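(* Let $\mathbf{s},\mathbf{t},\boldsymbol{\varepsilon},\boldsymbol{\sigma}\in\mathbb{R}^j$ be such that for every $l\in\{1,\dots,j\}$: $s_l+t_l>n_l/2$, $0<\varepsilon_l<s_l+t_l-n_l/2$, and $\sigma_l=\min\{s_l,\,t_l,\,s_l+t_l-n_l/2-\varepsilon_l\}$. If $1\le p,q,r\le\infty$ and $\frac1p+\frac1q=\frac1r$, then $$\mathcal{K}_p^{\mathbf{s}}(\mathbb{R}^n)\cdot\mathcal{K}_q^{\mathbf{t}}(\mathbb{R}^n)\subset\mathcal{K}_r^{\boldsymbol{\sigma}}(\mathbb{R}^n).$$
   Context: Fix $j\in\{1,\dots,n\}$ and a decomposition $\mathbb{R}^n=\mathbb{R}^{n_1}\times\dots\times\mathbb{R}^{n_j}$ with $n_1,\dots,n_j\ge1$; write $\xi=(\xi_1,\dots,\xi_j)$ accordingly. For $\mathbf{s}=(s_1,\dots,s_j)\in\mathbb{R}^j$ put $\langle\langle\xi\rangle\rangle^{\mathbf{s}}=\prod_{l=1}^j(1+|\xi_l|^2)^{s_l/2}$ and $\mathcal{H}^{\mathbf{s}}(\mathbb{R}^n)=\{u\in\mathcal{S}'(\mathbb{R}^n):\langle\langle D\rangle\rangle^{\mathbf{s}}u\in L^2(\mathbb{R}^n)\}$, $\|u\|_{\mathcal{H}^{\mathbf{s}}}=\|\langle\langle D\rangle\rangle^{\mathbf{s}}u\|_{L^2}$, where $\langle\langle D\rangle\rangle^{\mathbf{s}}$ is the Fourier multiplier with symbol $\langle\langle\xi\rangle\rangle^{\mathbf{s}}$.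 For $y\in\mathbb{R}^n$, $\tau_y\chi=\chi(\cdot-y)$. For $1\le p\le\infty$, $\mathcal{K}_p^{\mathbf{s}}(\mathbb{R}^n)$ is the set of $u\in\mathcal{D}'(\mathbb{R}^n)$ for which there is $\chi\in\mathcal{C}_0^\infty(\mathbb{R}^n)\smallsetminus\{0\}$ such that the function $y\mapsto\|u\,\tau_y\chi\|_{\mathcal{H}^{\mathbf{s}}}$ belongs to $L^p(\mathbb{R}^n)$ (this does not depend on $\chi$). For subspaces $A,B$ of distributions, $A\cdot B\subset C$ means that $uv\in C$ for all $u\in A$, $v\in B$. The product of $u$, locally in $\mathcal{H}^{\mathbf{s}}$, and $v$, locally in $\mathcal{H}^{\mathbf{t}}$, with $s_l+t_l\ge0$ for all $l$, is the distribution $\langle uv,\varphi\rangle=\langle\chi u,\varphi v\rangle$ for $\varphi\in\mathcal{C}_0^\infty(\mathbb{R}^n)$, where $\chi\in\mathcal{C}_0^\infty(\mathbb{R}^n)$ equals $1$ near $\mathrm{supp}\,\varphi$ and the pairing is the bilinear duality between $\mathcal{H}^{\mathbf{s}}$ and $\mathcal{H}^{-\mathbf{s}}\supset\mathcal{H}^{\mathbf{t}}$; it agrees with the continuous extension of pointwise multiplication of Schwartz functions. *)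

theory Defs
  imports "HOL-Analysis.Analysis"
begin

section \<open>Smooth functions, test functions, Schwartz functions\<close>

definition partial_deriv :: "'n::finite \<Rightarrow> (real^'n \<Rightarrow> complex) \<Rightarrow> real^'n \<Rightarrow> complex" where
  "partial_deriv i f = (\<lambda>x. frechet_derivative f (at x) (axis i 1))"

text \<open>A multi-index is given by the list of the directions of differentiation,
  so that its order is the length of the list.\<close>

definition partials :: "'n::finite list \<Rightarrow> (real^'n \<Rightarrow> complex) \<Rightarrow> real^'n \<Rightarrow> complex" where
  "partials \<alpha> f = foldr partial_deriv \<alpha> f"

definition smooth :: "(real^'n::finite \<Rightarrow> complex) \<Rightarrow> bool" where
  "smooth f \<longleftrightarrow> (\<forall>\<alpha> x. partials \<alpha> f differentiable (at x))"

definition supp :: "(real^'n::finite \<Rightarrow> complex) \<Rightarrow> (real^'n) set" where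
  "supp f = closure {x. f x \<noteq> 0}"

definition test_functions :: "(real^'n::finite \<Rightarrow> complex) set" where
  "test_functions = {\<phi>. smooth \<phi> \<and> compact (supp \<phi>)}"

definition schwartz_functions :: "(real^'n::finite \<Rightarrow> complex) set" where
  "schwartz_functions = {\<phi>. smooth \<phi> \<and>
     (\<forall>k \<alpha>. bounded (range (\<lambda>x. (1 + norm x) ^ k *\<^sub>R partials \<alpha> \<phi> x)))}"

definition translate :: "real^'n::finite \<Rightarrow> (real^'n \<Rightarrow> complex) \<Rightarrow> real^'n \<Rightarrow> complex" where
  "translate y f = (\<lambda>x. f (x - y))"

section \<open>Distributions\<close>

text \<open>A (tempered) distribution is represented by a functional on all functions, of which only
  the values on test functions (Schwartz functions) are meaningful: every notion below is
  insensitive to the remaining values.\<close>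

type_synonym 'n functional = "(real^'n \<Rightarrow> complex) \<Rightarrow> complex"

definition linear_functional_on :: "(real^'n::finite \<Rightarrow> complex) set \<Rightarrow> 'n functional \<Rightarrow> bool" where
  "linear_functional_on S u \<longleftrightarrow>
     (\<forall>\<phi>\<in>S. \<forall>\<psi>\<in>S. u (\<lambda>x. \<phi> x + \<psi> x) = u \<phi> + u \<psi>) \<and>
     (\<forall>c. \<forall>\<phi>\<in>S. u (\<lambda>x. c * \<phi> x) = c * u \<phi>)"

definition distributions :: "'n::finite functional set" where
  "distributions = {u. linear_functional_on test_functions u \<and>
     (\<forall>K. compact K \<longrightarrow> (\<exists>C N. \<forall>\<phi>\<in>test_functions. supp \<phi> \<subseteq> K \<longrightarrow>
        cmod (u \<phi>) \<le> C * (\<Sum>\<alpha> | length \<alpha> \<le> N. SUP x. cmod (partials \<alpha> \<phi> x))))}"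

definition tempered_distributions :: "'n::finite functional set" where
  "tempered_distributions = {u. linear_functional_on schwartz_functions u \<and>
     (\<exists>C N. \<forall>\<phi>\<in>schwartz_functions.
        cmod (u \<phi>) \<le> C * (\<Sum>\<alpha> | length \<alpha> \<le> N. SUP x. (1 + norm x) ^ N * cmod (partials \<alpha> \<phi> x)))}"

text \<open>The product of a function and a functional. If \<open>a\<close> is a test function and \<open>u\<close> a distribution,
  the values of \<open>fun_mult a u\<close> on Schwartz functions only involve values of \<open>u\<close> on test functions,
  so that \<open>fun_mult a u\<close> directly is the tempered extension of the compactly supported
  distribution \<open>a u\<close>.\<close>

definition fun_mult :: "(real^'n::finite \<Rightarrow> complex) \<Rightarrow> 'n functional \<Rightarrow> 'n functional" where
  "fun_mult a u = (\<lambda>\<phi>. u (\<lambda>x. a x * \<phi> x))"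

section \<open>Lebesgue spaces\<close>

definition Lp_space ::
    "ennreal \<Rightarrow> ('a::euclidean_space \<Rightarrow> 'b::real_normed_vector) set" where
  "Lp_space p = {f. f \<in> borel_measurable lebesgue \<and>
     (if p = \<infinity> then \<exists>C. AE x in lebesgue. norm (f x) \<le> C
      else integrable lebesgue (\<lambda>x. norm (f x) powr enn2real p))}"

definition is_density :: "(real^'n::finite \<Rightarrow> complex) \<Rightarrow> 'n functional \<Rightarrow> bool" where
  "is_density f u \<longleftrightarrow> (\<forall>\<phi>\<in>schwartz_functions. u \<phi> = (LINT x|lebesgue. f x * \<phi> x))"

definition in_L2 :: "'n::finite functional \<Rightarrow> bool" where
  "in_L2 u \<longleftrightarrow> (\<exists>f\<in>Lp_space 2. is_density f u)"

text \<open>The function with which a tempered distribution in \<open>L\<^sup>2\<close> is identified; it is unique up to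
  equality almost everywhere.\<close>

definition L2_density :: "'n::finite functional \<Rightarrow> real^'n \<Rightarrow> complex" where
  "L2_density u = (SOME f. f \<in> Lp_space 2 \<and> is_density f u)"

definition L2_norm :: "'n::finite functional \<Rightarrow> real" where
  "L2_norm u = sqrt (LINT x|lebesgue. (cmod (L2_density u x))\<^sup>2)"

section \<open>Fourier transform and Fourier multipliers\<close>

definition fourier :: "(real^'n::finite \<Rightarrow> complex) \<Rightarrow> real^'n \<Rightarrow> complex" where
  "fourier \<phi> = (\<lambda>\<xi>. LINT x|lebesgue. cis (- (x \<bullet> \<xi>)) * \<phi> x)"

definition inv_fourier :: "(real^'n::finite \<Rightarrow> complex) \<Rightarrow> real^'n \<Rightarrow> complex" where
  "inv_fourier \<phi> =
     (\<lambda>x. (LINT \<xi>|lebesgue. cis (x \<bullet> \<xi>) * \<phi> \<xi>) / complex_of_real ((2 * pi) ^ CARD('n)))"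

definition fourier_distr :: "'n::finite functional \<Rightarrow> 'n functional" where
  "fourier_distr u = (\<lambda>\<phi>. u (fourier \<phi>))"

definition inv_fourier_distr :: "'n::finite functional \<Rightarrow> 'n functional" where
  "inv_fourier_distr u = (\<lambda>\<phi>. u (inv_fourier \<phi>))"

definition fourier_multiplier :: "(real^'n::finite \<Rightarrow> complex) \<Rightarrow> 'n functional \<Rightarrow> 'n functional" where
  "fourier_multiplier m u = inv_fourier_distr (fun_mult m (fourier_distr u))"

section \<open>Sobolev spaces of multiple order and Kato-Sobolev spaces\<close>

text \<open>A decomposition of \<open>\<real>\<^sup>n\<close> into \<open>j\<close> factors is given by the map \<open>b\<close> sending each coordinate to
  the factor it belongs to. All factors have positive dimension iff \<open>b\<close> is surjective.\<close>

definition block_dim :: "('n::finite \<Rightarrow> 'j::finite) \<Rightarrow> 'j \<Rightarrow> nat" where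
  "block_dim b l = card {i. b i = l}"

definition block_norm :: "('n::finite \<Rightarrow> 'j::finite) \<Rightarrow> 'j \<Rightarrow> real^'n \<Rightarrow> real" where
  "block_norm b l \<xi> = sqrt (\<Sum>i | b i = l. (\<xi> $ i)\<^sup>2)"

definition bracket :: "('n::finite \<Rightarrow> 'j::finite) \<Rightarrow> real^'j \<Rightarrow> real^'n \<Rightarrow> real" where
  "bracket b s \<xi> = (\<Prod>l\<in>UNIV. (1 + (block_norm b l \<xi>)\<^sup>2) powr (s $ l / 2))"

definition bracket_D :: "('n::finite \<Rightarrow> 'j::finite) \<Rightarrow> real^'j \<Rightarrow> 'n functional \<Rightarrow> 'n functional" where
  "bracket_D b s = fourier_multiplier (\<lambda>\<xi>. complex_of_real (bracket b s \<xi>))"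

definition sobolev_space :: "('n::finite \<Rightarrow> 'j::finite) \<Rightarrow> real^'j \<Rightarrow> 'n functional set" where
  "sobolev_space b s = {u \<in> tempered_distributions. in_L2 (bracket_D b s u)}"

definition sobolev_norm :: "('n::finite \<Rightarrow> 'j::finite) \<Rightarrow> real^'j \<Rightarrow> 'n functional \<Rightarrow> real" where
  "sobolev_norm b s u = L2_norm (bracket_D b s u)"

text \<open>That the real-valued function \<open>y \<mapsto> \<parallel>u \<tau>\<^sub>y\<theta>\<parallel>\<close> is in \<open>L\<^sup>p\<close> includes that it is defined at every \<open>y\<close>.\<close>

definition kato_sobolev ::
    "('n::finite \<Rightarrow> 'j::finite) \<Rightarrow> ennreal \<Rightarrow> real^'j \<Rightarrow> 'n functional set" where
  "kato_sobolev b p s = {u \<in> distributions. \<exists>\<theta>\<in>test_functions - {\<lambda>x. 0}.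
     (\<forall>y. fun_mult (translate y \<theta>) u \<in> sobolev_space b s) \<and>
     (\<lambda>y. sobolev_norm b s (fun_mult (translate y \<theta>) u)) \<in> Lp_space p}"

section \<open>The product of distributions\<close>

text \<open>The bilinear duality between the Sobolev spaces of orders \<open>s\<close> and \<open>-s\<close>. The symbol of
  \<open>bracket_D b s\<close> being even, this extends \<open>(f, g) \<mapsto> \<integral> f g\<close> from Schwartz functions.\<close>

definition sobolev_pairing ::
    "('n::finite \<Rightarrow> 'j::finite) \<Rightarrow> real^'j \<Rightarrow> 'n functional \<Rightarrow> 'n functional \<Rightarrow> complex" where
  "sobolev_pairing b s f g =
     (LINT x|lebesgue. L2_density (bracket_D b s f) x * L2_density (bracket_D b (- s) g) x)"

definition cutoff_for :: "(real^'n::finite \<Rightarrow> complex) \<Rightarrow> real^'n \<Rightarrow> complex" where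
  "cutoff_for \<phi> = (SOME \<theta>. \<theta> \<in> test_functions \<and> (\<exists>U. open U \<and> supp \<phi> \<subseteq> U \<and> (\<forall>x\<in>U. \<theta> x = 1)))"

text \<open>The product of \<open>u\<close>, locally of Sobolev order \<open>s\<close>, and \<open>v\<close>, locally of some order \<open>t\<close> with
  \<open>s + t \<ge> 0\<close> componentwise. Its values do not depend on the cutoff that is chosen.\<close>

definition distr_prod ::
    "('n::finite \<Rightarrow> 'j::finite) \<Rightarrow> real^'j \<Rightarrow> 'n functional \<Rightarrow> 'n functional \<Rightarrow> 'n functional" where
  "distr_prod b s u v = (\<lambda>\<phi>. sobolev_pairing b s (fun_mult (cutoff_for \<phi>) u) (fun_mult \<phi> v))"

end

theory Submission
  imports Defs "HOL-Probability.Characteristic_Functions" "HOL-Real_Asymp.Real_Asymp"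
begin

text \<open>
  The proof takes place on the Fourier side. By Plancherel's theorem a functional \<open>u\<close> is in the Sobolev space
  of order \<open>s\<close> iff its Fourier transform is a measurable function \<open>F\<close> with \<open>\<langle>\<langle>\<xi>\<rangle>\<rangle>\<^sup>s F \<in> L\<^sup>2\<close>, and the norm of this
  function is \<open>(2\<pi>)\<^sup>n\<^sup>/\<^sup>2\<close> times the Sobolev norm (\<open>sobolev_space_fourier_rep\<close>, \<open>fourier_rep_sobolev\<close>). The duality
  pairing becomes \<open>(2\<pi>)\<^sup>-\<^sup>n \<integral>F(\<xi>)G(-\<xi>)d\<xi>\<close> (\<open>fourier_rep_pairing\<close>), and multiplication becomes convolution up to the
  same constant (\<open>pairing_convolution\<close>).

  The heart of the matter is the estimate \<open>\<parallel>\<langle>\<langle>\<xi>\<rangle>\<rangle>\<^sup>\<sigma>(F * G)\<parallel> \<le> C \<parallel>\<langle>\<langle>\<xi>\<rangle>\<rangle>\<^sup>sF\<parallel> \<parallel>\<langle>\<langle>\<xi>\<rangle>\<rangle>\<^sup>tG\<parallel>\<close> of \<open>L\<^sup>2\<close> norms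
  (\<open>convolution_bound\<close>). By the inequality of Cauchy and Schwarz it suffices that the integral over \<open>\<eta>\<close> of the
  square of the kernel \<open>\<langle>\<langle>\<xi>\<rangle>\<rangle>\<^sup>\<sigma>\<langle>\<langle>\<xi> - \<eta>\<rangle>\<rangle>\<^sup>-\<^sup>s\<langle>\<langle>\<eta>\<rangle>\<rangle>\<^sup>-\<^sup>t\<close> is bounded in \<open>\<xi>\<close> (\<open>kernel_integral_bound\<close>). The kernel is a
  product over the blocks, and the conditions on the exponents ensure that the square of each factor is at
  most a constant times \<open>\<langle>\<xi>\<^sub>l - \<eta>\<^sub>l\<rangle>\<^sup>-\<^sup>2\<^sup>\<delta> + \<langle>\<eta>\<^sub>l\<rangle>\<^sup>-\<^sup>2\<^sup>\<delta>\<close> with \<open>\<delta> = n\<^sub>l/2 + \<epsilon>\<^sub>l\<close> (\<open>kernel_block\<close>). Both terms are integrable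
  over the block because \<open>\<delta> > n\<^sub>l/2\<close>.

  It remains to localise. Let \<open>\<theta>\<^sub>1\<close> and \<open>\<theta>\<^sub>2\<close> be windows for \<open>u\<close> and \<open>v\<close>, translated such that neither vanishes at the
  origin. Then \<open>\<theta>\<^sub>1\<theta>\<^sub>2\<close> is a window for \<open>uv\<close>, and \<open>(\<tau>\<^sub>y\<theta>\<^sub>1 \<tau>\<^sub>y\<theta>\<^sub>2)uv\<close> is the product of \<open>(\<tau>\<^sub>y\<theta>\<^sub>1)u\<close> and \<open>(\<tau>\<^sub>y\<theta>\<^sub>2)v\<close>
  (\<open>distr_prod_fourier_rep\<close>). This identity has to be extracted from a definition of the product that involves
  a cutoff chosen separately for each test function; the choice is immaterial since a cutoff may be moved from one
  factor of the pairing to the other (\<open>pairing_fun_mult\<close>). For these manipulations \<open>\<kappa>u\<close> has to be of order \<open>s\<close> for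
  every test function \<open>\<kappa>\<close>, which follows from the hypothesis on one window by a compactness argument
  (\<open>local_sobolev\<close>). By the convolution estimate, the norm of the localised product at \<open>y\<close> is at most a constant
  times the product of the norms of the localised factors, and Hoelder's inequality finishes the proof. That the norm
  depends measurably on \<open>y\<close> is a separate point (\<open>sobolev_norm_translate_borel\<close>).

  Plancherel's theorem is proved by regularisation with Gaussians: this gives the inversion formula on Schwartz
  functions and one inequality between the norms; the other inequality and Parseval's formula follow from inversion
  and polarisation (\<open>fourier_pair_sqnorm\<close>, \<open>fourier_pair_parseval\<close>).
\<close>

section \<open>Smooth functions\<close>

lemma partial_deriv_eqI:
  assumes "\<And>x. (f has_derivative f' x) (at x)"
  shows "partial_deriv i f = (\<lambda>x. f' x (axis i 1))"
  using frechet_derivative_at[OF assms] by (simp add: partial_deriv_def fun_eq_iff)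

text \<open>Being smooth is the largest property of differentiable functions that is inherited by partial
  derivatives. This is how every closure property is obtained: one exhibits a class of differentiable functions
  that contains the given one and is stable under partial derivatives.\<close>

lemma smooth_coinduct:
  assumes "P f"
    and step: "\<And>g. P g \<Longrightarrow> (\<forall>x. g differentiable (at x)) \<and> (\<forall>i. P (partial_deriv i g))"
  shows "smooth f"
proof -
  have "P (partials \<alpha> f)" for \<alpha>
    by (induction \<alpha>) (use assms in \<open>auto simp: partials_def\<close>)
  then show ?thesis using step by (auto simp: smooth_def)
qed

lemma smooth_differentiable: "smooth f \<Longrightarrow> f differentiable (at x)"
  unfolding smooth_def by (metis foldr.simps(1) id_apply partials_def)

lemma smooth_has_derivative: "smooth f \<Longrightarrow> (f has_derivative frechet_derivative f (at x)) (at x)"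
  using smooth_differentiable frechet_derivative_works by blast

lemma partials_snoc: "partials \<alpha> (partial_deriv i f) = partials (\<alpha> @ [i]) f"
  by (simp add: partials_def)

lemma partials_Nil [simp]: "partials [] f = f"
  by (simp add: partials_def)

lemma partials_Cons: "partials (i # \<alpha>) f = partial_deriv i (partials \<alpha> f)"
  by (simp add: partials_def)

lemma smooth_partial_deriv: "smooth f \<Longrightarrow> smooth (partial_deriv i f)"
  by (simp add: smooth_def partials_snoc)

lemma smooth_continuous: "smooth f \<Longrightarrow> continuous_on UNIV f"
  using smooth_differentiable differentiable_imp_continuous_within
  by (metis continuous_at_imp_continuous_on)

lemma smooth_borel: "smooth f \<Longrightarrow> f \<in> borel_measurable borel"
  by (intro borel_measurable_continuous_onI smooth_continuous)

text \<open>The functions \<open>t\<^sup>-\<^sup>k e\<^sup>-\<^sup>1\<^sup>/\<^sup>t\<close> on the positive half-line, extended by zero. The whole family is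
  needed since it, and not its first member, is stable under differentiation up to linear combinations.\<close>

definition flat_exp :: "nat \<Rightarrow> real \<Rightarrow> real" where
  "flat_exp k t = (if t > 0 then inverse t ^ k * exp (- inverse t) else 0)"

lemma flat_exp_nonneg: "flat_exp k t \<ge> 0"
  by (auto simp: flat_exp_def)

lemma flat_exp_pos_iff: "flat_exp k t > 0 \<longleftrightarrow> t > 0"
  by (auto simp: flat_exp_def)

lemma flat_exp_eq_0_iff: "flat_exp k t = 0 \<longleftrightarrow> t \<le> 0"
  by (auto simp: flat_exp_def)

text \<open>The bound that makes the derivative at the origin vanish; it comes from
  \<open>(1 + x/n)\<^sup>n \<le> e\<^sup>x\<close> with \<open>x = 1/t\<close> and \<open>n = k + 1\<close>.\<close>

lemma flat_exp_le: "flat_exp k t \<le> (real (Suc k) ^ Suc k) * \<bar>t\<bar>"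
proof (cases "t > 0")
  case True
  have "(inverse t / real (Suc k)) ^ Suc k \<le> (1 + inverse t / real (Suc k)) ^ Suc k"
    using True by (intro power_mono) auto
  also have "\<dots> \<le> exp (inverse t)"
    using True by (intro exp_ge_one_plus_x_over_n_power_n) (auto intro: order_trans[of _ 0])
  finally have "inverse t ^ Suc k / real (Suc k) ^ Suc k \<le> exp (inverse t)"
    by (simp only: power_divide)
  then have "inverse t ^ Suc k \<le> exp (inverse t) * real (Suc k) ^ Suc k"
    by (subst (asm) pos_divide_le_eq) (auto simp del: power_Suc of_nat_Suc)
  then have "inverse t ^ Suc k * exp (- inverse t) \<le> exp (inverse t) * real (Suc k) ^ Suc k * exp (- inverse t)"
    by (intro mult_right_mono) auto
  also have "\<dots> = real (Suc k) ^ Suc k * (exp (inverse t) * exp (- inverse t))"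
    by (simp only: mult_ac)
  finally have "inverse t ^ Suc k * exp (- inverse t) \<le> real (Suc k) ^ Suc k"
    by (simp add: exp_minus del: power_Suc of_nat_Suc)
  then have "t * (inverse t ^ Suc k * exp (- inverse t)) \<le> t * (real (Suc k) ^ Suc k)"
    using True by (intro mult_left_mono) auto
  moreover have "t * (inverse t ^ Suc k * exp (- inverse t)) = flat_exp k t" using True by (simp add: flat_exp_def)
  ultimately show ?thesis using True by (simp only: mult.commute abs_of_pos)
next
  case False
  then have "flat_exp k t = 0" by (simp add: flat_exp_def)
  then show ?thesis by (simp only: ) (intro mult_nonneg_nonneg zero_le_power; simp)
qed

lemma flat_exp_deriv:
  "(flat_exp k has_real_derivative (flat_exp (k + 2) t - real k * flat_exp (k + 1) t)) (at t)"
proof -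
  consider "t > 0" | "t < 0" | "t = 0" by linarith
  then show ?thesis
  proof cases
    case 1
    have "((\<lambda>t. inverse t ^ k * exp (- inverse t)) has_real_derivative
        (flat_exp (k + 2) t - real k * flat_exp (k + 1) t)) (at t)"
    proof (cases k)
      case 0
      then show ?thesis
        using 1 by (auto intro!: derivative_eq_intros simp: flat_exp_def power2_eq_square field_simps)
    next
      case (Suc m)
      have e: "t ^ j = t * t ^ (j - Suc 0)" if "j \<noteq> 0" for j using that by (cases j) auto
      show ?thesis
        using 1 Suc by (cases m)
          (auto intro!: derivative_eq_intros simp: flat_exp_def power2_eq_square field_simps, use e in blast)
    qed
    then show ?thesis
      by (rule has_field_derivative_transform_within_open[where S = "{0<..}"]) (use 1 in \<open>auto simp: flat_exp_def\<close>)
  next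
    case 2
    have "((\<lambda>t. 0) has_real_derivative (flat_exp (k + 2) t - real k * flat_exp (k + 1) t)) (at t)"
      using 2 by (auto simp: flat_exp_def)
    then show ?thesis
      by (rule has_field_derivative_transform_within_open[where S = "{..<0}"]) (use 2 in \<open>auto simp: flat_exp_def\<close>)
  next
    case 3
    have "((\<lambda>h. flat_exp k h / h) \<longlongrightarrow> 0) (at 0)"
    proof (rule tendsto_0_le[where K = 1])
      have *: "flat_exp k h / h = flat_exp (Suc k) h" if "h \<noteq> 0" for h
        using that by (auto simp: flat_exp_def field_simps)
      show "((\<lambda>h. (real (Suc (Suc k)) ^ Suc (Suc k)) * \<bar>h\<bar>) \<longlongrightarrow> (0::real)) (at 0)"
        by (auto intro!: tendsto_eq_intros simp del: power_Suc of_nat_Suc)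
      show "\<forall>\<^sub>F h in at 0. norm (flat_exp k h / h) \<le> norm ((real (Suc (Suc k)) ^ Suc (Suc k)) * \<bar>h\<bar>) * 1"
        unfolding eventually_at_filter
        by (rule always_eventually)
          (use * flat_exp_le[of "Suc k"] flat_exp_nonneg in \<open>auto simp: abs_mult simp del: power_Suc of_nat_Suc\<close>)
    qed
    then show ?thesis using 3 unfolding DERIV_def by (simp add: flat_exp_eq_0_iff[THEN iffD2])
  qed
qed

text \<open>All operations used below to build smooth functions. The class is closed under partial
  derivatives, which is why the reciprocals, the real powers and the compositions with \<^const>\<open>flat_exp\<close>
  have to be included together with sums and products.\<close>

inductive smooth_closure :: "(real^'n::finite \<Rightarrow> complex) \<Rightarrow> bool" where
  base: "smooth f \<Longrightarrow> smooth_closure f"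
| const: "smooth_closure (\<lambda>x. c)"
| coord: "smooth_closure (\<lambda>x. of_real (x $ i))"
| cis: "smooth_closure (\<lambda>x. cis (x \<bullet> y))"
| Re: "smooth_closure f \<Longrightarrow> smooth_closure (\<lambda>x. of_real (Re (f x)))"
| cnj: "smooth_closure f \<Longrightarrow> smooth_closure (\<lambda>x. cnj (f x))"
| add: "smooth_closure f \<Longrightarrow> smooth_closure g \<Longrightarrow> smooth_closure (\<lambda>x. f x + g x)"
| mult: "smooth_closure f \<Longrightarrow> smooth_closure g \<Longrightarrow> smooth_closure (\<lambda>x. f x * g x)"
| inverse: "smooth_closure f \<Longrightarrow> (\<And>x. f x \<noteq> 0) \<Longrightarrow> smooth_closure (\<lambda>x. inverse (f x))"
| flat_exp: "smooth_closure f \<Longrightarrow> smooth_closure (\<lambda>x. of_real (flat_exp k (Re (f x))))"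
| powr: "smooth_closure f \<Longrightarrow> (\<And>x. Re (f x) > 0) \<Longrightarrow> smooth_closure (\<lambda>x. of_real (Re (f x) powr a))"
| affine: "smooth_closure f \<Longrightarrow> smooth_closure (\<lambda>x. f (c *\<^sub>R x + y))"

lemma smooth_closure_derivative:
  "smooth_closure f \<Longrightarrow> \<exists>f'. (\<forall>x. (f has_derivative f' x) (at x)) \<and> (\<forall>i. smooth_closure (\<lambda>x. f' x (axis i 1)))"
proof (induction rule: smooth_closure.induct)
  case (base f)
  then show ?case
    using smooth_has_derivative[OF base] smooth_closure.base[OF smooth_partial_deriv[OF base]]
    by (intro exI[of _ "\<lambda>x. frechet_derivative f (at x)"]) (auto simp: partial_deriv_def)
next
  case (const c)
  then show ?case by (intro exI[of _ "\<lambda>x h. 0"]) (auto intro: smooth_closure.const)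
next
  case (coord j)
  have *: "((\<lambda>x::real^'a. complex_of_real (x $ j)) has_derivative (\<lambda>h. of_real (h $ j))) (at x)" for x
    by (auto intro!: derivative_eq_intros bounded_linear.has_derivative[OF bounded_linear_vec_nth])
  show ?case
    by (intro exI[of _ "\<lambda>x h. of_real (h $ j)"]) (auto simp: * intro: smooth_closure.const)
next
  case (cis y)
  have *: "((\<lambda>x. cis (x \<bullet> y)) has_derivative (\<lambda>h. of_real (h \<bullet> y) * (\<i> * cis (x \<bullet> y)))) (at x)" for x :: "real^'a"
    by (auto intro!: derivative_eq_intros simp: scaleR_conv_of_real)
  show ?case
    by (intro exI[of _ "\<lambda>x h. of_real (h \<bullet> y) * (\<i> * cis (x \<bullet> y))"])
      (auto simp: * inner_axis' intro!: smooth_closure.mult smooth_closure.const smooth_closure.cis)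
next
  case (Re f)
  then obtain f' where f': "\<And>x. (f has_derivative f' x) (at x)" "\<And>i. smooth_closure (\<lambda>x. f' x (axis i 1))"
    by blast
  show ?case
    using f' by (intro exI[of _ "\<lambda>x h. of_real (Re (f' x h))"])
      (auto intro!: derivative_eq_intros smooth_closure.Re bounded_linear.has_derivative[OF bounded_linear_of_real])
next
  case (cnj f)
  then obtain f' where f': "\<And>x. (f has_derivative f' x) (at x)" "\<And>i. smooth_closure (\<lambda>x. f' x (axis i 1))"
    by blast
  show ?case
    using f' by (intro exI[of _ "\<lambda>x h. cnj (f' x h)"])
      (auto intro!: derivative_eq_intros smooth_closure.cnj bounded_linear.has_derivative[OF bounded_linear_cnj])
next
  case (add f g)
  then obtain f' g' where f': "\<And>x. (f has_derivative f' x) (at x)" "\<And>i. smooth_closure (\<lambda>x. f' x (axis i 1))"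
    and g': "\<And>x. (g has_derivative g' x) (at x)" "\<And>i. smooth_closure (\<lambda>x. g' x (axis i 1))"
    by blast
  show ?case
    using f' g' by (intro exI[of _ "\<lambda>x h. f' x h + g' x h"])
      (auto intro!: derivative_eq_intros smooth_closure.add)
next
  case (mult f g)
  then obtain f' g' where f': "\<And>x. (f has_derivative f' x) (at x)" "\<And>i. smooth_closure (\<lambda>x. f' x (axis i 1))"
    and g': "\<And>x. (g has_derivative g' x) (at x)" "\<And>i. smooth_closure (\<lambda>x. g' x (axis i 1))"
    by blast
  show ?case
    using f' g' mult.hyps by (intro exI[of _ "\<lambda>x h. f x * g' x h + f' x h * g x"])
      (auto intro!: derivative_eq_intros smooth_closure.add smooth_closure.mult)
next
  case (inverse f)
  then obtain f' where f': "\<And>x. (f has_derivative f' x) (at x)" "\<And>i. smooth_closure (\<lambda>x. f' x (axis i 1))"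
    by blast
  have "smooth_closure (\<lambda>x. (-1) * (inverse (f x) * f' x (axis i 1) * inverse (f x)))" for i
    using f' inverse.hyps by (intro smooth_closure.mult smooth_closure.inverse smooth_closure.const)
  then show ?case
    using f' inverse.hyps by (intro exI[of _ "\<lambda>x h. - (inverse (f x) * f' x h * inverse (f x))"])
      (auto intro!: has_derivative_inverse)
next
  case (flat_exp f k)
  then obtain f' where f': "\<And>x. (f has_derivative f' x) (at x)" "\<And>i. smooth_closure (\<lambda>x. f' x (axis i 1))"
    by blast
  have d: "(flat_exp k has_derivative (\<lambda>h. (flat_exp (k + 2) t - real k * flat_exp (k + 1) t) * h)) (at t)" for t
    using flat_exp_deriv[of k t] by (simp add: has_field_derivative_def)
  have 1: "((\<lambda>x. complex_of_real (flat_exp k (Re (f x)))) has_derivative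
      (\<lambda>h. of_real ((flat_exp (k + 2) (Re (f x)) - real k * flat_exp (k + 1) (Re (f x))) * Re (f' x h)))) (at x)" for x
    by (intro bounded_linear.has_derivative[OF bounded_linear_of_real]
        has_derivative_compose[OF _ d] bounded_linear.has_derivative[OF bounded_linear_Re] f'(1))
  have 2: "smooth_closure (\<lambda>x. (of_real (flat_exp (k + 2) (Re (f x))) + of_real (- real k) * of_real (flat_exp (k + 1) (Re (f x)))) *
      of_real (Re (f' x (axis i 1))))" for i
    using f' flat_exp.hyps by (intro smooth_closure.mult smooth_closure.add smooth_closure.const smooth_closure.flat_exp smooth_closure.Re)
  show ?case
    using 1 2 by (intro exI[of _ "\<lambda>x h. of_real ((flat_exp (k + 2) (Re (f x)) - real k * flat_exp (k + 1) (Re (f x))) * Re (f' x h))"])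
     auto
next
  case (powr f a)
  then obtain f' where f': "\<And>x. (f has_derivative f' x) (at x)" "\<And>i. smooth_closure (\<lambda>x. f' x (axis i 1))"
    by blast
  have d: "((\<lambda>t. t powr a) has_derivative (\<lambda>h. (a * t powr (a - 1)) * h)) (at t)" if "t > 0" for t
    using has_real_derivative_powr[OF that, of a] by (simp add: has_field_derivative_def)
  have 1: "((\<lambda>x. complex_of_real (Re (f x) powr a)) has_derivative
      (\<lambda>h. of_real (a * Re (f x) powr (a - 1) * Re (f' x h)))) (at x)" for x
    by (intro bounded_linear.has_derivative[OF bounded_linear_of_real]
        has_derivative_compose[OF _ d] bounded_linear.has_derivative[OF bounded_linear_Re] f'(1) powr.hyps)
  have 2: "smooth_closure (\<lambda>x. (of_real a * of_real (Re (f x) powr (a - 1))) *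
      of_real (Re (f' x (axis i 1))))" for i
    using f' powr.hyps by (intro smooth_closure.mult smooth_closure.add smooth_closure.const smooth_closure.powr smooth_closure.Re)
  show ?case
    using 1 2 by (intro exI[of _ "\<lambda>x h. of_real (a * Re (f x) powr (a - 1) * Re (f' x h))"]) auto
next
  case (affine f c y)
  then obtain f' where f': "\<And>x. (f has_derivative f' x) (at x)" "\<And>i. smooth_closure (\<lambda>x. f' x (axis i 1))"
    by blast
  have l: "linear (f' x)" for x using f'(1) has_derivative_linear by blast
  have sc: "f' z (c *\<^sub>R v) = of_real c * f' z v" for z v
    by (simp add: linear_scale[OF l] scaleR_conv_of_real[of c "f' z v"])
  have 1: "((\<lambda>x. f (c *\<^sub>R x + y)) has_derivative (\<lambda>h. f' (c *\<^sub>R x + y) (c *\<^sub>R h))) (at x)" for x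
    by (rule has_derivative_compose[OF _ f'(1)]) (auto intro!: derivative_eq_intros)
  have 2: "smooth_closure (\<lambda>x. of_real c * f' (c *\<^sub>R x + y) (axis i 1))" for i
    using smooth_closure.affine[OF f'(2)] by (intro smooth_closure.mult smooth_closure.const) auto
  show ?case
    using 1 2 by (intro exI[of _ "\<lambda>x h. f' (c *\<^sub>R x + y) (c *\<^sub>R h)"])
       (auto simp: sc)
qed

lemma smooth_closure_smooth: "smooth_closure f \<Longrightarrow> smooth f"
proof (erule smooth_coinduct)
  fix g :: "real^'a \<Rightarrow> complex" assume "smooth_closure g"
  then show "(\<forall>x. g differentiable (at x)) \<and> (\<forall>i. smooth_closure (partial_deriv i g))"
    using smooth_closure_derivative[of g] partial_deriv_eqI[of g] unfolding differentiable_def by metis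
qed

lemma smooth_const: "smooth (\<lambda>x. c)" by (rule smooth_closure_smooth[OF smooth_closure.const])
lemma smooth_coord: "smooth (\<lambda>x. of_real (x $ i))" by (rule smooth_closure_smooth[OF smooth_closure.coord])
lemma smooth_cis: "smooth (\<lambda>x. cis (x \<bullet> y))" by (rule smooth_closure_smooth[OF smooth_closure.cis])
lemma smooth_cnj: "smooth f \<Longrightarrow> smooth (\<lambda>x. cnj (f x))"
  by (rule smooth_closure_smooth) (intro smooth_closure.cnj smooth_closure.base)
lemma smooth_add: "smooth f \<Longrightarrow> smooth g \<Longrightarrow> smooth (\<lambda>x. f x + g x)"
  by (rule smooth_closure_smooth) (intro smooth_closure.add smooth_closure.base)
lemma smooth_mult: "smooth f \<Longrightarrow> smooth g \<Longrightarrow> smooth (\<lambda>x. f x * g x)"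
  by (rule smooth_closure_smooth) (intro smooth_closure.mult smooth_closure.base)
lemma smooth_inverse: "smooth f \<Longrightarrow> (\<And>x. f x \<noteq> 0) \<Longrightarrow> smooth (\<lambda>x. inverse (f x))"
  by (rule smooth_closure_smooth) (intro smooth_closure.inverse smooth_closure.base)
lemma smooth_flat_exp: "smooth f \<Longrightarrow> smooth (\<lambda>x. of_real (flat_exp k (Re (f x))))"
  by (rule smooth_closure_smooth) (intro smooth_closure.flat_exp smooth_closure.base)
lemma smooth_powr: "smooth f \<Longrightarrow> (\<And>x. Re (f x) > 0) \<Longrightarrow> smooth (\<lambda>x. of_real (Re (f x) powr a))"
  by (rule smooth_closure_smooth) (intro smooth_closure.powr smooth_closure.base)
lemma smooth_affine: "smooth f \<Longrightarrow> smooth (\<lambda>x. f (c *\<^sub>R x + y))"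
  by (rule smooth_closure_smooth) (intro smooth_closure.affine smooth_closure.base)
lemma smooth_sum: "(\<And>i. i \<in> I \<Longrightarrow> smooth (f i)) \<Longrightarrow> smooth (\<lambda>x. \<Sum>i\<in>I. f i x)"
  by (induction I rule: infinite_finite_induct) (auto intro!: smooth_const smooth_add)
lemma smooth_prod: "(\<And>i. i \<in> I \<Longrightarrow> smooth (f i)) \<Longrightarrow> smooth (\<lambda>x. \<Prod>i\<in>I. f i x)"
  by (induction I rule: infinite_finite_induct) (auto intro!: smooth_const smooth_mult)

section \<open>Schwartz functions\<close>

definition rapid :: "(real^'n::finite \<Rightarrow> complex) \<Rightarrow> bool" where
  "rapid f \<longleftrightarrow> (\<forall>k. \<exists>C. \<forall>x. (1 + norm x) ^ k * cmod (f x) \<le> C)"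

lemma schwartz_functions_iff: "f \<in> schwartz_functions \<longleftrightarrow> smooth f \<and> (\<forall>\<alpha>. rapid (partials \<alpha> f))"
proof -
  have "bounded (range (\<lambda>x. (1 + norm x) ^ k *\<^sub>R g x)) \<longleftrightarrow> (\<exists>C. \<forall>x. (1 + norm x) ^ k * cmod (g x) \<le> C)"
    for k and g :: "real^'a \<Rightarrow> complex"
    by (auto simp: bounded_iff power_abs)
  then show ?thesis
    by (auto simp: schwartz_functions_def rapid_def)
qed

text \<open>As for smoothness: it suffices to exhibit a class of rapidly decreasing functions that is
  stable under partial derivatives.\<close>

lemma schwartz_coinduct:
  assumes "P f"
    and step: "\<And>g. P g \<Longrightarrow> rapid g \<and> (\<forall>x. g differentiable (at x)) \<and> (\<forall>i. P (partial_deriv i g))"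
  shows "f \<in> schwartz_functions"
proof -
  have "P (partials \<alpha> f)" for \<alpha>
    by (induction \<alpha>) (use assms in \<open>auto simp: partials_def\<close>)
  then show ?thesis using step by (auto simp: smooth_def schwartz_functions_iff)
qed

lemma schwartz_smooth: "f \<in> schwartz_functions \<Longrightarrow> smooth f"
  by (simp add: schwartz_functions_iff)

lemma schwartz_rapid: "f \<in> schwartz_functions \<Longrightarrow> rapid f"
  unfolding schwartz_functions_iff by (metis partials_Nil)

lemma schwartz_partial_deriv: "f \<in> schwartz_functions \<Longrightarrow> partial_deriv i f \<in> schwartz_functions"
  by (simp add: schwartz_functions_iff smooth_partial_deriv partials_snoc)

lemma schwartz_partials: "f \<in> schwartz_functions \<Longrightarrow> partials \<alpha> f \<in> schwartz_functions"
  by (induction \<alpha>) (auto simp: partials_Cons schwartz_partial_deriv)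

text \<open>A class of multipliers of the Schwartz space that contains the brackets and is closed under
  partial derivatives; all its members grow at most polynomially.\<close>

inductive multiplier :: "(real^'n::finite \<Rightarrow> complex) \<Rightarrow> bool" where
  const: "multiplier (\<lambda>x. c)"
| coord: "multiplier (\<lambda>x. of_real (x $ i))"
| cis: "multiplier (\<lambda>x. cis (x \<bullet> y))"
| bracket: "multiplier (\<lambda>x. of_real ((1 + (\<Sum>i\<in>I. (x $ i)\<^sup>2)) powr a))"
| add: "multiplier f \<Longrightarrow> multiplier g \<Longrightarrow> multiplier (\<lambda>x. f x + g x)"
| mult: "multiplier f \<Longrightarrow> multiplier g \<Longrightarrow> multiplier (\<lambda>x. f x * g x)"

lemma sum_squares_le_norm: "(\<Sum>i\<in>I. (x $ i)\<^sup>2) \<le> (norm (x :: real^'n::finite))\<^sup>2"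
proof -
  have "(\<Sum>i\<in>I. (x $ i)\<^sup>2) \<le> (\<Sum>i\<in>UNIV. (x $ i)\<^sup>2)" by (intro sum_mono2) auto
  also have "\<dots> = (norm x)\<^sup>2" by (simp add: norm_vec_def L2_set_def sum_nonneg)
  finally show ?thesis .
qed

lemma multiplier_growth: "multiplier f \<Longrightarrow> \<exists>C k. C \<ge> 0 \<and> (\<forall>x. cmod (f x) \<le> C * (1 + norm x) ^ k)"
proof (induction rule: multiplier.induct)
  case (const c)
  then show ?case by (intro exI[of _ "cmod c"] exI[of _ 0]) auto
next
  case (coord i)
  have "\<bar>x $ i\<bar> \<le> 1 + norm x" for x :: "real^'a" using component_le_norm_cart[of x i] by linarith
  then show ?case by (intro exI[of _ 1] exI[of _ 1]) auto
next
  case (cis y)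
  then show ?case by (intro exI[of _ 1] exI[of _ 0]) auto
next
  case (bracket I a)
  define m where "m = nat \<lceil>\<bar>a\<bar>\<rceil>"
  have "(1 + (\<Sum>i\<in>I. (x $ i)\<^sup>2)) powr a \<le> 1 * (1 + norm x) ^ (2 * m)" for x :: "real^'a"
  proof -
    have 0: "(\<Sum>i\<in>I. (x $ i)\<^sup>2) \<ge> 0" by (intro sum_nonneg) auto
    have "(1 + (\<Sum>i\<in>I. (x $ i)\<^sup>2)) powr a \<le> (1 + (\<Sum>i\<in>I. (x $ i)\<^sup>2)) powr real m"
      using 0 by (intro powr_mono) (auto simp: m_def intro: order_trans[OF abs_ge_self])
    also have "\<dots> = (1 + (\<Sum>i\<in>I. (x $ i)\<^sup>2)) ^ m"
      using 0 by (subst powr_realpow) auto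
    also have "\<dots> \<le> ((1 + norm x)\<^sup>2) ^ m"
      using 0 sum_squares_le_norm[of x I] by (intro power_mono) (auto simp: power2_sum intro: order_trans)
    finally show ?thesis by (simp add: power_mult)
  qed
  then show ?case by (intro exI[of _ 1] exI[of _ "2 * m"]) auto
next
  case (add f g)
  then obtain C k D l where C: "C \<ge> 0" "\<And>x. cmod (f x) \<le> C * (1 + norm x) ^ k"
    and D: "D \<ge> 0" "\<And>x. cmod (g x) \<le> D * (1 + norm x) ^ l" by blast
  have "cmod (f x + g x) \<le> (C + D) * (1 + norm x) ^ (k + l)" for x
  proof -
    have "C * (1 + norm x) ^ k \<le> C * (1 + norm x) ^ (k + l)" "D * (1 + norm x) ^ l \<le> D * (1 + norm x) ^ (k + l)"
      using C(1) D(1) by (auto intro!: mult_left_mono power_increasing)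
    then show ?thesis using norm_triangle_ineq[of "f x" "g x"] C(2)[of x] D(2)[of x]
      unfolding distrib_right by linarith
  qed
  then show ?case using C D by (intro exI[of _ "C + D"] exI[of _ "k + l"]) auto
next
  case (mult f g)
  then obtain C k D l where C: "C \<ge> 0" "\<And>x. cmod (f x) \<le> C * (1 + norm x) ^ k"
    and D: "D \<ge> 0" "\<And>x. cmod (g x) \<le> D * (1 + norm x) ^ l" by blast
  have "cmod (f x * g x) \<le> (C * D) * (1 + norm x) ^ (k + l)" for x
    using mult_mono[OF C(2) D(2), of x x] C(1) by (simp add: norm_mult power_add mult_ac)
  then show ?case using C D by (intro exI[of _ "C * D"] exI[of _ "k + l"]) auto
qed

lemma multiplier_smooth: "multiplier f \<Longrightarrow> smooth f"
proof (induction rule: multiplier.induct)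
  case (bracket I a)
  have 0: "(\<Sum>i\<in>I. (x $ i)\<^sup>2) \<ge> 0" for x :: "real^'a" by (intro sum_nonneg) auto
  have "smooth (\<lambda>x::real^'a. 1 + (\<Sum>i\<in>I. of_real (x $ i) * of_real (x $ i)))"
    by (intro smooth_add smooth_const smooth_sum smooth_mult smooth_coord)
  then have "smooth (\<lambda>x::real^'a. complex_of_real (Re (1 + (\<Sum>i\<in>I. of_real (x $ i) * of_real (x $ i))) powr a))"
    by (rule smooth_powr) (use 0 in \<open>auto simp: power2_eq_square add_pos_nonneg\<close>)
  then show ?case by (simp add: power2_eq_square)
qed (auto intro!: smooth_const smooth_coord smooth_cis smooth_add smooth_mult)

lemma multiplier_derivative: "multiplier f \<Longrightarrow> \<exists>f'. (\<forall>x. (f has_derivative f' x) (at x)) \<and> (\<forall>i. multiplier (\<lambda>x. f' x (axis i 1)))"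
proof (induction rule: multiplier.induct)
  case (const c)
  then show ?case by (intro exI[of _ "\<lambda>x h. 0"]) (auto intro: multiplier.const)
next
  case (coord j)
  have *: "((\<lambda>x::real^'a. complex_of_real (x $ j)) has_derivative (\<lambda>h. of_real (h $ j))) (at x)" for x
    by (auto intro!: derivative_eq_intros bounded_linear.has_derivative[OF bounded_linear_vec_nth])
  show ?case
    by (intro exI[of _ "\<lambda>x h. of_real (h $ j)"]) (auto simp: * intro: multiplier.const)
next
  case (cis y)
  have *: "((\<lambda>x. cis (x \<bullet> y)) has_derivative (\<lambda>h. of_real (h \<bullet> y) * (\<i> * cis (x \<bullet> y)))) (at x)" for x :: "real^'a"
    by (auto intro!: derivative_eq_intros simp: scaleR_conv_of_real)
  show ?case
    by (intro exI[of _ "\<lambda>x h. of_real (h \<bullet> y) * (\<i> * cis (x \<bullet> y))"])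
      (auto simp: * inner_axis' intro!: multiplier.mult multiplier.const multiplier.cis)
next
  case (bracket I a)
  have 0: "1 + (\<Sum>i\<in>I. (x $ i)\<^sup>2) > 0" for x :: "real^'a" by (intro add_pos_nonneg sum_nonneg) auto
  have d: "((\<lambda>t. t powr a) has_derivative (\<lambda>h. (a * t powr (a - 1)) * h)) (at t)" if "t > 0" for t
    using has_real_derivative_powr[OF that, of a] by (simp add: has_field_derivative_def)
  have 1: "((\<lambda>x::real^'a. complex_of_real ((1 + (\<Sum>i\<in>I. (x $ i)\<^sup>2)) powr a)) has_derivative
      (\<lambda>h. of_real (a * (1 + (\<Sum>i\<in>I. (x $ i)\<^sup>2)) powr (a - 1) * (\<Sum>i\<in>I. 2 * (h $ i) * (x $ i))))) (at x)" for x
    by (intro bounded_linear.has_derivative[OF bounded_linear_of_real]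
        has_derivative_compose[OF _ d] 0)
      (auto intro!: derivative_eq_intros bounded_linear.has_derivative[OF bounded_linear_vec_nth]
        simp: mult_ac)
  have "of_real (a * (1 + (\<Sum>i\<in>I. (x $ i)\<^sup>2)) powr (a - 1) * (\<Sum>i\<in>I. 2 * (axis j 1 $ i) * (x $ i))) =
    of_real a * of_real ((1 + (\<Sum>i\<in>I. (x $ i)\<^sup>2)) powr (a - 1)) * ((if j \<in> I then 2 else 0) * complex_of_real (x $ j))"
    for j and x :: "real^'a"
  proof -
    have "(\<Sum>i\<in>I. 2 * (axis j 1 $ i) * (x $ i)) = (\<Sum>i\<in>I. if i = j then 2 * x $ j else 0)"
      by (intro sum.cong) (auto simp: axis_def)
    also have "\<dots> = (if j \<in> I then 2 else 0) * x $ j" by (simp add: sum.delta)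
    finally show ?thesis by simp
  qed
  then have 2: "multiplier (\<lambda>x::real^'a. of_real (a * (1 + (\<Sum>i\<in>I. (x $ i)\<^sup>2)) powr (a - 1) * (\<Sum>i\<in>I. 2 * (axis j 1 $ i) * (x $ i))))" for j
    by (simp only:) (intro multiplier.intros)
  show ?case
    using 1 2 by (intro exI[of _ "\<lambda>x h. of_real (a * (1 + (\<Sum>i\<in>I. (x $ i)\<^sup>2)) powr (a - 1) * (\<Sum>i\<in>I. 2 * (h $ i) * (x $ i)))"]) blast
next
  case (add f g)
  then obtain f' g' where f': "\<And>x. (f has_derivative f' x) (at x)" "\<And>i. multiplier (\<lambda>x. f' x (axis i 1))"
    and g': "\<And>x. (g has_derivative g' x) (at x)" "\<And>i. multiplier (\<lambda>x. g' x (axis i 1))"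
    by blast
  show ?case
    using f' g' by (intro exI[of _ "\<lambda>x h. f' x h + g' x h"])
      (auto intro!: derivative_eq_intros multiplier.add)
next
  case (mult f g)
  then obtain f' g' where f': "\<And>x. (f has_derivative f' x) (at x)" "\<And>i. multiplier (\<lambda>x. f' x (axis i 1))"
    and g': "\<And>x. (g has_derivative g' x) (at x)" "\<And>i. multiplier (\<lambda>x. g' x (axis i 1))"
    by blast
  show ?case
    using f' g' mult.hyps by (intro exI[of _ "\<lambda>x h. f x * g' x h + f' x h * g x"])
      (auto intro!: derivative_eq_intros multiplier.add multiplier.mult)
qed

lemma multiplier_prod: "(\<And>i. i \<in> I \<Longrightarrow> multiplier (f i)) \<Longrightarrow> multiplier (\<lambda>x. \<Prod>i\<in>I. f i x)"
  by (induction I rule: infinite_finite_induct) (auto intro!: multiplier.const multiplier.mult)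

lemma rapid_add: "rapid f \<Longrightarrow> rapid g \<Longrightarrow> rapid (\<lambda>x. f x + g x)"
  unfolding rapid_def
proof
  fix k assume "\<forall>k. \<exists>C. \<forall>x. (1 + norm x) ^ k * cmod (f x) \<le> C" "\<forall>k. \<exists>C. \<forall>x. (1 + norm x) ^ k * cmod (g x) \<le> C"
  then obtain C D where C: "\<And>x. (1 + norm x) ^ k * cmod (f x) \<le> C" and D: "\<And>x. (1 + norm x) ^ k * cmod (g x) \<le> D"
    by metis
  have "(1 + norm x) ^ k * cmod (f x + g x) \<le> C + D" for x
  proof -
    have "(1 + norm x) ^ k * cmod (f x + g x) \<le> (1 + norm x) ^ k * (cmod (f x) + cmod (g x))"
      by (intro mult_left_mono norm_triangle_ineq) auto
    then show ?thesis using C[of x] D[of x] unfolding distrib_left by linarith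
  qed
  then show "\<exists>C. \<forall>x. (1 + norm x) ^ k * cmod (f x + g x) \<le> C" by blast
qed

lemma rapid_multiplier: "multiplier m \<Longrightarrow> rapid f \<Longrightarrow> rapid (\<lambda>x. m x * f x)"
  unfolding rapid_def
proof
  fix k assume "multiplier m" and f: "\<forall>k. \<exists>C. \<forall>x. (1 + norm x) ^ k * cmod (f x) \<le> C"
  then obtain D l where D: "D \<ge> 0" "\<And>x. cmod (m x) \<le> D * (1 + norm x) ^ l"
    using multiplier_growth by blast
  obtain C where C: "\<And>x. (1 + norm x) ^ (k + l) * cmod (f x) \<le> C"
    using f by blast
  have "(1 + norm x) ^ k * cmod (m x * f x) \<le> D * C" for x
  proof -
    have "(1 + norm x) ^ k * cmod (m x * f x) \<le> (1 + norm x) ^ k * ((D * (1 + norm x) ^ l) * cmod (f x))"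
      unfolding norm_mult using D by (intro mult_left_mono mult_right_mono) auto
    also have "\<dots> = D * ((1 + norm x) ^ (k + l) * cmod (f x))" by (simp add: power_add)
    also have "\<dots> \<le> D * C" using C D by (intro mult_left_mono) auto
    finally show ?thesis .
  qed
  then show "\<exists>C. \<forall>x. (1 + norm x) ^ k * cmod (m x * f x) \<le> C" by blast
qed

lemma rapid_mult:
  assumes "rapid f" "rapid g"
  shows "rapid (\<lambda>x. f x * g x)"
  unfolding rapid_def
proof
  fix k
  obtain C where C: "\<And>x. (1 + norm x) ^ k * cmod (f x) \<le> C" using assms(1) unfolding rapid_def by blast
  obtain D where D: "\<And>x. (1 + norm x) ^ 0 * cmod (g x) \<le> D" using assms(2) unfolding rapid_def by blast
  have "(1 + norm x) ^ k * cmod (f x * g x) \<le> C * D" for x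
  proof -
    have "((1 + norm x) ^ k * cmod (f x)) * cmod (g x) \<le> C * D"
      using C[of x] D[of x] by (intro mult_mono) (auto intro: order_trans[OF _ C[of x]])
    then show ?thesis by (simp add: norm_mult mult.assoc)
  qed
  then show "\<exists>C. \<forall>x. (1 + norm x) ^ k * cmod (f x * g x) \<le> C" by blast
qed

lemma rapid_affine:
  assumes "rapid f" "c \<noteq> 0"
  shows "rapid (\<lambda>x. f (c *\<^sub>R x + y))"
  unfolding rapid_def
proof
  fix k
  define D where "D = 1 + (1 + norm y) / \<bar>c\<bar>"
  have D: "1 + norm x \<le> D * (1 + norm (c *\<^sub>R x + y))" for x
  proof -
    have "\<bar>c\<bar> * norm x \<le> norm (c *\<^sub>R x + y) + norm y"
      using norm_triangle_ineq4[of "c *\<^sub>R x + y" y] by simp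
    then have "norm x \<le> (norm (c *\<^sub>R x + y) + norm y) / \<bar>c\<bar>"
      using assms(2) by (simp add: field_simps)
    also have "\<dots> \<le> ((1 + norm y) * (1 + norm (c *\<^sub>R x + y))) / \<bar>c\<bar>"
      using assms(2) by (intro divide_right_mono) (auto simp: algebra_simps)
    finally have "1 + norm x \<le> 1 + (1 + norm y) / \<bar>c\<bar> * (1 + norm (c *\<^sub>R x + y))" by simp
    then show ?thesis unfolding D_def distrib_right[of 1] mult_1 using norm_ge_zero[of "c *\<^sub>R x + y"] by linarith
  qed
  have D0: "D \<ge> 0" by (simp add: D_def)
  obtain C where C: "\<And>x. (1 + norm x) ^ k * cmod (f x) \<le> C"
    using assms(1) unfolding rapid_def by blast
  have "(1 + norm x) ^ k * cmod (f (c *\<^sub>R x + y)) \<le> D ^ k * C" for x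
  proof -
    have "(1 + norm x) ^ k * cmod (f (c *\<^sub>R x + y)) \<le> (D * (1 + norm (c *\<^sub>R x + y))) ^ k * cmod (f (c *\<^sub>R x + y))"
      using D by (intro mult_right_mono power_mono) auto
    also have "\<dots> = D ^ k * ((1 + norm (c *\<^sub>R x + y)) ^ k * cmod (f (c *\<^sub>R x + y)))"
      by (simp add: power_mult_distrib)
    also have "\<dots> \<le> D ^ k * C" using C D0 by (intro mult_left_mono) auto
    finally show ?thesis .
  qed
  then show "\<exists>C. \<forall>x. (1 + norm x) ^ k * cmod (f (c *\<^sub>R x + y)) \<le> C" by blast
qed

text \<open>The functions obtained from Schwartz functions by the operations under which the Schwartz
  space will turn out to be closed; by the product rule the class is stable under derivatives.\<close>

inductive schwartz_closure :: "(real^'n::finite \<Rightarrow> complex) \<Rightarrow> bool" where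
  base: "f \<in> schwartz_functions \<Longrightarrow> schwartz_closure f"
| multiplier: "multiplier m \<Longrightarrow> schwartz_closure f \<Longrightarrow> schwartz_closure (\<lambda>x. m x * f x)"
| add: "schwartz_closure f \<Longrightarrow> schwartz_closure g \<Longrightarrow> schwartz_closure (\<lambda>x. f x + g x)"
| mult: "schwartz_closure f \<Longrightarrow> schwartz_closure g \<Longrightarrow> schwartz_closure (\<lambda>x. f x * g x)"
| cnj: "schwartz_closure f \<Longrightarrow> schwartz_closure (\<lambda>x. cnj (f x))"
| affine: "schwartz_closure f \<Longrightarrow> c \<noteq> 0 \<Longrightarrow> schwartz_closure (\<lambda>x. f (c *\<^sub>R x + y))"

lemma schwartz_closure_derivative:
  "schwartz_closure f \<Longrightarrow> rapid f \<and> (\<exists>f'. (\<forall>x. (f has_derivative f' x) (at x)) \<and> (\<forall>i. schwartz_closure (\<lambda>x. f' x (axis i 1))))"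
proof (induction rule: schwartz_closure.induct)
  case (base f)
  then show ?case
    using smooth_has_derivative[OF schwartz_smooth[OF base]] schwartz_closure.base[OF schwartz_partial_deriv[OF base]]
      schwartz_rapid[OF base]
    by (intro conjI exI[of _ "\<lambda>x. frechet_derivative f (at x)"]) (auto simp: partial_deriv_def)
next
  case (multiplier m f)
  then obtain f' m' where f': "\<And>x. (f has_derivative f' x) (at x)" "\<And>i. schwartz_closure (\<lambda>x. f' x (axis i 1))"
    and m': "\<And>x. (m has_derivative m' x) (at x)" "\<And>i. multiplier (\<lambda>x. m' x (axis i 1))"
    using multiplier_derivative[OF multiplier(1)] by blast
  show ?case
    using f' m' multiplier rapid_multiplier by (intro conjI exI[of _ "\<lambda>x h. m x * f' x h + m' x h * f x"])
      (auto intro!: derivative_eq_intros schwartz_closure.add schwartz_closure.multiplier)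
next
  case (add f g)
  then obtain f' g' where f': "\<And>x. (f has_derivative f' x) (at x)" "\<And>i. schwartz_closure (\<lambda>x. f' x (axis i 1))"
    and g': "\<And>x. (g has_derivative g' x) (at x)" "\<And>i. schwartz_closure (\<lambda>x. g' x (axis i 1))"
    by blast
  show ?case
    using f' g' add rapid_add by (intro conjI exI[of _ "\<lambda>x h. f' x h + g' x h"])
      (auto intro!: derivative_eq_intros schwartz_closure.add)
next
  case (mult f g)
  then obtain f' g' where f': "\<And>x. (f has_derivative f' x) (at x)" "\<And>i. schwartz_closure (\<lambda>x. f' x (axis i 1))"
    and g': "\<And>x. (g has_derivative g' x) (at x)" "\<And>i. schwartz_closure (\<lambda>x. g' x (axis i 1))"
    by blast
  show ?case
    using f' g' mult rapid_mult by (intro conjI exI[of _ "\<lambda>x h. f x * g' x h + f' x h * g x"])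
      (auto intro!: derivative_eq_intros schwartz_closure.add schwartz_closure.mult)
next
  case (cnj f)
  then obtain f' where f': "\<And>x. (f has_derivative f' x) (at x)" "\<And>i. schwartz_closure (\<lambda>x. f' x (axis i 1))"
    by blast
  show ?case
    using f' cnj by (intro conjI exI[of _ "\<lambda>x h. cnj (f' x h)"])
      (auto intro!: derivative_eq_intros schwartz_closure.cnj bounded_linear.has_derivative[OF bounded_linear_cnj] simp: rapid_def)
next
  case (affine f c y)
  then obtain f' where f': "\<And>x. (f has_derivative f' x) (at x)" "\<And>i. schwartz_closure (\<lambda>x. f' x (axis i 1))"
    by blast
  have l: "linear (f' x)" for x using f'(1) has_derivative_linear by blast
  have sc: "f' z (c *\<^sub>R v) = of_real c * f' z v" for z v
    by (simp add: linear_scale[OF l] scaleR_conv_of_real[of c "f' z v"])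
  have 1: "((\<lambda>x. f (c *\<^sub>R x + y)) has_derivative (\<lambda>h. f' (c *\<^sub>R x + y) (c *\<^sub>R h))) (at x)" for x
    by (rule has_derivative_compose[OF _ f'(1)]) (auto intro!: derivative_eq_intros)
  have 2: "schwartz_closure (\<lambda>x. of_real c * f' (c *\<^sub>R x + y) (axis i 1))" for i
    using schwartz_closure.affine[OF f'(2) affine.hyps(2)] by (intro schwartz_closure.multiplier multiplier.const) auto
  show ?case
    using 1 2 affine rapid_affine by (intro conjI exI[of _ "\<lambda>x h. f' (c *\<^sub>R x + y) (c *\<^sub>R h)"])
       (auto simp: sc)
qed

lemma schwartz_closure_schwartz: "schwartz_closure f \<Longrightarrow> f \<in> schwartz_functions"
proof (erule schwartz_coinduct)
  fix g :: "real^'a \<Rightarrow> complex" assume "schwartz_closure g"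
  then show "rapid g \<and> (\<forall>x. g differentiable (at x)) \<and> (\<forall>i. schwartz_closure (partial_deriv i g))"
    using schwartz_closure_derivative[of g] partial_deriv_eqI[of g] unfolding differentiable_def by metis
qed

lemma schwartz_multiplier: "multiplier m \<Longrightarrow> f \<in> schwartz_functions \<Longrightarrow> (\<lambda>x. m x * f x) \<in> schwartz_functions"
  by (rule schwartz_closure_schwartz) (intro schwartz_closure.multiplier schwartz_closure.base)
lemma schwartz_add: "f \<in> schwartz_functions \<Longrightarrow> g \<in> schwartz_functions \<Longrightarrow> (\<lambda>x. f x + g x) \<in> schwartz_functions"
  by (rule schwartz_closure_schwartz) (intro schwartz_closure.add schwartz_closure.base)
lemma schwartz_mult: "f \<in> schwartz_functions \<Longrightarrow> g \<in> schwartz_functions \<Longrightarrow> (\<lambda>x. f x * g x) \<in> schwartz_functions"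
  by (rule schwartz_closure_schwartz) (intro schwartz_closure.mult schwartz_closure.base)
lemma schwartz_cnj: "f \<in> schwartz_functions \<Longrightarrow> (\<lambda>x. cnj (f x)) \<in> schwartz_functions"
  by (rule schwartz_closure_schwartz) (intro schwartz_closure.cnj schwartz_closure.base)
lemma schwartz_affine: "f \<in> schwartz_functions \<Longrightarrow> c \<noteq> 0 \<Longrightarrow> (\<lambda>x. f (c *\<^sub>R x + y)) \<in> schwartz_functions"
  by (rule schwartz_closure_schwartz) (intro schwartz_closure.affine schwartz_closure.base)
lemma schwartz_cmult: "f \<in> schwartz_functions \<Longrightarrow> (\<lambda>x. c * f x) \<in> schwartz_functions"
  by (intro schwartz_multiplier multiplier.const)
lemma schwartz_uminus: "f \<in> schwartz_functions \<Longrightarrow> (\<lambda>x. f (- x)) \<in> schwartz_functions"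
  using schwartz_affine[of f "-1" 0] by simp

section \<open>Test functions and cutoffs\<close>

lemma test_functions_iff:
  "f \<in> test_functions \<longleftrightarrow> smooth f \<and> (\<exists>R. \<forall>x. norm x > R \<longrightarrow> f x = 0)"
proof -
  have "compact (supp f) \<longleftrightarrow> bounded {x. f x \<noteq> 0}"
    by (simp add: supp_def)
  also have "\<dots> \<longleftrightarrow> (\<exists>R. \<forall>x. norm x > R \<longrightarrow> f x = 0)"
    unfolding bounded_iff by (metis (mono_tags, lifting) mem_Collect_eq not_le)
  finally show ?thesis by (simp add: test_functions_def)
qed

lemma test_smooth: "f \<in> test_functions \<Longrightarrow> smooth f"
  by (simp add: test_functions_def)

lemma test_mult: "smooth a \<Longrightarrow> f \<in> test_functions \<Longrightarrow> (\<lambda>x. a x * f x) \<in> test_functions"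
  by (auto simp: test_functions_iff intro!: smooth_mult)

lemma test_mult': "f \<in> test_functions \<Longrightarrow> smooth a \<Longrightarrow> (\<lambda>x. f x * a x) \<in> test_functions"
  using test_mult[of a f] by (simp add: mult.commute)

lemma test_add: "f \<in> test_functions \<Longrightarrow> g \<in> test_functions \<Longrightarrow> (\<lambda>x. f x + g x) \<in> test_functions"
  unfolding test_functions_iff
proof safe
  fix R S assume "\<forall>x. norm x > R \<longrightarrow> f x = 0" "\<forall>x. norm x > S \<longrightarrow> g x = 0"
  then have "\<forall>x. norm x > max R S \<longrightarrow> f x + g x = 0" by simp
  then show "\<exists>R. \<forall>x. norm x > R \<longrightarrow> f x + g x = 0" by blast
qed (rule smooth_add)

lemma test_translate: "f \<in> test_functions \<Longrightarrow> translate y f \<in> test_functions"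
proof -
  assume f: "f \<in> test_functions"
  then obtain R where R: "\<And>x. norm x > R \<Longrightarrow> f x = 0" by (auto simp: test_functions_iff)
  have "norm (x - y) > R" if "norm x > R + norm y" for x
    using that norm_triangle_ineq2[of x y] by linarith
  then have "\<forall>x. norm x > R + norm y \<longrightarrow> translate y f x = 0"
    using R by (auto simp: translate_def)
  moreover have "smooth (translate y f)"
    using smooth_affine[OF test_smooth[OF f], of 1 "-y"] by (simp add: translate_def)
  ultimately show ?thesis by (auto simp: test_functions_iff)
qed

lemma partial_deriv_zero_outside:
  assumes "\<And>x. norm x > R \<Longrightarrow> f x = 0" "norm x > R"
  shows "partial_deriv i f x = 0"
proof -
  have "(f has_derivative (\<lambda>h. 0)) (at x)"
  proof (rule has_derivative_transform_within_open[where f = "\<lambda>x. 0" and s = "{x. norm x > R}"])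
    show "open {x::real^'a. norm x > R}" by (intro open_Collect_less continuous_intros)
  qed (use assms in auto)
  then show ?thesis using frechet_derivative_at by (metis partial_deriv_def)
qed

lemma partials_zero_outside:
  assumes "\<And>x. norm x > R \<Longrightarrow> f x = 0" "norm x > R"
  shows "partials \<alpha> f x = 0"
  using assms(2) by (induction \<alpha> arbitrary: x)
     (simp_all add: partials_Cons assms(1) partial_deriv_zero_outside[where R = R])

lemma test_schwartz: "f \<in> test_functions \<Longrightarrow> f \<in> schwartz_functions"
proof (rule schwartz_coinduct[where P = "\<lambda>f. smooth f \<and> (\<exists>R. \<forall>x. norm x > R \<longrightarrow> f x = 0)"])
  fix g :: "real^'a \<Rightarrow> complex"
  assume g: "smooth g \<and> (\<exists>R. \<forall>x. norm x > R \<longrightarrow> g x = 0)"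
  then obtain R where R: "\<And>x. norm x > R \<Longrightarrow> g x = 0" by blast
  have "rapid g" unfolding rapid_def
  proof
    fix k
    have "continuous_on (cball 0 R) (\<lambda>x. (1 + norm x) ^ k * cmod (g x))"
      using smooth_continuous g continuous_on_subset by (intro continuous_intros) blast
    then have "compact ((\<lambda>x. (1 + norm x) ^ k * cmod (g x)) ` cball 0 R)"
      by (intro compact_continuous_image) auto
    then obtain C where C: "\<And>x. x \<in> cball 0 R \<Longrightarrow> (1 + norm x) ^ k * cmod (g x) \<le> C"
      by (meson bounded_imp_bdd_above bdd_above_def compact_imp_bounded image_eqI)
    have "(1 + norm x) ^ k * cmod (g x) \<le> max C 0" for x
      using C[of x] R[of x] by (cases "norm x > R") auto
    then show "\<exists>C. \<forall>x. (1 + norm x) ^ k * cmod (g x) \<le> C" by blast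
  qed
  then show "rapid g \<and> (\<forall>x. g differentiable (at x)) \<and>
      (\<forall>i. smooth (partial_deriv i g) \<and> (\<exists>R. \<forall>x. norm x > R \<longrightarrow> partial_deriv i g x = 0))"
    using g by (auto intro: smooth_differentiable smooth_partial_deriv intro!: exI[of _ R] partial_deriv_zero_outside[OF R])
qed (simp add: test_functions_iff)

text \<open>The quotient \<open>a / (a + c)\<close>, where \<open>a\<close> vanishes outside a large ball, \<open>c\<close> vanishes inside a smaller
  one, and at least one of the two is positive everywhere.\<close>

lemma cutoff_exists: "\<exists>\<theta>\<in>test_functions. \<forall>x::real^'n::finite. norm x \<le> R \<longrightarrow> \<theta> x = 1"
proof -
  define S where "S = (\<bar>R\<bar> + 1)\<^sup>2"
  define q where "q = (\<lambda>x::real^'n. \<Sum>i\<in>UNIV. complex_of_real (x $ i) * complex_of_real (x $ i))"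
  have q: "Re (q x) = (norm x)\<^sup>2" for x
    by (simp add: q_def norm_vec_def L2_set_def sum_nonneg power2_eq_square)
  have sq: "smooth q" unfolding q_def by (intro smooth_sum smooth_mult smooth_coord)
  \<comment> \<open>The cutoff is a function of the square of the norm, which is a polynomial.\<close>
  define a where "a = (\<lambda>x. complex_of_real (flat_exp 0 (Re ((of_real S + 1) + (-1) * q x))))"
  define c where "c = (\<lambda>x. complex_of_real (flat_exp 0 (Re (- of_real S + q x))))"
  have sa: "smooth a" unfolding a_def by (intro smooth_flat_exp smooth_add smooth_mult smooth_const sq)
  have sc: "smooth c" unfolding c_def by (intro smooth_flat_exp smooth_add smooth_mult smooth_const sq)
  have a: "a x = of_real (flat_exp 0 (S + 1 - (norm x)\<^sup>2))" for x by (simp add: a_def q)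
  have c: "c x = of_real (flat_exp 0 ((norm x)\<^sup>2 - S))" for x by (simp add: c_def q)
  have nz: "a x + c x \<noteq> 0" for x
  proof -
    have "flat_exp 0 (S + 1 - (norm x)\<^sup>2) + flat_exp 0 ((norm x)\<^sup>2 - S) > 0"
      using flat_exp_nonneg[of 0 "S + 1 - (norm x)\<^sup>2"] flat_exp_nonneg[of 0 "(norm x)\<^sup>2 - S"]
        flat_exp_pos_iff[of 0 "S + 1 - (norm x)\<^sup>2"] flat_exp_pos_iff[of 0 "(norm x)\<^sup>2 - S"]
      by linarith
    then show ?thesis unfolding a c of_real_add[symmetric] of_real_eq_0_iff by linarith
  qed
  have 1: "smooth (\<lambda>x. a x * inverse (a x + c x))"
    by (intro smooth_mult smooth_inverse smooth_add sa sc nz)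
  have 2: "a x * inverse (a x + c x) = 0" if "norm x > S + 1" for x
  proof -
    have "S + 1 \<ge> 1" by (simp add: S_def)
    then have "norm x \<ge> 1" using that by linarith
    then have "norm x \<le> (norm x)\<^sup>2" by (simp add: self_le_power)
    then have "S + 1 - (norm x)\<^sup>2 \<le> 0" using that by linarith
    then show ?thesis by (simp add: a flat_exp_def)
  qed
  have 3: "a x * inverse (a x + c x) = 1" if "norm x \<le> R" for x
  proof -
    have "(norm x)\<^sup>2 \<le> S" unfolding S_def using that by (intro power_mono) auto
    then have "c x = 0" by (simp add: c flat_exp_def)
    then show ?thesis using nz[of x] by simp
  qed
  show ?thesis
    using 1 2 3 by (intro bexI[of _ "\<lambda>x. a x * inverse (a x + c x)"]) (auto simp: test_functions_iff)
qed

lemma cutoff_exists':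
  fixes f :: "real^'n::finite \<Rightarrow> complex"
  assumes "f \<in> test_functions"
  shows "\<exists>\<theta>\<in>test_functions. \<forall>x. \<theta> x * f x = f x"
proof -
  obtain R where R: "\<And>x. norm x > R \<Longrightarrow> f x = 0" using assms by (auto simp: test_functions_iff)
  obtain \<theta> :: "real^'n \<Rightarrow> complex" where "\<theta> \<in> test_functions" "\<And>x. norm x \<le> R \<Longrightarrow> \<theta> x = 1" using cutoff_exists[of R] by blast
  then have "\<theta> x * f x = f x" for x using R[of x] by (cases "norm x \<le> R") auto
  then show ?thesis using \<open>\<theta> \<in> test_functions\<close> by blast
qed

section \<open>Integration over Euclidean space\<close>

lemma Basis_vec_real: "(Basis :: (real^'n::finite) set) = range (\<lambda>i. axis i 1)"
  by (auto simp: Basis_vec_def)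

lemma inj_axis_1: "inj (\<lambda>i. axis i (1::real))"
  by (auto simp: inj_on_def axis_eq_axis)

text \<open>Lebesgue measure on \<open>real^'n\<close> is the image of a product measure indexed by the standard basis,
  which is reindexed here by the coordinates.\<close>

lemma integral_lborel_prod:
  fixes f :: "'n::finite \<Rightarrow> real \<Rightarrow> 'c::{real_normed_field,banach,second_countable_topology}"
  assumes f: "\<And>i. integrable lborel (f i)"
  shows "integrable lborel (\<lambda>x::real^'n. \<Prod>i\<in>UNIV. f i (x $ i))"
    and "(LINT x|lborel. (\<Prod>i\<in>UNIV. f i ((x::real^'n) $ i))) = (\<Prod>i\<in>UNIV. (LINT x|lborel. f i x))"
proof -
  interpret product_sigma_finite "\<lambda>_::real^'n. lborel :: real measure" ..
  define g where "g = (\<lambda>b::real^'n. f (inv (\<lambda>i. axis i (1::real)) b))"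
  have g: "g (axis i 1) = f i" for i using inv_f_f[OF inj_axis_1, of i] by (simp add: g_def)
  have gi: "integrable lborel (g b)" for b by (simp add: g_def f)
  have [measurable]: "g b \<in> borel_measurable borel" for b
    using borel_measurable_integrable[OF gi] by simp
  have eq: "(\<Prod>i\<in>UNIV. f i (x $ i)) = (\<Prod>b\<in>Basis. g b (x \<bullet> b))" for x :: "real^'n"
    unfolding Basis_vec_real by (subst prod.reindex[OF inj_axis_1]) (simp add: g inner_axis)
  have eq2: "(\<Prod>i\<in>UNIV. (LINT x|lborel. f i x)) = (\<Prod>b\<in>Basis. (LINT x|lborel. g b x))"
    unfolding Basis_vec_real by (subst prod.reindex[OF inj_axis_1]) (simp add: g)
  let ?T = "\<lambda>f. \<Sum>b\<in>Basis. f b *\<^sub>R (b :: real^'n)"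
  have *: "(\<Prod>b\<in>Basis. g b (?T z \<bullet> b)) = (\<Prod>b\<in>Basis. g b (z b))" for z
    by (intro prod.cong) auto
  show "integrable lborel (\<lambda>x::real^'n. \<Prod>i\<in>UNIV. f i (x $ i))"
    unfolding eq by (subst lborel_eq, subst integrable_distr_eq)
      (auto simp: * intro!: product_integrable_prod gi)
  show "(LINT x|lborel. (\<Prod>i\<in>UNIV. f i ((x::real^'n) $ i))) = (\<Prod>i\<in>UNIV. (LINT x|lborel. f i x))"
    unfolding eq eq2 by (subst lborel_eq, subst integral_distr)
      (auto simp: * product_integral_prod gi)
qed

lemma integrable_powr_Ici:
  assumes "\<beta> > 1"
  shows "integrable lborel (\<lambda>x::real. (1 + x) powr (- \<beta>) * indicator {0..} x)"
proof (rule integrableI_nonneg)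
  have "((\<lambda>x. (1 + x) powr (1 - \<beta>) / (1 - \<beta>)) \<longlongrightarrow> 0) at_top"
    using assms by real_asymp
  then have "(\<integral>\<^sup>+x. ennreal ((1 + x) powr (- \<beta>)) * indicator {0 ..} x \<partial>lborel)
      = ennreal (0 - (1 + 0) powr (1 - \<beta>) / (1 - \<beta>))"
    using assms by (intro nn_integral_FTC_atLeast) (auto intro!: derivative_eq_intros)
  then show "(\<integral>\<^sup>+x. ennreal ((1 + x) powr (- \<beta>) * indicator {0 ..} x) \<partial>lborel) < \<infinity>"
    by (simp add: ennreal_mult ennreal_indicator)
qed auto

lemma integrable_japanese_1d:
  assumes "\<beta> > 1 / 2"
  shows "integrable lborel (\<lambda>x::real. (1 + x\<^sup>2) powr (- \<beta>))"
proof -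
  define h where "h = (\<lambda>x::real. (1 + x) powr (- (2 * \<beta>)) * indicator {0..} x)"
  have h: "integrable lborel h" unfolding h_def using assms by (intro integrable_powr_Ici) auto
  have h': "integrable lborel (\<lambda>x. h (0 + (-1) * x))"
    by (rule lborel_integrable_real_affine[OF h]) auto
  have "(1 + x\<^sup>2) powr (- \<beta>) \<le> 2 powr \<beta> * (h x + h (0 + (-1) * x))" for x :: real
  proof -
    have "(1 + \<bar>x\<bar>)\<^sup>2 / 2 \<le> 1 + x\<^sup>2"
      using zero_le_power2[of "1 - \<bar>x\<bar>"] by (simp add: power2_sum power2_diff)
    then have "(1 + x\<^sup>2) powr (- \<beta>) \<le> ((1 + \<bar>x\<bar>)\<^sup>2 / 2) powr (- \<beta>)"
      using assms by (intro powr_mono2') auto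
    also have "\<dots> = 2 powr \<beta> * (1 + \<bar>x\<bar>) powr (- (2 * \<beta>))"
      by (simp add: powr_divide powr_minus powr_powr field_simps flip: powr_numeral)
    also have "(1 + \<bar>x\<bar>) powr (- (2 * \<beta>)) \<le> h x + h (0 + (-1) * x)"
      by (cases "x \<ge> 0") (auto simp: h_def)
    finally show ?thesis by simp
  qed
  then have *: "norm ((1 + x\<^sup>2) powr (- \<beta>)) \<le> norm (2 powr \<beta> * (h x + h (0 + (-1) * x)))" for x :: real
    by (metis abs_of_nonneg powr_ge_zero real_norm_def order_trans abs_ge_self)
  have "integrable lborel (\<lambda>x. 2 powr \<beta> * (h x + h (0 + (-1) * x)))"
    by (intro integrable_mult_right Bochner_Integration.integrable_add h h')
  then show ?thesis
    by (rule Bochner_Integration.integrable_bound) (measurable, intro AE_I2 *)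
qed

lemma integrable_weight:
  assumes "\<And>i. \<beta> i > 1 / 2"
  shows "integrable lborel (\<lambda>x::real^'n::finite. \<Prod>i\<in>UNIV. (1 + (x $ i)\<^sup>2) powr (- \<beta> i))"
  using assms by (intro integral_lborel_prod(1)[of "\<lambda>i x. (1 + x\<^sup>2) powr (- \<beta> i)"] integrable_japanese_1d)

text \<open>The exponent \<open>2n\<close> is far from optimal, but it allows a comparison with a product of
  one-dimensional weights.\<close>

lemma integrable_poly_decay:
  "integrable lborel (\<lambda>x::real^'n::finite. inverse ((1 + norm x) ^ (2 * CARD('n))))"
proof (rule Bochner_Integration.integrable_bound)
  show "integrable lborel (\<lambda>x::real^'n. \<Prod>i\<in>UNIV. (1 + (x $ i)\<^sup>2) powr (- 1))"
    by (rule integrable_weight) auto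
  have "inverse ((1 + norm x) ^ (2 * CARD('n))) \<le> (\<Prod>i\<in>UNIV. (1 + (x $ i)\<^sup>2) powr (- 1))" for x :: "real^'n"
  proof -
    have *: "1 + (x $ i)\<^sup>2 \<le> (1 + norm x)\<^sup>2" for i
    proof -
      have "(x $ i)\<^sup>2 \<le> (norm x)\<^sup>2"
        using component_le_norm_cart[of x i] by (metis abs_ge_zero power2_abs power_mono)
      then show ?thesis using norm_ge_zero[of x] unfolding power2_sum power_one mult_1_right by linarith
    qed
    have "(\<Prod>i\<in>(UNIV::'n set). 1 + (x $ i)\<^sup>2) \<le> (\<Prod>i\<in>(UNIV::'n set). (1 + norm x)\<^sup>2)"
      by (intro prod_mono) (use * in auto)
    also have "\<dots> = (1 + norm x) ^ (2 * CARD('n))" by (simp add: power_mult)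
    finally have "inverse ((1 + norm x) ^ (2 * CARD('n))) \<le> inverse (\<Prod>i\<in>(UNIV::'n set). 1 + (x $ i)\<^sup>2)"
      by (intro le_imp_inverse_le prod_pos) (auto simp: add_pos_nonneg)
    also have "\<dots> = (\<Prod>i\<in>UNIV. (1 + (x $ i)\<^sup>2) powr (- 1))"
      by (simp add: powr_minus prod_inversef[unfolded o_def] add_pos_nonneg)
    finally show ?thesis .
  qed
  then show "AE x::real^'n in lborel. norm (inverse ((1 + norm x) ^ (2 * CARD('n)))) \<le> norm (\<Prod>i\<in>UNIV. (1 + (x $ i)\<^sup>2) powr (- 1))"
    by (auto simp: prod_nonneg abs_of_nonneg)
qed measurable

lemma rapid_integrable:
  fixes f :: "real^'n::finite \<Rightarrow> complex"
  assumes "rapid f" "f \<in> borel_measurable borel"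
  shows "integrable lborel (\<lambda>x. (1 + norm x) ^ k * cmod (f x))"
    and "integrable lborel (\<lambda>x. (1 + norm x) ^ k * (cmod (f x))\<^sup>2)"
proof -
  obtain C where C: "\<And>x. (1 + norm x) ^ (2 * CARD('n) + k) * cmod (f x) \<le> C"
    using assms(1) unfolding rapid_def by metis
  obtain D where D: "\<And>x. (1 + norm x) ^ 0 * cmod (f x) \<le> D"
    using assms(1) unfolding rapid_def by metis
  have D0: "D \<ge> 0" using D[of 0] norm_ge_zero[of "f 0"] by (simp del: norm_ge_zero)
  note [measurable] = assms(2)
  have *: "(1 + norm x) ^ k * cmod (f x) \<le> C * inverse ((1 + norm x) ^ (2 * CARD('n)))" for x
  proof -
    have "(1 + norm x) ^ (2 * CARD('n)) > 0" by (intro zero_less_power) (auto intro: add_pos_nonneg)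
    then show ?thesis using C[of x] by (simp add: power_add field_simps)
  qed
  show 1: "integrable lborel (\<lambda>x. (1 + norm x) ^ k * cmod (f x))"
    by (rule Bochner_Integration.integrable_bound[OF integrable_mult_right[OF integrable_poly_decay, of C]])
       (use * in \<open>auto intro!: AE_I2 intro: order_trans[OF _ abs_ge_self]\<close>)
  show "integrable lborel (\<lambda>x. (1 + norm x) ^ k * (cmod (f x))\<^sup>2)"
  proof (rule Bochner_Integration.integrable_bound[OF integrable_mult_right[OF 1, of D]])
    have "(1 + norm x) ^ k * (cmod (f x))\<^sup>2 \<le> D * ((1 + norm x) ^ k * cmod (f x))" for x
    proof -
      have "((1 + norm x) ^ k * cmod (f x)) * cmod (f x) \<le> ((1 + norm x) ^ k * cmod (f x)) * D"
        using D[of x] by (intro mult_left_mono) auto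
      then show ?thesis by (simp add: power2_eq_square mult_ac)
    qed
    then show "AE x in lborel. norm ((1 + norm x) ^ k * (cmod (f x))\<^sup>2) \<le> norm (D * ((1 + norm x) ^ k * cmod (f x)))"
      by (auto intro!: AE_I2 intro: order_trans[OF _ abs_ge_self])
  qed measurable
qed

lemma schwartz_borel: "f \<in> schwartz_functions \<Longrightarrow> f \<in> borel_measurable borel"
  using smooth_borel schwartz_smooth by blast

lemma schwartz_integrable:
  assumes "f \<in> schwartz_functions"
  shows "integrable lborel f" "integrable lborel (\<lambda>x. cmod (f x))"
proof -
  have [measurable]: "f \<in> borel_measurable borel" using assms by (rule schwartz_borel)
  show "integrable lborel (\<lambda>x. cmod (f x))"
    using rapid_integrable(1)[OF schwartz_rapid[OF assms] schwartz_borel[OF assms], of 0] by simp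
  then show "integrable lborel f" by (subst (asm) integrable_norm_iff) auto
qed

lemma lborel_distr_uminus_eucl: "distr lborel borel uminus = (lborel :: 'a::euclidean_space measure)"
  by (subst (2) lborel_affine[of "-1" 0]) (auto simp: density_1)

lemma integral_translate:
  fixes f :: "'a::euclidean_space \<Rightarrow> 'b::{banach, second_countable_topology}"
  assumes [measurable]: "f \<in> borel_measurable borel"
  shows "integrable lborel (\<lambda>x. f (a + x)) \<longleftrightarrow> integrable lborel f"
    and "(LINT x|lborel. f (a + x)) = (LINT x|lborel. f x)"
proof -
  have "integrable (distr lborel borel ((+) a)) f \<longleftrightarrow> integrable lborel (\<lambda>x. f (a + x))"
    by (intro integrable_distr_eq) auto
  then show "integrable lborel (\<lambda>x. f (a + x)) \<longleftrightarrow> integrable lborel f"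
    unfolding lborel_distr_plus by simp
  have "integral\<^sup>L (distr lborel borel ((+) a)) f = (LINT x|lborel. f (a + x))"
    by (intro integral_distr) auto
  then show "(LINT x|lborel. f (a + x)) = (LINT x|lborel. f x)"
    unfolding lborel_distr_plus by simp
qed

lemma integral_uminus:
  fixes f :: "'a::euclidean_space \<Rightarrow> 'b::{banach, second_countable_topology}"
  assumes [measurable]: "f \<in> borel_measurable borel"
  shows "integrable lborel (\<lambda>x. f (- x)) \<longleftrightarrow> integrable lborel f"
    and "(LINT x|lborel. f (- x)) = (LINT x|lborel. f x)"
proof -
  have "integrable (distr lborel borel uminus) f \<longleftrightarrow> integrable lborel (\<lambda>x. f (- x))"
    by (intro integrable_distr_eq) auto
  then show "integrable lborel (\<lambda>x. f (- x)) \<longleftrightarrow> integrable lborel f"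
    unfolding lborel_distr_uminus_eucl by simp
  have "integral\<^sup>L (distr lborel borel uminus) f = (LINT x|lborel. f (- x))"
    by (intro integral_distr) auto
  then show "(LINT x|lborel. f (- x)) = (LINT x|lborel. f x)"
    unfolding lborel_distr_uminus_eucl by simp
qed

lemma integral_reflect:
  fixes f :: "'a::euclidean_space \<Rightarrow> 'b::{banach, second_countable_topology}"
  assumes [measurable]: "f \<in> borel_measurable borel"
  shows "integrable lborel (\<lambda>x. f (a - x)) \<longleftrightarrow> integrable lborel f"
    and "(LINT x|lborel. f (a - x)) = (LINT x|lborel. f x)"
  using integral_uminus[of "\<lambda>x. f (a + x)"] integral_translate[of f a] by simp_all

lemma nn_integral_translate:
  fixes f :: "'a::euclidean_space \<Rightarrow> ennreal"
  assumes [measurable]: "f \<in> borel_measurable borel"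
  shows "(\<integral>\<^sup>+x. f (a + x) \<partial>lborel) = (\<integral>\<^sup>+x. f x \<partial>lborel)"
proof -
  have "(\<integral>\<^sup>+x. f x \<partial>distr lborel borel ((+) a)) = (\<integral>\<^sup>+x. f (a + x) \<partial>lborel)"
    by (intro nn_integral_distr) auto
  then show ?thesis unfolding lborel_distr_plus by simp
qed

lemma nn_integral_uminus:
  fixes f :: "'a::euclidean_space \<Rightarrow> ennreal"
  assumes [measurable]: "f \<in> borel_measurable borel"
  shows "(\<integral>\<^sup>+x. f (- x) \<partial>lborel) = (\<integral>\<^sup>+x. f x \<partial>lborel)"
proof -
  have "(\<integral>\<^sup>+x. f x \<partial>distr lborel borel uminus) = (\<integral>\<^sup>+x. f (- x) \<partial>lborel)"
    by (intro nn_integral_distr) auto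
  then show ?thesis unfolding lborel_distr_uminus_eucl by simp
qed

lemma nn_integral_reflect:
  fixes f :: "'a::euclidean_space \<Rightarrow> ennreal"
  assumes [measurable]: "f \<in> borel_measurable borel"
  shows "(\<integral>\<^sup>+x. f (a - x) \<partial>lborel) = (\<integral>\<^sup>+x. f x \<partial>lborel)"
  using nn_integral_uminus[of "\<lambda>x. f (a + x)"] nn_integral_translate[of f a] by simp

lemma integral_scale:
  fixes f :: "'a::euclidean_space \<Rightarrow> complex"
  assumes [measurable]: "f \<in> borel_measurable borel" and c: "c \<noteq> 0"
  shows "(LINT x|lborel. f x) = of_real (\<bar>c\<bar> ^ DIM('a)) * (LINT x|lborel. f (a + c *\<^sub>R x))"
  by (subst lborel_affine[OF c, of a]) (simp add: integral_density integral_distr scaleR_conv_of_real)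

lemma borel_measurable_cis [measurable]: "cis \<in> borel_measurable borel"
  by (intro borel_measurable_continuous_onI continuous_intros)

text \<open>A rescaling of the characteristic function of the standard normal distribution.\<close>

lemma gauss_1d:
  assumes "\<epsilon> > 0"
  shows "integrable lborel (\<lambda>x::real. cis (t * x) * of_real (exp (- (\<epsilon>\<^sup>2 * x\<^sup>2 / 2))))"
    and "(LINT x|lborel. cis (t * x) * of_real (exp (- (\<epsilon>\<^sup>2 * x\<^sup>2 / 2)))) =
      of_real (sqrt (2 * pi) / \<epsilon> * exp (- (t\<^sup>2 / (2 * \<epsilon>\<^sup>2))))"
proof -
  have i0: "integrable lborel std_normal_density" by simp
  have d: "std_normal_density x = exp (- (x\<^sup>2 / 2)) / sqrt (2 * pi)" for x
    by (simp add: std_normal_density_def)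
  have "integrable lborel (\<lambda>x. sqrt (2 * pi) * std_normal_density (0 + \<epsilon> * x))"
    using assms by (intro integrable_mult_right lborel_integrable_real_affine i0) auto
  then have i1: "integrable lborel (\<lambda>x. exp (- (\<epsilon>\<^sup>2 * x\<^sup>2 / 2)))"
    by (simp add: d power_mult_distrib)
  show i2: "integrable lborel (\<lambda>x::real. cis (t * x) * of_real (exp (- (\<epsilon>\<^sup>2 * x\<^sup>2 / 2))))"
    by (rule Bochner_Integration.integrable_bound[OF i1]) (auto simp: norm_mult)
  have std: "(LINT x|lborel. cis (u * x) * of_real (std_normal_density x)) = of_real (exp (- (u\<^sup>2) / 2))" for u
  proof -
    have "char std_normal_distribution u = (LINT x|lborel. std_normal_density x *\<^sub>R iexp (u * x))"
      unfolding char_def by (subst integral_density) auto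
    then show ?thesis unfolding char_std_normal_distribution
      by (simp add: scaleR_conv_of_real cis_conv_exp mult_ac)
  qed
  have "(LINT x|lborel. cis (t / \<epsilon> * x) * of_real (std_normal_density x)) =
     \<bar>\<epsilon>\<bar> *\<^sub>R (LINT x|lborel. cis (t / \<epsilon> * (0 + \<epsilon> * x)) * of_real (std_normal_density (0 + \<epsilon> * x)))"
    using assms by (intro lborel_integral_real_affine) auto
  also have "(LINT x|lborel. cis (t / \<epsilon> * (0 + \<epsilon> * x)) * of_real (std_normal_density (0 + \<epsilon> * x))) =
     (LINT x|lborel. of_real (1 / sqrt (2 * pi)) * (cis (t * x) * of_real (exp (- (\<epsilon>\<^sup>2 * x\<^sup>2 / 2)))))"
    using assms by (intro Bochner_Integration.integral_cong) (auto simp: d power_mult_distrib)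
  also have "\<dots> = of_real (1 / sqrt (2 * pi)) * (LINT x|lborel. cis (t * x) * of_real (exp (- (\<epsilon>\<^sup>2 * x\<^sup>2 / 2))))"
    by (rule integral_mult_right_zero)
  finally show "(LINT x|lborel. cis (t * x) * of_real (exp (- (\<epsilon>\<^sup>2 * x\<^sup>2 / 2)))) =
      of_real (sqrt (2 * pi) / \<epsilon> * exp (- (t\<^sup>2 / (2 * \<epsilon>\<^sup>2))))"
    unfolding std using assms
    by (simp add: scaleR_conv_of_real field_simps power_divide flip: of_real_mult)
qed

lemma norm_sq_sum: "(norm (x::real^'n::finite))\<^sup>2 = (\<Sum>i\<in>UNIV. (x $ i)\<^sup>2)"
  by (simp add: norm_vec_def L2_set_def sum_nonneg)

lemma cis_sum: "finite A \<Longrightarrow> cis (\<Sum>i\<in>A. f i) = (\<Prod>i\<in>A. cis (f i))"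
  by (induction A rule: finite_induct) (auto simp: cis_mult[symmetric])

lemma gauss_nd:
  fixes x :: "real^'n::finite"
  assumes "\<epsilon> > 0"
  shows "integrable lborel (\<lambda>\<xi>::real^'n. cis (x \<bullet> \<xi>) * of_real (exp (- (\<epsilon>\<^sup>2 * (norm \<xi>)\<^sup>2 / 2))))"
    and "(LINT \<xi>|lborel. cis (x \<bullet> \<xi>) * of_real (exp (- (\<epsilon>\<^sup>2 * (norm \<xi>)\<^sup>2 / 2)))) =
      of_real ((sqrt (2 * pi) / \<epsilon>) ^ CARD('n) * exp (- ((norm x)\<^sup>2 / (2 * \<epsilon>\<^sup>2))))"
proof -
  have eq: "cis (x \<bullet> \<xi>) * of_real (exp (- (\<epsilon>\<^sup>2 * (norm \<xi>)\<^sup>2 / 2))) =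
     (\<Prod>i\<in>UNIV. cis (x $ i * \<xi> $ i) * of_real (exp (- (\<epsilon>\<^sup>2 * (\<xi> $ i)\<^sup>2 / 2))))" for \<xi> :: "real^'n"
    by (simp add: norm_sq_sum inner_vec_def cis_sum prod.distrib sum_distrib_left sum_divide_distrib
       exp_sum flip: sum_negf of_real_prod)
  have "(sqrt (2 * pi) / \<epsilon>) ^ CARD('n) * exp (- ((norm x)\<^sup>2 / (2 * \<epsilon>\<^sup>2))) =
     (\<Prod>i\<in>(UNIV::'n set). sqrt (2 * pi) / \<epsilon> * exp (- ((x $ i)\<^sup>2 / (2 * \<epsilon>\<^sup>2))))"
    unfolding prod.distrib prod_constant norm_sq_sum sum_divide_distrib sum_negf[symmetric] exp_sum[OF finite] ..
  then have eq2: "of_real ((sqrt (2 * pi) / \<epsilon>) ^ CARD('n) * exp (- ((norm x)\<^sup>2 / (2 * \<epsilon>\<^sup>2)))) =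
     (\<Prod>i\<in>(UNIV::'n set). complex_of_real (sqrt (2 * pi) / \<epsilon> * exp (- ((x $ i)\<^sup>2 / (2 * \<epsilon>\<^sup>2)))))"
    by (simp only: of_real_prod)
  show "integrable lborel (\<lambda>\<xi>::real^'n. cis (x \<bullet> \<xi>) * of_real (exp (- (\<epsilon>\<^sup>2 * (norm \<xi>)\<^sup>2 / 2))))"
    unfolding eq by (intro integral_lborel_prod gauss_1d assms)
  show "(LINT \<xi>|lborel. cis (x \<bullet> \<xi>) * of_real (exp (- (\<epsilon>\<^sup>2 * (norm \<xi>)\<^sup>2 / 2)))) =
      of_real ((sqrt (2 * pi) / \<epsilon>) ^ CARD('n) * exp (- ((norm x)\<^sup>2 / (2 * \<epsilon>\<^sup>2))))"
    unfolding eq eq2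
    by (subst integral_lborel_prod(2)) (intro gauss_1d assms, subst gauss_1d(2)[OF assms], rule refl)
qed

lemma gauss_real_integrable:
  assumes "\<epsilon> > 0"
  shows "integrable lborel (\<lambda>\<xi>::real^'n::finite. exp (- (\<epsilon>\<^sup>2 * (norm \<xi>)\<^sup>2 / 2)))"
  using integrable_norm[OF gauss_nd(1)[OF assms, of "0::real^'n"]] by (simp add: norm_mult)

section \<open>The Fourier transform on Schwartz functions\<close>

lemma lint_lebesgue:
  fixes f :: "'a::euclidean_space \<Rightarrow> 'b::{banach, second_countable_topology}"
  shows "f \<in> borel_measurable borel \<Longrightarrow> (LINT x|lebesgue. f x) = (LINT x|lborel. f x)"
  by (rule integral_completion) simp

lemma fourier_eq:
  "\<phi> \<in> borel_measurable borel \<Longrightarrow> fourier \<phi> \<xi> = (LINT x|lborel. cis (- (x \<bullet> \<xi>)) * \<phi> x)"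
  unfolding fourier_def by (rule lint_lebesgue) measurable

lemma inv_fourier_eq:
  fixes \<phi> :: "real^'n::finite \<Rightarrow> complex"
  shows "inv_fourier \<phi> x = fourier \<phi> (- x) / of_real ((2 * pi) ^ CARD('n))"
  by (simp add: inv_fourier_def fourier_def inner_commute)

lemma fourier_bound:
  assumes "integrable lborel f"
  shows "cmod (fourier f \<xi>) \<le> (LINT x|lborel. cmod (f x))"
proof -
  have "f \<in> borel_measurable borel" using assms by auto
  then have "cmod (fourier f \<xi>) \<le> (LINT x|lborel. cmod (cis (- (x \<bullet> \<xi>)) * f x))"
    by (simp only: fourier_eq integral_norm_bound)
  then show ?thesis by (simp add: norm_mult)
qed

lemma fourier_integrand_integrable:
  fixes f :: "real^'n::finite \<Rightarrow> complex"
  assumes "integrable lborel f"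
  shows "integrable lborel (\<lambda>x. cis (- (x \<bullet> \<xi>)) * f x)" "integrable lborel (\<lambda>x. cis (x \<bullet> \<xi>) * f x)"
proof -
  have [measurable]: "f \<in> borel_measurable borel" using assms by auto
  show "integrable lborel (\<lambda>x. cis (- (x \<bullet> \<xi>)) * f x)" "integrable lborel (\<lambda>x. cis (x \<bullet> \<xi>) * f x)"
    by (rule Bochner_Integration.integrable_bound[OF assms]; simp add: norm_mult)+
qed

lemma fourier_borel [measurable (raw)]:
  assumes [measurable]: "f \<in> borel_measurable borel"
  shows "fourier f \<in> borel_measurable borel"
proof -
  have "fourier f = (\<lambda>\<xi>. LINT x|lborel. cis (- (x \<bullet> \<xi>)) * f x)"
    by (intro ext fourier_eq assms)
  then show ?thesis by simp
qed

lemma inv_fourier_borel [measurable (raw)]: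
  fixes f :: "real^'a::finite \<Rightarrow> complex"
  assumes [measurable]: "f \<in> borel_measurable borel"
  shows "inv_fourier f \<in> borel_measurable borel"
proof -
  have [measurable]: "fourier f \<in> borel_measurable borel" by measurable
  have "inv_fourier f = (\<lambda>x. fourier f (- x) / of_real ((2 * pi) ^ CARD('a)))"
    by (intro ext inv_fourier_eq)
  then show ?thesis by simp
qed

lemma fourier_add:
  assumes "integrable lborel f" "integrable lborel g"
  shows "fourier (\<lambda>x. f x + g x) \<xi> = fourier f \<xi> + fourier g \<xi>"
proof -
  have [measurable]: "f \<in> borel_measurable borel" "g \<in> borel_measurable borel" using assms by auto
  show ?thesis
    using fourier_integrand_integrable[OF assms(1)] fourier_integrand_integrable[OF assms(2)]
    by (simp add: fourier_eq distrib_left)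
qed

lemma fourier_cmult: "fourier (\<lambda>x. c * f x) \<xi> = c * fourier f \<xi>"
  by (simp add: fourier_def mult.left_commute)

lemma has_derivative_quadratic_remainder:
  fixes f :: "'a::real_normed_vector \<Rightarrow> 'b::real_normed_vector"
  assumes "bounded_linear L" "\<And>h. norm (f (x + h) - f x - L h) \<le> C * (norm h)\<^sup>2"
  shows "(f has_derivative L) (at x)"
  unfolding has_derivative_at
proof
  show "((\<lambda>h. norm (f (x + h) - f x - L h) / norm h) \<longlongrightarrow> 0) (at 0)"
  proof (rule tendsto_0_le[where K = 1])
    show "((\<lambda>h. C * norm h) \<longlongrightarrow> 0) (at (0::'a))" by (auto intro!: tendsto_eq_intros)
    have "norm (f (x + h) - f x - L h) / norm h \<le> C * norm h" if "h \<noteq> 0" for h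
      using assms(2)[of h] that by (simp add: divide_le_eq power2_eq_square)
    then show "\<forall>\<^sub>F h in at 0. norm (norm (f (x + h) - f x - L h) / norm h) \<le> norm (C * norm h) * 1"
      unfolding eventually_at_filter
      by (intro always_eventually) (auto intro: order_trans[OF _ abs_ge_self])
  qed
qed fact

text \<open>The remainder of the first-order Taylor expansion of \<open>e\<^sup>-\<^sup>i\<^sup>x\<^sup>h\<close> is bounded by \<open>\<bar>x\<bar>\<^sup>2\<bar>h\<bar>\<^sup>2\<close>, and
  \<open>\<bar>x\<bar>\<^sup>2 f(x)\<close> is integrable, so that the integrated remainder is quadratic in \<open>h\<close>.\<close>

lemma fourier_has_derivative:
  fixes f :: "real^'n::finite \<Rightarrow> complex"
  assumes f: "f \<in> schwartz_functions"
  shows "(fourier f has_derivative (\<lambda>h. \<Sum>i\<in>UNIV. of_real (h $ i) * fourier (\<lambda>x. (- \<i> * of_real (x $ i)) * f x) \<xi>)) (at \<xi>)"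
proof (rule has_derivative_quadratic_remainder)
  let ?g = "\<lambda>i x. (- \<i> * of_real (x $ i)) * f x"
  have g: "?g i \<in> schwartz_functions" for i
    by (intro schwartz_multiplier multiplier.mult multiplier.const multiplier.coord f)
  note [measurable] = schwartz_borel[OF f] schwartz_borel[OF g]
  show "bounded_linear (\<lambda>h. \<Sum>i\<in>UNIV. of_real (h $ i) * fourier (?g i) \<xi>)"
    by (intro bounded_linear_sum bounded_linear_mult_const bounded_linear_compose[OF bounded_linear_of_real] bounded_linear_vec_nth)
  have int2: "integrable lborel (\<lambda>x. (norm x)\<^sup>2 * cmod (f x))"
  proof (rule Bochner_Integration.integrable_bound[OF rapid_integrable(1)[OF schwartz_rapid[OF f], of 2]])
    show "AE x in lborel. norm ((norm x)\<^sup>2 * cmod (f x)) \<le> norm ((1 + norm x) ^ 2 * cmod (f x))"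
      by (intro AE_I2) (auto simp: abs_mult intro!: mult_right_mono power_mono)
  qed measurable
  fix h
  have e: "cis (- (x \<bullet> (\<xi> + h))) * f x - cis (- (x \<bullet> \<xi>)) * f x - (\<Sum>i\<in>UNIV. of_real (h $ i) * (cis (- (x \<bullet> \<xi>)) * ?g i x)) =
      cis (- (x \<bullet> \<xi>)) * ((iexp (- (x \<bullet> h)) - (\<Sum>k\<le>1. (\<i> * of_real (- (x \<bullet> h))) ^ k / fact k)) * f x)" for x
  proof -
    have "(\<Sum>i\<in>UNIV. of_real (h $ i) * (cis (- (x \<bullet> \<xi>)) * ?g i x)) =
      cis (- (x \<bullet> \<xi>)) * (- \<i> * (\<Sum>i\<in>UNIV. of_real (x $ i) * of_real (h $ i)) * f x)"
      by (simp add: sum_distrib_left sum_distrib_right sum_negf mult_ac)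
    also have "(\<Sum>i\<in>UNIV. complex_of_real (x $ i) * of_real (h $ i)) = of_real (x \<bullet> h)"
      by (simp add: inner_vec_def)
    finally have s: "(\<Sum>i\<in>UNIV. of_real (h $ i) * (cis (- (x \<bullet> \<xi>)) * ?g i x)) =
      cis (- (x \<bullet> \<xi>)) * (- \<i> * of_real (x \<bullet> h) * f x)" .
    have ex: "exp (- (\<i> * of_real (x \<bullet> h))) = cis (- (x \<bullet> h))" by (simp add: cis_conv_exp)
    have "cis (- (x \<bullet> (\<xi> + h))) = cis (- (x \<bullet> \<xi>)) * cis (- (x \<bullet> h))"
      by (simp add: inner_add_right cis_mult)
    then show ?thesis unfolding s by (simp add: ex algebra_simps)
  qed
  have b: "norm (cis (- (x \<bullet> \<xi>)) * ((iexp (- (x \<bullet> h)) - (\<Sum>k\<le>1. (\<i> * of_real (- (x \<bullet> h))) ^ k / fact k)) * f x))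
    \<le> (norm h)\<^sup>2 * ((norm x)\<^sup>2 * cmod (f x))" for x
  proof -
    have "cmod (iexp (- (x \<bullet> h)) - (\<Sum>k\<le>1. (\<i> * of_real (- (x \<bullet> h))) ^ k / fact k)) \<le> \<bar>- (x \<bullet> h)\<bar> ^ Suc 1 / fact (Suc 1)"
      by (rule iexp_approx1)
    also have "\<dots> \<le> \<bar>x \<bullet> h\<bar>\<^sup>2" by (simp add: power2_eq_square)
    also have "\<dots> \<le> (norm x * norm h)\<^sup>2" by (intro power_mono Cauchy_Schwarz_ineq2) auto
    finally have "cmod (iexp (- (x \<bullet> h)) - (\<Sum>k\<le>1. (\<i> * of_real (- (x \<bullet> h))) ^ k / fact k)) * cmod (f x)
        \<le> (norm x * norm h)\<^sup>2 * cmod (f x)" by (rule mult_right_mono) auto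
    then show ?thesis by (simp only: norm_mult norm_cis power_mult_distrib mult_1 mult_ac)
  qed
  have "fourier f (\<xi> + h) - fourier f \<xi> - (\<Sum>i\<in>UNIV. of_real (h $ i) * fourier (?g i) \<xi>) =
     (LINT x|lborel. cis (- (x \<bullet> (\<xi> + h))) * f x - cis (- (x \<bullet> \<xi>)) * f x - (\<Sum>i\<in>UNIV. of_real (h $ i) * (cis (- (x \<bullet> \<xi>)) * ?g i x)))"
    using fourier_integrand_integrable(1)[OF schwartz_integrable(1)[OF f]]
      fourier_integrand_integrable(1)[OF schwartz_integrable(1)[OF g]]
    by (simp only: fourier_eq schwartz_borel[OF f] schwartz_borel[OF g] Bochner_Integration.integral_diff
      Bochner_Integration.integral_sum Bochner_Integration.integrable_diff Bochner_Integration.integrable_sum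
      integral_mult_right_zero integrable_mult_right)
  also have "\<dots> = (LINT x|lborel. cis (- (x \<bullet> \<xi>)) * ((iexp (- (x \<bullet> h)) - (\<Sum>k\<le>1. (\<i> * of_real (- (x \<bullet> h))) ^ k / fact k)) * f x))"
    unfolding e ..
  also have "cmod \<dots> \<le> (LINT x|lborel. (norm h)\<^sup>2 * ((norm x)\<^sup>2 * cmod (f x)))"
  proof (rule Bochner_Integration.integral_norm_bound_integral)
    show i: "integrable lborel (\<lambda>x. (norm h)\<^sup>2 * ((norm x)\<^sup>2 * cmod (f x)))"
      by (intro integrable_mult_right int2)
    show "integrable lborel (\<lambda>x. cis (- (x \<bullet> \<xi>)) * ((iexp (- (x \<bullet> h)) - (\<Sum>k\<le>1. (\<i> * of_real (- (x \<bullet> h))) ^ k / fact k)) * f x))"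
      by (rule Bochner_Integration.integrable_bound[OF i])
        (measurable, use b in \<open>auto intro!: AE_I2 intro: order_trans[OF _ abs_ge_self]\<close>)
  qed (rule b)
  also have "\<dots> = (LINT x|lborel. (norm x)\<^sup>2 * cmod (f x)) * (norm h)\<^sup>2"
    by simp
  finally show "cmod (fourier f (\<xi> + h) - fourier f \<xi> - (\<Sum>i\<in>UNIV. of_real (h $ i) * fourier (?g i) \<xi>)) \<le>
     (LINT x|lborel. (norm x)\<^sup>2 * cmod (f x)) * (norm h)\<^sup>2" .
qed

lemma partial_deriv_fourier:
  fixes f :: "real^'n::finite \<Rightarrow> complex"
  assumes f: "f \<in> schwartz_functions"
  shows "partial_deriv i (fourier f) = fourier (\<lambda>x. (- \<i> * of_real (x $ i)) * f x)"
proof -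
  have "(\<Sum>j\<in>UNIV. complex_of_real (axis i 1 $ j) * G j) = G i" for G
  proof -
    have "(\<Sum>j\<in>UNIV. complex_of_real (axis i 1 $ j) * G j) = (\<Sum>j\<in>UNIV. if j = i then G i else 0)"
      by (intro sum.cong) (auto simp: axis_def)
    then show ?thesis by simp
  qed
  then show ?thesis
    by (subst partial_deriv_eqI[OF fourier_has_derivative[OF f]]) simp
qed

text \<open>Uniform decay of the values near \<open>x\<close>; it provides the dominating function for difference
  quotients.\<close>

lemma schwartz_bound_near:
  fixes g :: "real^'n::finite \<Rightarrow> complex"
  assumes "rapid g"
  shows "\<exists>C. \<forall>x z. norm (z - x) \<le> 1 \<longrightarrow> cmod (g z) \<le> C * inverse ((1 + norm x) ^ (2 * CARD('n)))"
proof -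
  obtain C where C: "\<And>x. (1 + norm x) ^ (2 * CARD('n)) * cmod (g x) \<le> C"
    using assms unfolding rapid_def by metis
  have "cmod (g z) \<le> (2 ^ (2 * CARD('n)) * C) * inverse ((1 + norm x) ^ (2 * CARD('n)))"
    if "norm (z - x) \<le> 1" for x z
  proof -
    have "norm x \<le> norm z + norm (z - x)"
      using norm_triangle_sub[of x z] by (simp add: norm_minus_commute)
    then have "norm x \<le> norm z + 1" using that by (rule order_trans[OF _ add_left_mono])
    then have "1 + norm x \<le> 2 * (1 + norm z)" using norm_ge_zero[of z] by (simp del: norm_ge_zero)
    then have "(1 + norm x) ^ (2 * CARD('n)) \<le> (2 * (1 + norm z)) ^ (2 * CARD('n))"
      by (intro power_mono) auto
    then have "(1 + norm x) ^ (2 * CARD('n)) * cmod (g z) \<le> (2 * (1 + norm z)) ^ (2 * CARD('n)) * cmod (g z)"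
      by (intro mult_right_mono) auto
    also have "\<dots> \<le> 2 ^ (2 * CARD('n)) * C"
      unfolding power_mult_distrib mult.assoc by (rule mult_left_mono[OF C]) simp
    finally have "cmod (g z) * (1 + norm x) ^ (2 * CARD('n)) \<le> 2 ^ (2 * CARD('n)) * C"
      by (simp only: mult.commute)
    moreover have "(1 + norm x) ^ (2 * CARD('n)) > 0" by (intro zero_less_power) (auto intro: add_pos_nonneg)
    ultimately have "cmod (g z) \<le> 2 ^ (2 * CARD('n)) * C / (1 + norm x) ^ (2 * CARD('n))"
      by (simp only: pos_le_divide_eq)
    then show ?thesis by (simp only: divide_inverse)
  qed
  then show ?thesis by blast
qed

text \<open>The integral of a difference quotient vanishes by translation invariance, and the difference
  quotients converge to the partial derivative with an integrable majorant.\<close>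

lemma integral_partial_deriv:
  fixes f :: "real^'n::finite \<Rightarrow> complex"
  assumes f: "f \<in> schwartz_functions"
  shows "(LINT x|lborel. partial_deriv i f x) = 0"
proof -
  define e :: "real^'n" where "e = axis i 1"
  define h where "h = (\<lambda>k. inverse (real (Suc k)))"
  have h: "h k > 0" "h k \<le> 1" for k by (auto simp: h_def field_simps)
  note [measurable] = schwartz_borel[OF f] schwartz_borel[OF schwartz_partial_deriv[OF f]]
  define g where "g = (\<lambda>k x. (f (h k *\<^sub>R e + x) - f x) / of_real (h k))"
  have d: "((\<lambda>t. f (x + t *\<^sub>R e)) has_vector_derivative partial_deriv i f (x + t *\<^sub>R e)) (at t)" for x t
  proof -
    have l: "linear (frechet_derivative f (at (x + t *\<^sub>R e)))"
      using smooth_has_derivative[OF schwartz_smooth[OF f]] has_derivative_linear by blast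
    have "((\<lambda>t. f (x + t *\<^sub>R e)) has_derivative (\<lambda>s. frechet_derivative f (at (x + t *\<^sub>R e)) (s *\<^sub>R e))) (at t)"
      by (rule has_derivative_compose[OF _ smooth_has_derivative[OF schwartz_smooth[OF f]]])
        (auto intro!: derivative_eq_intros)
    then show ?thesis
      unfolding has_vector_derivative_def partial_deriv_def e_def[symmetric] linear_scale[OF l] .
  qed
  have int: "integrable lborel f" by (rule schwartz_integrable[OF f])
  have int': "integrable lborel (\<lambda>x. f (a + x))" for a using int by (subst integral_translate) auto
  have "(LINT x|lborel. g k x) = ((LINT x|lborel. f (h k *\<^sub>R e + x)) - (LINT x|lborel. f x)) / of_real (h k)" for k
    unfolding g_def by (subst integral_divide_zero, subst Bochner_Integration.integral_diff[OF int' int]) simp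
  then have g0: "(LINT x|lborel. g k x) = 0" for k by (simp add: integral_translate(2))
  obtain C where C: "\<And>x z. norm (z - x) \<le> 1 \<Longrightarrow> cmod (partial_deriv i f z) \<le> C * inverse ((1 + norm x) ^ (2 * CARD('n)))"
    using schwartz_bound_near[OF schwartz_rapid[OF schwartz_partial_deriv[OF f]]] by blast
  have bound: "cmod (g k x) \<le> C * inverse ((1 + norm x) ^ (2 * CARD('n)))" for k x
  proof -
    let ?B = "C * inverse ((1 + norm x) ^ (2 * CARD('n)))"
    have "norm (f (x + h k *\<^sub>R e) - f (x + 0 *\<^sub>R e)) \<le> ?B * norm (h k - 0)"
    proof (rule differentiable_bound[of "{0..h k}" "\<lambda>t. f (x + t *\<^sub>R e)" "\<lambda>t s. s *\<^sub>R partial_deriv i f (x + t *\<^sub>R e)"])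
      fix t assume t: "t \<in> {0..h k}"
      show "((\<lambda>t. f (x + t *\<^sub>R e)) has_derivative (\<lambda>s. s *\<^sub>R partial_deriv i f (x + t *\<^sub>R e))) (at t within {0..h k})"
        using d[of x t] by (simp add: has_vector_derivative_def has_derivative_at_withinI)
      have "cmod (partial_deriv i f (x + t *\<^sub>R e)) \<le> ?B"
        using t h(2)[of k] by (intro C) (auto simp: e_def)
      then show "onorm (\<lambda>s. s *\<^sub>R partial_deriv i f (x + t *\<^sub>R e)) \<le> ?B"
        by (simp add: onorm_scaleR_left_lemma onorm_id[where 'a = real] onorm_scaleR_left[OF bounded_linear_ident])
    qed (use h(1)[of k] in auto)
    then have "cmod (f (h k *\<^sub>R e + x) - f x) \<le> ?B * h k"
      using h(1)[of k] by (simp add: add.commute)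
    then show ?thesis using h(1)[of k] by (simp add: g_def norm_divide pos_divide_le_eq)
  qed
  have lim: "(\<lambda>k. g k x) \<longlonglongrightarrow> partial_deriv i f x" for x
  proof -
    have "((\<lambda>s. (f (x + s *\<^sub>R e) - f x) /\<^sub>R s) \<longlongrightarrow> partial_deriv i f x) (at 0)"
    proof (rule iffD1[OF LIM_zero_iff], rule tendsto_norm_zero_cancel)
      have "((\<lambda>s. cmod (f (x + s *\<^sub>R e) - f x - s *\<^sub>R partial_deriv i f x) / \<bar>s\<bar>) \<longlongrightarrow> 0) (at 0)"
        using d[of x 0] by (simp add: has_vector_derivative_def has_derivative_at)
      then show "((\<lambda>s. cmod ((f (x + s *\<^sub>R e) - f x) /\<^sub>R s - partial_deriv i f x)) \<longlongrightarrow> 0) (at 0)"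
      proof (rule Lim_transform_eventually)
        have "cmod (u - s *\<^sub>R D) / \<bar>s\<bar> = cmod (u /\<^sub>R s - D)" if "s \<noteq> 0" for s u D
        proof -
          have "u /\<^sub>R s - D = (u - s *\<^sub>R D) /\<^sub>R s" using that by (simp add: scaleR_diff_right)
          then show ?thesis using that by (simp add: divide_inverse mult.commute)
        qed
        then show "\<forall>\<^sub>F s in at 0. cmod (f (x + s *\<^sub>R e) - f x - s *\<^sub>R partial_deriv i f x) / \<bar>s\<bar> =
            cmod ((f (x + s *\<^sub>R e) - f x) /\<^sub>R s - partial_deriv i f x)"
          unfolding eventually_at_filter by (intro always_eventually) auto
      qed
    qed
    moreover have "filterlim h (at 0) sequentially"
      unfolding filterlim_at using h(1) LIMSEQ_inverse_real_of_nat
      by (auto simp: h_def[abs_def] simp del: of_nat_Suc)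
    ultimately have "(\<lambda>k. (f (x + h k *\<^sub>R e) - f x) /\<^sub>R h k) \<longlonglongrightarrow> partial_deriv i f x"
      by (rule filterlim_compose)
    then show ?thesis
      by (simp add: g_def add.commute scaleR_conv_of_real divide_inverse mult.commute)
  qed
  have "(\<lambda>k. LINT x|lborel. g k x) \<longlonglongrightarrow> (LINT x|lborel. partial_deriv i f x)"
  proof (rule integral_dominated_convergence)
    show "integrable lborel (\<lambda>x::real^'n. C * inverse ((1 + norm x) ^ (2 * CARD('n))))"
      by (intro integrable_mult_right integrable_poly_decay)
    show "AE x in lborel. (\<lambda>k. g k x) \<longlonglongrightarrow> partial_deriv i f x" using lim by auto
    show "AE x in lborel. norm (g k x) \<le> C * inverse ((1 + norm x) ^ (2 * CARD('n)))" for k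
      using bound by auto
    show "g k \<in> borel_measurable lborel" for k unfolding g_def by measurable
  qed measurable
  then have "(\<lambda>k. 0) \<longlonglongrightarrow> (LINT x|lborel. partial_deriv i f x)" by (simp only: g0)
  then show ?thesis by (metis LIMSEQ_unique tendsto_const)
qed

text \<open>Apply \<open>integral_partial_deriv\<close> to \<open>e\<^sup>-\<^sup>i\<^sup>x\<^sup>\<xi> f(x)\<close>.\<close>

lemma fourier_partial_deriv:
  fixes f :: "real^'n::finite \<Rightarrow> complex"
  assumes f: "f \<in> schwartz_functions"
  shows "fourier (partial_deriv i f) \<xi> = \<i> * of_real (\<xi> $ i) * fourier f \<xi>"
proof -
  note [measurable] = schwartz_borel[OF f] schwartz_borel[OF schwartz_partial_deriv[OF f]]
  let ?p = "\<lambda>x. cis (x \<bullet> (- \<xi>)) * f x"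
  have p: "?p \<in> schwartz_functions" by (intro schwartz_multiplier multiplier.cis f)
  have "(?p has_derivative (\<lambda>h. cis (x \<bullet> (- \<xi>)) * frechet_derivative f (at x) h +
     (of_real (h \<bullet> (- \<xi>)) * (\<i> * cis (x \<bullet> (- \<xi>)))) * f x)) (at x)" for x
    by (auto intro!: derivative_eq_intros smooth_has_derivative[OF schwartz_smooth[OF f]] simp: scaleR_conv_of_real)
  then have "partial_deriv i ?p = (\<lambda>x. cis (x \<bullet> (- \<xi>)) * frechet_derivative f (at x) (axis i 1) +
     (of_real (axis i 1 \<bullet> (- \<xi>)) * (\<i> * cis (x \<bullet> (- \<xi>)))) * f x)"
    by (rule partial_deriv_eqI)
  then have "partial_deriv i ?p = (\<lambda>x. cis (- (x \<bullet> \<xi>)) * partial_deriv i f x - (\<i> * of_real (\<xi> $ i)) * (cis (- (x \<bullet> \<xi>)) * f x))"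
    by (simp add: partial_deriv_def inner_axis' fun_eq_iff)
  then have "0 = (LINT x|lborel. cis (- (x \<bullet> \<xi>)) * partial_deriv i f x - (\<i> * of_real (\<xi> $ i)) * (cis (- (x \<bullet> \<xi>)) * f x))"
    using integral_partial_deriv[OF p, of i] by simp
  also have "\<dots> = fourier (partial_deriv i f) \<xi> - \<i> * of_real (\<xi> $ i) * fourier f \<xi>"
    using fourier_integrand_integrable(1)[OF schwartz_integrable(1)[OF f]]
      fourier_integrand_integrable(1)[OF schwartz_integrable(1)[OF schwartz_partial_deriv[OF f]]]
    by (simp only: fourier_eq schwartz_borel[OF f] schwartz_borel[OF schwartz_partial_deriv[OF f]]
      Bochner_Integration.integral_diff integrable_mult_right integral_mult_right_zero)
  finally show ?thesis by simp
qed

text \<open>The sum of the seminorms that occurs in the definition of tempered distributions.\<close>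

definition schwartz_seminorm :: "nat \<Rightarrow> (real^'n::finite \<Rightarrow> complex) \<Rightarrow> real" where
  "schwartz_seminorm N \<phi> = (\<Sum>\<alpha> | length \<alpha> \<le> N. SUP x. (1 + norm x) ^ N * cmod (partials \<alpha> \<phi> x))"

lemma finite_multiindices: "finite {\<alpha>::'n::finite list. length \<alpha> \<le> N}"
  using finite_lists_length_le[of "UNIV::'n set" N] by simp

lemma rapid_bdd: "rapid f \<Longrightarrow> bdd_above (range (\<lambda>x. (1 + norm x) ^ N * cmod (f x)))"
  unfolding rapid_def by (auto simp: bdd_above_def)

lemma le_schwartz_seminorm:
  fixes \<phi> :: "real^'n::finite \<Rightarrow> complex"
  assumes "\<phi> \<in> schwartz_functions" "length \<alpha> \<le> N"
  shows "(1 + norm x) ^ N * cmod (partials \<alpha> \<phi> x) \<le> schwartz_seminorm N \<phi>"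
proof -
  have bdd: "bdd_above (range (\<lambda>x. (1 + norm x) ^ N * cmod (partials \<beta> \<phi> x)))" for \<beta>
    using assms(1) by (intro rapid_bdd) (simp add: schwartz_functions_iff)
  have up: "(1 + norm x) ^ N * cmod (partials \<beta> \<phi> x) \<le> (SUP x. (1 + norm x) ^ N * cmod (partials \<beta> \<phi> x))" for \<beta> x
    by (rule cSUP_upper[OF UNIV_I bdd])
  have "0 \<le> (SUP x. (1 + norm x) ^ N * cmod (partials \<beta> \<phi> x))" for \<beta>
    by (rule order_trans[OF _ up[of 0]]) simp
  then have "(SUP x. (1 + norm x) ^ N * cmod (partials \<alpha> \<phi> x)) \<le> schwartz_seminorm N \<phi>"
    unfolding schwartz_seminorm_def by (intro member_le_sum) (use assms(2) finite_multiindices in auto)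
  then show ?thesis using up[of x \<alpha>] by linarith
qed

text \<open>Reduces a power of \<open>1 + \<bar>\<xi>\<bar>\<close> to powers of single coordinates, each of which the Fourier transform
  turns into a repeated partial derivative.\<close>

lemma power_norm_le:
  fixes \<xi> :: "real^'n::finite"
  shows "(1 + norm \<xi>) ^ k \<le> (real CARD('n) + 1) ^ k * (1 + (\<Sum>i\<in>UNIV. \<bar>\<xi> $ i\<bar> ^ k))"
proof -
  define m where "m = Max (insert 1 (range (\<lambda>i. \<bar>\<xi> $ i\<bar>)))"
  have m1: "m \<ge> 1" and mi: "\<bar>\<xi> $ i\<bar> \<le> m" for i
    unfolding m_def by (rule Max_ge; auto)+
  have "m \<in> insert 1 (range (\<lambda>i. \<bar>\<xi> $ i\<bar>))" unfolding m_def by (intro Max_in) auto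
  then have mk: "m ^ k \<le> 1 + (\<Sum>i\<in>UNIV. \<bar>\<xi> $ i\<bar> ^ k)"
  proof
    assume "m \<in> range (\<lambda>i. \<bar>\<xi> $ i\<bar>)"
    then obtain i where "m = \<bar>\<xi> $ i\<bar>" by blast
    moreover have "\<bar>\<xi> $ i\<bar> ^ k \<le> (\<Sum>i\<in>UNIV. \<bar>\<xi> $ i\<bar> ^ k)" by (intro member_le_sum) auto
    ultimately show ?thesis by simp
  qed (simp add: sum_nonneg)
  have "norm \<xi> \<le> (\<Sum>i\<in>UNIV. \<bar>\<xi> $ i\<bar>)" by (rule norm_le_l1_cart)
  also have "\<dots> \<le> (\<Sum>i\<in>(UNIV::'n set). m)" by (intro sum_mono mi)
  finally have "1 + norm \<xi> \<le> (real CARD('n) + 1) * m" using m1 by (simp add: algebra_simps)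
  then have "(1 + norm \<xi>) ^ k \<le> ((real CARD('n) + 1) * m) ^ k" by (intro power_mono) auto
  also have "\<dots> \<le> (real CARD('n) + 1) ^ k * (1 + (\<Sum>i\<in>UNIV. \<bar>\<xi> $ i\<bar> ^ k))"
    unfolding power_mult_distrib using mk by (intro mult_left_mono) auto
  finally show ?thesis .
qed

text \<open>The quantitative form, with one seminorm of \<open>\<phi>\<close> on the right, is what the continuity of a
  functional given by its Fourier transform will require.\<close>

lemma fourier_decay:
  "\<exists>C\<ge>0. \<exists>N. \<forall>\<phi>\<in>schwartz_functions. \<forall>\<xi>::real^'n::finite. (1 + norm \<xi>) ^ k * cmod (fourier \<phi> \<xi>) \<le> C * schwartz_seminorm N \<phi>"
proof -
  define N where "N = k + 2 * CARD('n)"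
  define W where "W = (LINT x::real^'n|lborel. inverse ((1 + norm x) ^ (2 * CARD('n))))"
  have W: "W \<ge> 0" unfolding W_def by (intro Bochner_Integration.integral_nonneg) auto
  have L1: "(LINT x|lborel. cmod (partials \<alpha> \<phi> x)) \<le> W * schwartz_seminorm N \<phi>"
    if \<phi>: "\<phi> \<in> schwartz_functions" and \<alpha>: "length \<alpha> \<le> k" for \<alpha> and \<phi> :: "real^'n \<Rightarrow> complex"
  proof -
    have "(LINT x|lborel. cmod (partials \<alpha> \<phi> x)) \<le> (LINT x::real^'n|lborel. schwartz_seminorm N \<phi> * inverse ((1 + norm x) ^ (2 * CARD('n))))"
    proof (rule Bochner_Integration.integral_mono)
      show "integrable lborel (\<lambda>x. cmod (partials \<alpha> \<phi> x))" by (intro schwartz_integrable schwartz_partials \<phi>)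
      show "integrable lborel (\<lambda>x::real^'n. schwartz_seminorm N \<phi> * inverse ((1 + norm x) ^ (2 * CARD('n))))"
        by (intro integrable_mult_right integrable_poly_decay)
      fix x :: "real^'n"
      have p: "(1 + norm x) ^ (2 * CARD('n)) > 0" by (intro zero_less_power) (auto intro: add_pos_nonneg)
      have "(1 + norm x) ^ (2 * CARD('n)) * cmod (partials \<alpha> \<phi> x) \<le> (1 + norm x) ^ N * cmod (partials \<alpha> \<phi> x)"
        unfolding N_def by (intro mult_right_mono power_increasing) auto
      also have "\<dots> \<le> schwartz_seminorm N \<phi>" using \<alpha> by (intro le_schwartz_seminorm \<phi>) (auto simp: N_def)
      finally have "(1 + norm x) ^ (2 * CARD('n)) * cmod (partials \<alpha> \<phi> x) \<le> schwartz_seminorm N \<phi>" .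
      then have "cmod (partials \<alpha> \<phi> x) * (1 + norm x) ^ (2 * CARD('n)) \<le> schwartz_seminorm N \<phi>"
        by (subst mult.commute)
      then have "cmod (partials \<alpha> \<phi> x) \<le> schwartz_seminorm N \<phi> / (1 + norm x) ^ (2 * CARD('n))"
        by (subst pos_le_divide_eq[OF p])
      then show "cmod (partials \<alpha> \<phi> x) \<le> schwartz_seminorm N \<phi> * inverse ((1 + norm x) ^ (2 * CARD('n)))"
        by (subst divide_inverse[symmetric])
    qed
    then show ?thesis by (simp add: W_def mult.commute)
  qed
  have fourier_rep: "cmod (fourier (partials (replicate m i) \<phi>) \<xi>) = \<bar>\<xi> $ i\<bar> ^ m * cmod (fourier \<phi> \<xi>)"
    if \<phi>: "\<phi> \<in> schwartz_functions" for m i \<xi> and \<phi> :: "real^'n \<Rightarrow> complex"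
    by (induction m) (simp_all add: partials_Cons fourier_partial_deriv[OF schwartz_partials[OF \<phi>]] norm_mult)
  have b: "\<bar>\<xi> $ i\<bar> ^ m * cmod (fourier \<phi> \<xi>) \<le> W * schwartz_seminorm N \<phi>"
    if \<phi>: "\<phi> \<in> schwartz_functions" and "m \<le> k" for m i \<xi> and \<phi> :: "real^'n \<Rightarrow> complex"
    unfolding fourier_rep[OF \<phi>, symmetric]
    by (rule order_trans[OF fourier_bound[OF schwartz_integrable(1)[OF schwartz_partials[OF \<phi>]]] L1[OF \<phi>]])
       (use that(2) in simp)
  define C where "C = (real CARD('n) + 1) ^ k * ((1 + real CARD('n)) * W)"
  have "(1 + norm \<xi>) ^ k * cmod (fourier \<phi> \<xi>) \<le> C * schwartz_seminorm N \<phi>" if \<phi>: "\<phi> \<in> schwartz_functions" for \<phi> and \<xi> :: "real^'n"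
  proof -
    have "(1 + norm \<xi>) ^ k * cmod (fourier \<phi> \<xi>) \<le>
       (real CARD('n) + 1) ^ k * (1 + (\<Sum>i\<in>UNIV. \<bar>\<xi> $ i\<bar> ^ k)) * cmod (fourier \<phi> \<xi>)"
      by (intro mult_right_mono power_norm_le) auto
    \<comment> \<open>The summand \<open>1\<close> is the power with exponent zero of an arbitrary coordinate.\<close>
    also have "\<dots> = (real CARD('n) + 1) ^ k * (\<bar>\<xi> $ undefined\<bar> ^ 0 * cmod (fourier \<phi> \<xi>) + (\<Sum>i\<in>UNIV. \<bar>\<xi> $ i\<bar> ^ k * cmod (fourier \<phi> \<xi>)))"
      by (simp add: algebra_simps sum_distrib_left sum_distrib_right)
    also have "\<dots> \<le> (real CARD('n) + 1) ^ k * (W * schwartz_seminorm N \<phi> + (\<Sum>i\<in>(UNIV::'n set). W * schwartz_seminorm N \<phi>))"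
      by (intro mult_left_mono add_mono sum_mono b \<phi>) auto
    also have "\<dots> = C * schwartz_seminorm N \<phi>" by (simp add: C_def algebra_simps)
    finally show ?thesis .
  qed
  moreover have "C \<ge> 0" using W by (simp add: C_def)
  ultimately show ?thesis by blast
qed

lemma fourier_schwartz:
  "f \<in> schwartz_functions \<Longrightarrow> fourier f \<in> schwartz_functions"
proof (rule schwartz_coinduct[where P = "\<lambda>g. \<exists>f\<in>schwartz_functions. g = fourier f"])
  fix g :: "real^'a \<Rightarrow> complex"
  assume "\<exists>f\<in>schwartz_functions. g = fourier f"
  then obtain f where f: "f \<in> schwartz_functions" "g = fourier f" by blast
  have "rapid g" unfolding rapid_def
  proof
    fix k
    obtain C N where "\<forall>\<phi>\<in>schwartz_functions. \<forall>\<xi>::real^'a. (1 + norm \<xi>) ^ k * cmod (fourier \<phi> \<xi>) \<le> C * schwartz_seminorm N \<phi>"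
      using fourier_decay[of k] by blast
    then show "\<exists>C. \<forall>x. (1 + norm x) ^ k * cmod (g x) \<le> C" using f by blast
  qed
  moreover have "g differentiable (at x)" for x
    using fourier_has_derivative[OF f(1)] f(2) unfolding differentiable_def by blast
  moreover have "\<exists>f\<in>schwartz_functions. partial_deriv i g = fourier f" for i
    unfolding f(2) partial_deriv_fourier[OF f(1)]
    by (intro bexI, rule refl) (intro schwartz_multiplier multiplier.mult multiplier.const multiplier.coord f(1))
  ultimately show "rapid g \<and> (\<forall>x. g differentiable (at x)) \<and> (\<forall>i. \<exists>f\<in>schwartz_functions. partial_deriv i g = fourier f)"
    by blast
qed blast

lemma inv_fourier_schwartz:
  fixes f :: "real^'n::finite \<Rightarrow> complex"
  assumes "f \<in> schwartz_functions"
  shows "inv_fourier f \<in> schwartz_functions"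
proof -
  have "(\<lambda>x. inverse (of_real ((2 * pi) ^ CARD('n))) * fourier f (- x)) \<in> schwartz_functions"
    by (intro schwartz_cmult schwartz_uminus fourier_schwartz assms)
  then show ?thesis by (simp add: inv_fourier_eq[abs_def] divide_inverse mult.commute)
qed

section \<open>Fourier inversion\<close>

lemma pair_integrable:
  fixes f g :: "real^'n::finite \<Rightarrow> complex"
  assumes "integrable lborel f" "integrable lborel g"
    and [measurable]: "k \<in> borel_measurable (borel \<Otimes>\<^sub>M borel)" and k: "\<And>x y. cmod (k (x, y)) \<le> 1"
  shows "integrable (lborel \<Otimes>\<^sub>M lborel) (\<lambda>(x, y). k (x, y) * (f x * g y))"
proof -
  have [measurable]: "f \<in> borel_measurable borel" "g \<in> borel_measurable borel" using assms by auto
  have 1: "integrable (lborel \<Otimes>\<^sub>M lborel) (\<lambda>z. f (fst z) * g (snd z))"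
  proof (rule lborel_pair.Fubini_integrable)
    have "(\<lambda>x. LINT y|lborel. norm (f (fst (x, y)) * g (snd (x, y)))) = (\<lambda>x. (LINT y|lborel. norm (g y)) * norm (f x))"
      by (simp add: norm_mult mult.commute)
    then show "integrable lborel (\<lambda>x. LINT y|lborel. norm (f (fst (x, y)) * g (snd (x, y))))"
      using assms(1) by (simp only:) (intro integrable_mult_right integrable_norm)
    show "AE x in lborel. integrable lborel (\<lambda>y. f (fst (x, y)) * g (snd (x, y)))"
      using assms(2) by simp
  qed measurable
  have "cmod (k (x, y)) * (cmod (f x) * cmod (g y)) \<le> cmod (f x) * cmod (g y)" for x y
    by (rule mult_left_le_one_le) (use k in auto)
  then show ?thesis
    by (intro Bochner_Integration.integrable_bound[OF 1]) (auto simp: norm_mult)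
qed

lemma Fubini_kernel:
  fixes f g :: "real^'n::finite \<Rightarrow> complex"
  assumes "integrable lborel f" "integrable lborel g"
    and "k \<in> borel_measurable (borel \<Otimes>\<^sub>M borel)" and "\<And>x y. cmod (k (x, y)) \<le> 1"
  shows "(LINT y|lborel. (LINT x|lborel. k (x, y) * (f x * g y))) = (LINT x|lborel. (LINT y|lborel. k (x, y) * (f x * g y)))"
  using lborel_pair.Fubini_integral[OF pair_integrable[OF assms]] by simp

lemma fourier_duality:
  fixes f g :: "real^'n::finite \<Rightarrow> complex"
  assumes "integrable lborel f" "integrable lborel g"
  shows "(LINT \<xi>|lborel. fourier f \<xi> * g \<xi>) = (LINT x|lborel. f x * fourier g x)"
proof -
  have [measurable]: "f \<in> borel_measurable borel" "g \<in> borel_measurable borel" using assms by auto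
  have "(LINT \<xi>|lborel. fourier f \<xi> * g \<xi>) = (LINT \<xi>|lborel. (LINT x|lborel. cis (- (fst (x, \<xi>) \<bullet> snd (x, \<xi>))) * (f x * g \<xi>)))"
    by (simp add: fourier_eq flip: integral_mult_left_zero) (simp add: mult_ac)
  also have "\<dots> = (LINT x|lborel. (LINT \<xi>|lborel. cis (- (fst (x, \<xi>) \<bullet> snd (x, \<xi>))) * (f x * g \<xi>)))"
    by (rule Fubini_kernel[OF assms, where k = "\<lambda>z. cis (- (fst z \<bullet> snd z))"]) simp_all
  also have "\<dots> = (LINT x|lborel. f x * fourier g x)"
    by (simp add: fourier_eq flip: integral_mult_right_zero) (simp add: mult_ac inner_commute)
  finally show ?thesis .
qed

text \<open>Written after the substitution that moves the dilation from the Gaussian into the function, so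
  that dominated convergence applies with a fixed Gaussian.\<close>

lemma approx_identity:
  fixes f :: "real^'n::finite \<Rightarrow> complex"
  assumes "continuous_on UNIV f" "\<And>x. cmod (f x) \<le> C"
  shows "(\<lambda>k. LINT z|lborel. f (x + inverse (real (Suc k)) *\<^sub>R z) * of_real (exp (- ((norm z)\<^sup>2 / 2))))
     \<longlonglongrightarrow> f x * of_real (sqrt (2 * pi) ^ CARD('n))"
proof -
  have [measurable]: "f \<in> borel_measurable borel" using assms(1) by (rule borel_measurable_continuous_onI)
  have "(\<lambda>k. LINT z|lborel. f (x + inverse (real (Suc k)) *\<^sub>R z) * of_real (exp (- ((norm z)\<^sup>2 / 2))))
     \<longlonglongrightarrow> (LINT z::real^'n|lborel. f x * of_real (exp (- ((norm z)\<^sup>2 / 2))))"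
  proof (rule integral_dominated_convergence)
    show "integrable lborel (\<lambda>z::real^'n. C * exp (- ((norm z)\<^sup>2 / 2)))"
      using gauss_real_integrable[of 1, where 'n = 'n] by (intro integrable_mult_right) simp
    have "(\<lambda>k. x + inverse (real (Suc k)) *\<^sub>R z) \<longlonglongrightarrow> x + 0 *\<^sub>R z" for z
      by (intro tendsto_intros LIMSEQ_inverse_real_of_nat)
    then have "(\<lambda>k. f (x + inverse (real (Suc k)) *\<^sub>R z)) \<longlonglongrightarrow> f (x + 0 *\<^sub>R z)" for z
      using assms(1) by (intro continuous_on_tendsto_compose[OF assms(1)]) auto
    then show "AE z in lborel. (\<lambda>k. f (x + inverse (real (Suc k)) *\<^sub>R z) * of_real (exp (- ((norm z)\<^sup>2 / 2)))) \<longlonglongrightarrow> f x * of_real (exp (- ((norm z)\<^sup>2 / 2)))"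
      by (intro AE_I2 tendsto_mult tendsto_const) simp
    show "AE z in lborel. norm (f (x + inverse (real (Suc k)) *\<^sub>R z) * of_real (exp (- ((norm z)\<^sup>2 / 2)))) \<le> C * exp (- ((norm z)\<^sup>2 / 2))" for k
      using assms(2) by (intro AE_I2) (auto simp: norm_mult intro!: mult_right_mono)
  qed measurable
  also have "(LINT z::real^'n|lborel. f x * of_real (exp (- ((norm z)\<^sup>2 / 2)))) = f x * of_real (sqrt (2 * pi) ^ CARD('n))"
    using gauss_nd(2)[of 1 "0::real^'n"] by (simp add: integral_mult_right_zero)
  finally show ?thesis .
qed

text \<open>Insert a Gaussian factor \<open>exp (- \<epsilon>\<^sup>2\<bar>\<xi>\<bar>\<^sup>2/2)\<close> into the inversion integral. By duality the
  regularised integral is a mean of \<open>f\<close> around \<open>x\<close> with respect to a narrow Gaussian; let \<open>\<epsilon> \<rightarrow> 0\<close> on both sides.\<close>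

lemma inv_fourier_fourier:
  fixes f :: "real^'n::finite \<Rightarrow> complex"
  assumes f: "f \<in> schwartz_functions"
  shows "inv_fourier (fourier f) = f"
proof
  fix x
  define e where "e = (\<lambda>k. inverse (real (Suc k)))"
  have e: "e k > 0" for k by (simp add: e_def)
  have F: "fourier f \<in> schwartz_functions" by (rule fourier_schwartz[OF f])
  note [measurable] = schwartz_borel[OF f] schwartz_borel[OF F]
  define I where "I = (\<lambda>k. LINT \<xi>|lborel. cis (x \<bullet> \<xi>) * of_real (exp (- ((e k)\<^sup>2 * (norm \<xi>)\<^sup>2 / 2))) * fourier f \<xi>)"
  have I1: "I k = (LINT z|lborel. f (x + e k *\<^sub>R z) * of_real (exp (- ((norm z)\<^sup>2 / 2)))) * of_real (sqrt (2 * pi) ^ CARD('n))" for k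
  proof -
    have "I k = (LINT \<xi>|lborel. fourier f \<xi> * (cis (x \<bullet> \<xi>) * of_real (exp (- ((e k)\<^sup>2 * (norm \<xi>)\<^sup>2 / 2)))))"
      by (simp add: I_def mult_ac)
    also have "\<dots> = (LINT y|lborel. f y * fourier (\<lambda>\<xi>. cis (x \<bullet> \<xi>) * of_real (exp (- ((e k)\<^sup>2 * (norm \<xi>)\<^sup>2 / 2)))) y)"
      by (intro fourier_duality schwartz_integrable f gauss_nd e)
    also have "\<dots> = (LINT y|lborel. f y * of_real ((sqrt (2 * pi) / e k) ^ CARD('n) * exp (- ((norm (x - y))\<^sup>2 / (2 * (e k)\<^sup>2)))))"
    proof -
      have "fourier (\<lambda>\<xi>. cis (x \<bullet> \<xi>) * of_real (exp (- ((e k)\<^sup>2 * (norm \<xi>)\<^sup>2 / 2)))) y =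
        (LINT \<xi>|lborel. cis ((x - y) \<bullet> \<xi>) * of_real (exp (- ((e k)\<^sup>2 * (norm \<xi>)\<^sup>2 / 2))))" for y
        by (subst fourier_eq) (simp_all add: inner_diff_left inner_commute[of _ y] cis_mult mult.assoc[symmetric])
      then show ?thesis by (simp only: gauss_nd(2)[OF e])
    qed
    also have "\<dots> = of_real (\<bar>e k\<bar> ^ DIM(real^'n)) * (LINT z|lborel. f (x + e k *\<^sub>R z) *
       of_real ((sqrt (2 * pi) / e k) ^ CARD('n) * exp (- ((norm (x - (x + e k *\<^sub>R z)))\<^sup>2 / (2 * (e k)\<^sup>2)))))"
      by (rule integral_scale) (use e[of k] in auto)
    also have "\<dots> = of_real (e k ^ CARD('n)) * (LINT z|lborel. of_real ((sqrt (2 * pi) / e k) ^ CARD('n)) * (f (x + e k *\<^sub>R z) *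
       of_real (exp (- ((norm z)\<^sup>2 / 2)))))"
      using e[of k] by (simp add: power_mult_distrib mult_ac)
    also have "\<dots> = (LINT z|lborel. f (x + e k *\<^sub>R z) * of_real (exp (- ((norm z)\<^sup>2 / 2)))) * of_real (sqrt (2 * pi) ^ CARD('n))"
      using e[of k] by (subst integral_mult_right_zero) (simp add: power_divide field_simps)
    finally show ?thesis .
  qed
  have "\<exists>C. \<forall>x. (1 + norm x) ^ 0 * cmod (f x) \<le> C"
    using schwartz_rapid[OF f] unfolding rapid_def by (rule spec)
  then obtain C where C: "\<And>x. cmod (f x) \<le> C" by auto
  have lim1: "I \<longlonglongrightarrow> f x * of_real (sqrt (2 * pi) ^ CARD('n)) * of_real (sqrt (2 * pi) ^ CARD('n))"
    unfolding I1 e_def by (intro tendsto_mult tendsto_const approx_identity[where C = C] smooth_continuous schwartz_smooth f C)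
  have lim2: "I \<longlonglongrightarrow> (LINT \<xi>|lborel. cis (x \<bullet> \<xi>) * 1 * fourier f \<xi>)"
    unfolding I_def
  proof (rule integral_dominated_convergence)
    show "integrable lborel (\<lambda>\<xi>. cmod (fourier f \<xi>))" by (rule schwartz_integrable[OF F])
    have "(\<lambda>k. exp (- ((e k)\<^sup>2 * (norm \<xi>)\<^sup>2 / 2))) \<longlonglongrightarrow> exp (- (0\<^sup>2 * (norm \<xi>)\<^sup>2 / 2))" for \<xi> :: "real^'n"
      unfolding e_def by (intro tendsto_intros LIMSEQ_inverse_real_of_nat) simp
    then have "(\<lambda>k. exp (- ((e k)\<^sup>2 * (norm \<xi>)\<^sup>2 / 2))) \<longlonglongrightarrow> 1" for \<xi> :: "real^'n" by simp
    from tendsto_of_real[OF this, where 'a = complex]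
    show "AE \<xi> in lborel. (\<lambda>k. cis (x \<bullet> \<xi>) * of_real (exp (- ((e k)\<^sup>2 * (norm \<xi>)\<^sup>2 / 2))) * fourier f \<xi>) \<longlonglongrightarrow> cis (x \<bullet> \<xi>) * 1 * fourier f \<xi>"
      by (intro AE_I2 tendsto_intros) simp
    show "AE \<xi> in lborel. norm (cis (x \<bullet> \<xi>) * of_real (exp (- ((e k)\<^sup>2 * (norm \<xi>)\<^sup>2 / 2))) * fourier f \<xi>) \<le> cmod (fourier f \<xi>)" for k
      by (intro AE_I2) (auto simp: norm_mult intro!: mult_left_le_one_le)
  qed measurable
  have "(LINT \<xi>|lborel. cis (x \<bullet> \<xi>) * fourier f \<xi>) = f x * of_real ((2 * pi) ^ CARD('n))"
  proof -
    have "sqrt (2 * pi) ^ CARD('n) * sqrt (2 * pi) ^ CARD('n) = (2 * pi) ^ CARD('n)"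
      unfolding power_mult_distrib[symmetric] by simp
    then have "complex_of_real (sqrt (2 * pi) ^ CARD('n)) * of_real (sqrt (2 * pi) ^ CARD('n)) = of_real ((2 * pi) ^ CARD('n))"
      unfolding of_real_mult[symmetric] by (rule arg_cong)
    then show ?thesis using LIMSEQ_unique[OF lim2 lim1] unfolding mult.assoc mult_1 by simp
  qed
  then show "inv_fourier (fourier f) x = f x"
    unfolding inv_fourier_def by (subst lint_lebesgue) simp_all
qed

lemma fourier_inv_fourier:
  fixes f :: "real^'n::finite \<Rightarrow> complex"
  assumes f: "f \<in> schwartz_functions"
  shows "fourier (inv_fourier f) = f"
proof
  fix x
  have F: "fourier f \<in> schwartz_functions" by (rule fourier_schwartz[OF f])
  note [measurable] = schwartz_borel[OF f] schwartz_borel[OF F]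
  have "fourier (inv_fourier f) x = (LINT y|lborel. cis (- (y \<bullet> x)) * (fourier f (- y) / of_real ((2 * pi) ^ CARD('n))))"
    by (subst fourier_eq) (simp_all add: inv_fourier_eq)
  also have "\<dots> = (LINT y|lborel. cis (- ((- y) \<bullet> x)) * (fourier f (- (- y)) / of_real ((2 * pi) ^ CARD('n))))"
    by (rule integral_uminus(2)[symmetric]) measurable
  also have "\<dots> = inv_fourier (fourier f) x"
    unfolding inv_fourier_def by (subst lint_lebesgue) (simp_all add: inner_commute)
  finally show "fourier (inv_fourier f) x = f x" by (simp add: inv_fourier_fourier[OF f])
qed

text \<open>Write \<open>a\<close> as the Fourier transform of its inverse transform and exchange the integrals.\<close>

lemma inv_fourier_mult:
  fixes a f :: "real^'n::finite \<Rightarrow> complex"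
  assumes a: "a \<in> schwartz_functions" and f: "f \<in> schwartz_functions"
  shows "inv_fourier (\<lambda>x. a x * f x) \<xi> = (LINT \<eta>|lborel. inv_fourier a \<eta> * inv_fourier f (\<xi> - \<eta>))"
proof -
  let ?c = "complex_of_real ((2 * pi) ^ CARD('n))"
  have va: "inv_fourier a \<in> schwartz_functions" by (rule inv_fourier_schwartz[OF a])
  note [measurable] = schwartz_borel[OF a] schwartz_borel[OF f] schwartz_borel[OF va]
  have a': "a x = (LINT \<eta>|lborel. cis (- (\<eta> \<bullet> x)) * inv_fourier a \<eta>)" for x
    using fourier_inv_fourier[OF a] fourier_eq[OF schwartz_borel[OF va], of x] by simp
  have "inv_fourier (\<lambda>x. a x * f x) \<xi> = (LINT x|lborel. cis (\<xi> \<bullet> x) * (a x * f x)) / ?c"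
    unfolding inv_fourier_def by (subst lint_lebesgue) simp_all
  also have "(LINT x|lborel. cis (\<xi> \<bullet> x) * (a x * f x)) =
     (LINT x|lborel. (LINT \<eta>|lborel. cis (\<xi> \<bullet> snd (\<eta>, x) - fst (\<eta>, x) \<bullet> snd (\<eta>, x)) * (inv_fourier a \<eta> * f x)))"
    by (simp add: a' flip: integral_mult_right_zero integral_mult_left_zero)
       (simp add: mult_ac diff_conv_add_uminus cis_mult[symmetric] del: add_uminus_conv_diff)
  also have "\<dots> = (LINT \<eta>|lborel. (LINT x|lborel. cis (\<xi> \<bullet> snd (\<eta>, x) - fst (\<eta>, x) \<bullet> snd (\<eta>, x)) * (inv_fourier a \<eta> * f x)))"
    by (rule Fubini_kernel[OF schwartz_integrable(1)[OF va] schwartz_integrable(1)[OF f],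
        where k = "\<lambda>z. cis (\<xi> \<bullet> snd z - fst z \<bullet> snd z)"]) simp_all
  also have "\<dots> = (LINT \<eta>|lborel. inv_fourier a \<eta> * (LINT x|lborel. cis ((\<xi> - \<eta>) \<bullet> x) * f x))"
    by (simp add: inner_diff_left flip: integral_mult_right_zero) (simp add: mult_ac)
  also have "\<dots> / ?c = (LINT \<eta>|lborel. inv_fourier a \<eta> * inv_fourier f (\<xi> - \<eta>))"
  proof -
    have "inv_fourier f \<zeta> = (LINT x|lborel. cis (\<zeta> \<bullet> x) * f x) / ?c" for \<zeta>
      unfolding inv_fourier_def by (subst lint_lebesgue) simp_all
    then show ?thesis by (simp only: times_divide_eq_right integral_divide_zero)
  qed
  finally show ?thesis .
qed

lemma inv_fourier_translate:
  fixes f :: "real^'n::finite \<Rightarrow> complex"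
  assumes f: "f \<in> schwartz_functions"
  shows "inv_fourier (translate y f) \<xi> = cis (y \<bullet> \<xi>) * inv_fourier f \<xi>"
proof -
  note [measurable] = schwartz_borel[OF f]
  let ?c = "complex_of_real ((2 * pi) ^ CARD('n))"
  have v: "inv_fourier g \<zeta> = (LINT x|lborel. cis (\<zeta> \<bullet> x) * g x) / ?c"
    if [measurable]: "g \<in> borel_measurable borel" for g :: "real^'n \<Rightarrow> complex" and \<zeta>
    unfolding inv_fourier_def by (subst lint_lebesgue) simp_all
  have "(LINT x|lborel. cis (\<xi> \<bullet> x) * translate y f x) = (LINT x|lborel. cis (\<xi> \<bullet> (y + x)) * translate y f (y + x))"
    by (rule integral_translate(2)[symmetric]) (simp add: translate_def)
  also have "\<dots> = cis (y \<bullet> \<xi>) * (LINT x|lborel. cis (\<xi> \<bullet> x) * f x)"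
    by (simp add: translate_def inner_add_right cis_mult[symmetric] inner_commute flip: integral_mult_right_zero)
      (simp add: mult_ac)
  finally show ?thesis by (simp add: v translate_def)
qed

lemma inv_fourier_cnj:
  fixes f :: "real^'n::finite \<Rightarrow> complex"
  shows "inv_fourier (\<lambda>x. cnj (f x)) \<xi> = cnj (inv_fourier f (- \<xi>))"
proof -
  have "(LINT x|lebesgue. cis (\<xi> \<bullet> x) * cnj (f x)) = (LINT x|lebesgue. cnj (cis (- (\<xi> \<bullet> x)) * f x))"
    by (simp add: cis_cnj)
  also have "\<dots> = cnj (LINT x|lebesgue. cis (- (\<xi> \<bullet> x)) * f x)" by (rule Bochner_Integration.integral_cnj)
  finally show ?thesis by (simp add: inv_fourier_def)
qed

section \<open>Square-integrable functions\<close>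

lemma borel_measurable_cnj [measurable (raw)]:
  "f \<in> borel_measurable M \<Longrightarrow> (\<lambda>x. cnj (f x)) \<in> borel_measurable M"
  by (rule measurable_compose[OF _ borel_measurable_continuous_onI[OF continuous_on_cnj[OF continuous_on_id]]])

definition L2 :: "('a::euclidean_space \<Rightarrow> complex) \<Rightarrow> bool" where
  "L2 f \<longleftrightarrow> f \<in> borel_measurable borel \<and> integrable lborel (\<lambda>x. (cmod (f x))\<^sup>2)"

definition sqnorm :: "('a::euclidean_space \<Rightarrow> complex) \<Rightarrow> real" where
  "sqnorm f = (LINT x|lborel. (cmod (f x))\<^sup>2)"

lemma L2_borel: "L2 f \<Longrightarrow> f \<in> borel_measurable borel"
  by (simp add: L2_def)

lemma L2_integrable_sq: "L2 f \<Longrightarrow> integrable lborel (\<lambda>x. (cmod (f x))\<^sup>2)"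
  by (simp add: L2_def)

lemma sqnorm_nonneg: "sqnorm f \<ge> 0"
  unfolding sqnorm_def by (intro Bochner_Integration.integral_nonneg) auto

lemma L2_bound:
  assumes "f \<in> borel_measurable borel" "integrable lborel g" "\<And>x. (cmod (f x))\<^sup>2 \<le> g x"
  shows "L2 f"
  unfolding L2_def
proof
  note [measurable] = assms(1)
  show "integrable lborel (\<lambda>x. (cmod (f x))\<^sup>2)"
    by (rule Bochner_Integration.integrable_bound[OF assms(2)])
      (use assms(3) in \<open>auto intro!: AE_I2 intro: order_trans[OF _ abs_ge_self]\<close>)
qed (rule assms)

lemma prod_le_sum_squares: "(u::real) * v \<le> u\<^sup>2 + v\<^sup>2"
proof -
  have "2 * u * v \<le> u\<^sup>2 + v\<^sup>2" by (rule sum_squares_bound)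
  moreover have "u\<^sup>2 + v\<^sup>2 \<ge> 0" by simp
  ultimately show ?thesis by (cases "u * v \<ge> 0") linarith+
qed

lemma L2_mult_integrable:
  assumes "L2 f" "L2 g"
  shows "integrable lborel (\<lambda>x. f x * g x)"
proof (rule Bochner_Integration.integrable_bound)
  note [measurable] = L2_borel[OF assms(1)] L2_borel[OF assms(2)]
  show "integrable lborel (\<lambda>x. (cmod (f x))\<^sup>2 + (cmod (g x))\<^sup>2)"
    by (intro Bochner_Integration.integrable_add L2_integrable_sq assms)
  show "AE x in lborel. norm (f x * g x) \<le> norm ((cmod (f x))\<^sup>2 + (cmod (g x))\<^sup>2)"
    by (intro AE_I2) (simp add: norm_mult prod_le_sum_squares)
qed (use assms[THEN L2_borel] in \<open>simp add: borel_measurable_times\<close>)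

lemma cmod_add_sq: "(cmod (u + v))\<^sup>2 \<le> 2 * (cmod u)\<^sup>2 + 2 * (cmod v)\<^sup>2"
proof -
  have "(cmod (u + v))\<^sup>2 \<le> (cmod u + cmod v)\<^sup>2" by (intro power_mono norm_triangle_ineq) auto
  also have "\<dots> \<le> 2 * (cmod u)\<^sup>2 + 2 * (cmod v)\<^sup>2"
    using sum_squares_bound[of "cmod u" "cmod v"] unfolding power2_sum by linarith
  finally show ?thesis .
qed

lemma L2_add: "L2 f \<Longrightarrow> L2 g \<Longrightarrow> L2 (\<lambda>x. f x + g x)"
  by (rule L2_bound[where g = "\<lambda>x. 2 * (cmod (f x))\<^sup>2 + 2 * (cmod (g x))\<^sup>2"])
     (auto simp: L2_def cmod_add_sq)

lemma L2_cmult: "L2 f \<Longrightarrow> L2 (\<lambda>x. c * f x)"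
  by (auto simp: L2_def norm_mult power_mult_distrib)

lemma L2_diff: "L2 f \<Longrightarrow> L2 g \<Longrightarrow> L2 (\<lambda>x. f x - g x)"
  using L2_add[OF _ L2_cmult, of f g "-1"] by simp

lemma L2_cnj: "L2 f \<Longrightarrow> L2 (\<lambda>x. cnj (f x))"
  by (auto simp: L2_def)

lemma L2_uminus:
  fixes f :: "'a::euclidean_space \<Rightarrow> complex"
  assumes "L2 f"
  shows "L2 (\<lambda>x. f (- x))" "sqnorm (\<lambda>x. f (- x)) = sqnorm f"
proof -
  note [measurable] = L2_borel[OF assms]
  show "L2 (\<lambda>x. f (- x))" "sqnorm (\<lambda>x. f (- x)) = sqnorm f"
    using assms integral_uminus[of "\<lambda>x. (cmod (f x))\<^sup>2"] by (auto simp: L2_def sqnorm_def)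
qed

lemma schwartz_L2: "f \<in> schwartz_functions \<Longrightarrow> L2 f"
  using rapid_integrable(2)[OF schwartz_rapid schwartz_borel, of f 0]
  by (auto simp: L2_def schwartz_borel)

lemma L2_cong_AE:
  "L2 f \<Longrightarrow> g \<in> borel_measurable borel \<Longrightarrow> AE x in lborel. f x = g x \<Longrightarrow> L2 g \<and> sqnorm g = sqnorm f"
  unfolding L2_def sqnorm_def
proof (intro conjI)
  assume *: "f \<in> borel_measurable borel \<and> integrable lborel (\<lambda>x. (cmod (f x))\<^sup>2)" and [measurable]: "g \<in> borel_measurable borel"
    and ae: "AE x in lborel. f x = g x"
  have [measurable]: "f \<in> borel_measurable borel" using * by simp
  show "integrable lborel (\<lambda>x. (cmod (g x))\<^sup>2)"
    using * by (rule_tac integrable_cong_AE_imp[of _ "\<lambda>x. (cmod (f x))\<^sup>2"]) (use ae in auto)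
  show "(LINT x|lborel. (cmod (g x))\<^sup>2) = (LINT x|lborel. (cmod (f x))\<^sup>2)"
    by (rule integral_cong_AE) (use ae in auto)
qed

text \<open>The positive and the negative part are densities of two measures that agree on open boxes, hence
  agree everywhere.\<close>

lemma zero_on_boxes_AE_zero:
  fixes h :: "'a::euclidean_space \<Rightarrow> real"
  assumes [measurable]: "h \<in> borel_measurable borel"
    and int: "\<And>a b. integrable lborel (\<lambda>x. indicator (box a b) x * h x)"
    and zero: "\<And>a b. (LINT x|lborel. indicator (box a b) x * h x) = 0"
  shows "AE x in lborel. h x = 0"
proof -
  define P where "P = (\<lambda>x. ennreal (max 0 (h x)))"
  define N where "N = (\<lambda>x. ennreal (max 0 (- h x)))"
  have [measurable]: "P \<in> borel_measurable borel" "N \<in> borel_measurable borel"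
    by (auto simp: P_def N_def)
  have iP: "integrable lborel (\<lambda>x. indicator (box a b) x * max 0 (h x))" for a b
    by (rule Bochner_Integration.integrable_bound[OF int[of a b]]) (auto simp: indicator_def)
  have iN: "integrable lborel (\<lambda>x. indicator (box a b) x * max 0 (- h x))" for a b
    by (rule Bochner_Integration.integrable_bound[OF int[of a b]]) (auto simp: indicator_def)
  have eP: "emeasure (density lborel P) (box a b) = ennreal (LINT x|lborel. indicator (box a b) x * max 0 (h x))" for a b
    by (subst emeasure_density, measurable, subst nn_integral_eq_integral[symmetric, OF iP])
      (auto simp: P_def indicator_def intro!: nn_integral_cong)
  have eN: "emeasure (density lborel N) (box a b) = ennreal (LINT x|lborel. indicator (box a b) x * max 0 (- h x))" for a b
    by (subst emeasure_density, measurable, subst nn_integral_eq_integral[symmetric, OF iN])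
      (auto simp: N_def indicator_def intro!: nn_integral_cong)
  have eq: "(LINT x|lborel. indicator (box a b) x * max 0 (h x)) = (LINT x|lborel. indicator (box a b) x * max 0 (- h x))" for a b
  proof -
    have "(LINT x|lborel. indicator (box a b) x * max 0 (h x) - indicator (box a b) x * max 0 (- h x)) =
        (LINT x|lborel. indicator (box a b) x * h x)"
      by (intro Bochner_Integration.integral_cong) (auto simp: indicator_def max_def)
    then show ?thesis using Bochner_Integration.integral_diff[OF iP[of a b] iN[of a b]] zero[of a b] by simp
  qed
  have "density lborel P = density lborel N"
  proof (rule measure_eqI_generator_eq)
    let ?E = "range (\<lambda>(a, b). box a b::'a set)"
    show "Int_stable ?E" by (auto simp: Int_stable_def box_Int_box)
    show "?E \<subseteq> Pow UNIV" "sets (density lborel P) = sigma_sets UNIV ?E" "sets (density lborel N) = sigma_sets UNIV ?E"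
      by (simp_all add: borel_eq_box)
    let ?A = "\<lambda>n::nat. box (- (real n *\<^sub>R One)) (real n *\<^sub>R One) :: 'a set"
    show "range ?A \<subseteq> ?E" "(\<Union>i. ?A i) = UNIV" unfolding UN_box_eq_UNIV by auto
    show "emeasure (density lborel P) (?A i) \<noteq> \<infinity>" for i unfolding eP by simp
    show "emeasure (density lborel P) X = emeasure (density lborel N) X" if "X \<in> ?E" for X
      using that by (auto simp: eP eN eq)
  qed
  then have "AE x in lborel. P x = N x"
    by (subst (asm) sigma_finite_measure.density_unique_iff[OF sigma_finite_lborel]) auto
  then show ?thesis
    by eventually_elim (auto simp: P_def N_def max_def split: if_splits)
qed

text \<open>With \<open>g\<close> smooth and positive exactly on the box, \<open>g / (g + 1/k)\<close> increases to the indicator of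
  the box.\<close>

lemma box_test_function:
  fixes a b :: "real^'n::finite"
  shows "\<exists>\<psi>. (\<forall>k::nat. \<psi> k \<in> test_functions) \<and> (\<forall>k x. cmod (\<psi> k x) \<le> indicator (box a b) x) \<and>
     (\<forall>x. (\<lambda>k. \<psi> k x) \<longlonglongrightarrow> indicator (box a b) x)"
proof -
  define g where "g = (\<lambda>x::real^'n. \<Prod>i\<in>UNIV. flat_exp 0 (x $ i - a $ i) * flat_exp 0 (b $ i - x $ i))"
  have g0: "g x \<ge> 0" for x unfolding g_def by (intro prod_nonneg) (auto simp: flat_exp_nonneg)
  have gbox: "g x > 0 \<longleftrightarrow> x \<in> box a b" for x
  proof -
    have "g x \<noteq> 0 \<longleftrightarrow> x \<in> box a b"
      by (auto simp: g_def flat_exp_eq_0_iff mem_box_cart not_le)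
    then show ?thesis using g0[of x] by linarith
  qed
  define G where "G = (\<lambda>x. complex_of_real (g x))"
  have "smooth (\<lambda>x::real^'n. \<Prod>i\<in>UNIV. complex_of_real (flat_exp 0 (Re (of_real (x $ i) + of_real (- a $ i)))) *
      complex_of_real (flat_exp 0 (Re (of_real (b $ i) + of_real (- 1) * of_real (x $ i)))))"
    by (intro smooth_prod smooth_mult smooth_flat_exp smooth_add smooth_coord smooth_const)
  then have sG: "smooth G" by (simp add: G_def g_def of_real_prod)
  define \<psi> where "\<psi> = (\<lambda>(k::nat) x. G x * inverse (G x + of_real (inverse (real (Suc k)))))"
  have pos: "g x + inverse (real (Suc k)) > 0" for x k
    using g0[of x] by (intro add_nonneg_pos) auto
  have nz: "G x + of_real (inverse (real (Suc k))) \<noteq> 0" for x k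
    unfolding G_def of_real_add[symmetric] of_real_eq_0_iff using pos[of x k] by linarith
  have \<psi>: "\<psi> k x = of_real (g x / (g x + inverse (real (Suc k))))" for k x
    by (simp add: \<psi>_def G_def divide_inverse)
  have "smooth (\<psi> k)" for k unfolding \<psi>_def
    by (intro smooth_mult smooth_inverse smooth_add sG smooth_const nz)
  moreover have "\<exists>R. \<forall>x. norm x > R \<longrightarrow> \<psi> k x = 0" for k
  proof -
    obtain R where R: "\<And>x. x \<in> box a b \<Longrightarrow> norm x \<le> R"
      using bounded_box[of a b] unfolding bounded_iff by blast
    have "g x = 0" if "norm x > R" for x
      using R[of x] that gbox[of x] g0[of x] by force
    then show ?thesis by (auto simp: \<psi>)
  qed
  ultimately have 1: "\<psi> k \<in> test_functions" for k by (simp add: test_functions_iff)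
  have 2: "cmod (\<psi> k x) \<le> indicator (box a b) x" for k x
  proof (cases "x \<in> box a b")
    case True
    have "g x / (g x + inverse (real (Suc k))) \<le> 1" "0 \<le> g x / (g x + inverse (real (Suc k)))"
      using pos[of x k] g0[of x] by (auto simp: divide_le_eq_1)
    then show ?thesis using True unfolding \<psi> norm_of_real by (simp only: abs_of_nonneg indicator_simps)
  next
    case False
    then have "g x = 0" using gbox[of x] g0[of x] by linarith
    then show ?thesis by (simp add: \<psi>)
  qed
  have 3: "(\<lambda>k. \<psi> k x) \<longlonglongrightarrow> indicator (box a b) x" for x
  proof (cases "x \<in> box a b")
    case True
    then have p: "g x > 0" using gbox by simp
    have "(\<lambda>k. g x / (g x + inverse (real (Suc k)))) \<longlonglongrightarrow> g x / (g x + 0)"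
      using p by (intro tendsto_intros LIMSEQ_inverse_real_of_nat) auto
    then have "(\<lambda>k. complex_of_real (g x / (g x + inverse (real (Suc k))))) \<longlonglongrightarrow> of_real (g x / (g x + 0))"
      by (rule tendsto_of_real)
    then show ?thesis using p True by (simp add: \<psi>)
  next
    case False
    then have "g x = 0" using gbox[of x] g0[of x] by linarith
    then show ?thesis using False by (simp add: \<psi>)
  qed
  show ?thesis using 1 2 3 by blast
qed

lemma indicator_box_L2: "L2 (\<lambda>x. indicator (box a b) x)"
proof -
  have "integrable lborel (indicator (box a b) :: 'a \<Rightarrow> real)" by (rule integrable_real_indicator) (use emeasure_bounded_finite[OF bounded_box, of a b] in auto)
  then show ?thesis by (intro L2_bound[where g = "indicator (box a b)"]) (auto simp: indicator_def)
qed

lemma L2_zero_AE: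
  fixes f :: "real^'n::finite \<Rightarrow> complex"
  assumes f: "L2 f" and z: "\<And>\<phi>. \<phi> \<in> test_functions \<Longrightarrow> (LINT x|lborel. f x * \<phi> x) = 0"
  shows "AE x in lborel. f x = 0"
proof -
  note [measurable] = L2_borel[OF f]
  have int: "integrable lborel (\<lambda>x. indicator (box a b) x * f x)" for a b
    by (rule L2_mult_integrable[OF indicator_box_L2 f])
  have zero: "(LINT x|lborel. indicator (box a b) x * f x) = 0" for a b
  proof -
    obtain \<psi> where \<psi>: "\<And>k::nat. \<psi> k \<in> test_functions" "\<And>k x. cmod (\<psi> k x) \<le> indicator (box a b) x"
       "\<And>x. (\<lambda>k. \<psi> k x) \<longlonglongrightarrow> indicator (box a b) x"
      using box_test_function[of a b] by blast
    note [measurable] = smooth_borel[OF test_smooth[OF \<psi>(1)]]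
    have "(\<lambda>k. LINT x|lborel. \<psi> k x * f x) \<longlonglongrightarrow> (LINT x|lborel. indicator (box a b) x * f x)"
    proof (rule integral_dominated_convergence)
      show "integrable lborel (\<lambda>x. cmod (indicator (box a b) x * f x))"
        by (intro integrable_norm int)
      show "AE x in lborel. (\<lambda>k. \<psi> k x * f x) \<longlonglongrightarrow> indicator (box a b) x * f x"
        by (intro AE_I2 tendsto_mult tendsto_const \<psi>)
      show "AE x in lborel. norm (\<psi> k x * f x) \<le> cmod (indicator (box a b) x * f x)" for k
      proof (intro AE_I2)
        fix x
        show "norm (\<psi> k x * f x) \<le> cmod (indicator (box a b) x * f x)"
          using mult_right_mono[OF \<psi>(2)[of k x], of "cmod (f x)"]
          by (cases "x \<in> box a b") (simp_all add: norm_mult)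
      qed
    qed measurable
    then have "(\<lambda>k. 0) \<longlonglongrightarrow> (LINT x|lborel. indicator (box a b) x * f x)"
      using z[OF \<psi>(1)] by (simp add: mult.commute)
    then show ?thesis by (metis LIMSEQ_unique tendsto_const)
  qed
  have "AE x in lborel. Re (f x) = 0"
  proof (rule zero_on_boxes_AE_zero)
    fix a b
    have e: "(\<lambda>x. indicator (box a b) x * Re (f x)) = (\<lambda>x. Re (indicator (box a b) x * f x))"
      by (auto simp: indicator_def)
    show "integrable lborel (\<lambda>x. indicator (box a b) x * Re (f x))"
      unfolding e by (intro integrable_Re int)
    show "(LINT x|lborel. indicator (box a b) x * Re (f x)) = 0"
      unfolding e by (subst integral_Re[OF int]) (simp add: zero)
  qed measurable
  moreover have "AE x in lborel. Im (f x) = 0"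
  proof (rule zero_on_boxes_AE_zero)
    fix a b
    have e: "(\<lambda>x. indicator (box a b) x * Im (f x)) = (\<lambda>x. Im (indicator (box a b) x * f x))"
      by (auto simp: indicator_def)
    show "integrable lborel (\<lambda>x. indicator (box a b) x * Im (f x))"
      unfolding e by (intro integrable_Im int)
    show "(LINT x|lborel. indicator (box a b) x * Im (f x)) = 0"
      unfolding e by (subst integral_Im[OF int]) (simp add: zero)
  qed measurable
  ultimately show ?thesis by eventually_elim (simp add: complex_eq_iff)
qed

lemma L2_eq_AE:
  fixes f g :: "real^'n::finite \<Rightarrow> complex"
  assumes f: "L2 f" and g: "L2 g"
    and eq: "\<And>\<phi>. \<phi> \<in> schwartz_functions \<Longrightarrow> (LINT x|lborel. f x * \<phi> x) = (LINT x|lborel. g x * \<phi> x)"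
  shows "AE x in lborel. f x = g x"
proof -
  have "AE x in lborel. f x - g x = 0"
  proof (rule L2_zero_AE[OF L2_diff[OF f g]])
    fix \<phi> :: "real^'n \<Rightarrow> complex" assume "\<phi> \<in> test_functions"
    then have \<phi>: "\<phi> \<in> schwartz_functions" by (rule test_schwartz)
    show "(LINT x|lborel. (f x - g x) * \<phi> x) = 0"
      using L2_mult_integrable[OF f schwartz_L2[OF \<phi>]] L2_mult_integrable[OF g schwartz_L2[OF \<phi>]] eq[OF \<phi>]
      by (simp add: left_diff_distrib)
  qed
  then show ?thesis by eventually_elim simp
qed

section \<open>The theorem of Plancherel\<close>

lemma sqnorm_ennreal: "L2 f \<Longrightarrow> ennreal (sqnorm f) = (\<integral>\<^sup>+x. ennreal ((cmod (f x))\<^sup>2) \<partial>lborel)"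
  unfolding sqnorm_def by (subst nn_integral_eq_integral[OF L2_integrable_sq]) auto

lemma L2_of_nn_integral:
  assumes [measurable]: "f \<in> borel_measurable borel" and "(\<integral>\<^sup>+x. ennreal ((cmod (f x))\<^sup>2) \<partial>lborel) \<le> ennreal C" "C \<ge> 0"
  shows "L2 f \<and> sqnorm f \<le> C"
proof -
  have "L2 f" unfolding L2_def
    using assms(2) by (auto intro!: integrableI_nonneg intro: le_less_trans)
  moreover from this have "ennreal (sqnorm f) \<le> ennreal C" using assms(2) sqnorm_ennreal[of f] by simp
  ultimately show ?thesis using assms(3) by (simp add: ennreal_le_iff)
qed

text \<open>Half of Plancherel's theorem, for integrable \<open>h\<close>. The integral of \<open>\<bar>\<F>h\<bar>\<^sup>2\<close> against a wide
  Gaussian equals \<open>\<integral>\<integral> h(x) \<cdot> cnj (h(y)) K(y - x) dx dy\<close> with a positive kernel \<open>K\<close> of total mass \<open>(2\<pi>)\<^sup>n\<close>, and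
  \<open>\<bar>h(x) h(y)\<bar> \<le> (\<bar>h(x)\<bar>\<^sup>2 + \<bar>h(y)\<bar>\<^sup>2)/2\<close>. Equality will follow from inversion.\<close>

lemma fourier_sqnorm_le:
  fixes h :: "real^'n::finite \<Rightarrow> complex"
  assumes h1: "integrable lborel h" and h2: "L2 h"
  shows "L2 (fourier h) \<and> sqnorm (fourier h) \<le> (2 * pi) ^ CARD('n) * sqnorm h"
proof -
  note [measurable] = L2_borel[OF h2]
  define e where "e = (\<lambda>k. inverse (real (Suc k)))"
  have e: "e k > 0" for k by (simp add: e_def)
  define E where "E = (\<lambda>k (\<xi>::real^'n). exp (- ((e k)\<^sup>2 * (norm \<xi>)\<^sup>2 / 2)))"
  have [measurable]: "E k \<in> borel_measurable borel" for k by (auto simp: E_def)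
  have E0: "E k \<xi> > 0" "E k \<xi> \<le> 1" for k \<xi> by (auto simp: E_def)
  have Ei: "integrable lborel (E k)" for k unfolding E_def by (rule gauss_real_integrable[OF e])
  define K where "K = (\<lambda>k (z::real^'n). (sqrt (2 * pi) / e k) ^ CARD('n) * exp (- ((norm z)\<^sup>2 / (2 * (e k)\<^sup>2))))"
  have [measurable]: "K k \<in> borel_measurable borel" for k by (auto simp: K_def)
  have K0: "K k z \<ge> 0" for k z using e[of k] by (auto simp: K_def)
  have Kint: "(\<integral>\<^sup>+z. ennreal (K k z) \<partial>lborel) = ennreal ((2 * pi) ^ CARD('n))" for k
  proof -
    have i: "integrable lborel (\<lambda>z::real^'n. exp (- ((inverse (e k))\<^sup>2 * (norm z)\<^sup>2 / 2)))"
      by (rule gauss_real_integrable) (use e[of k] in auto)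
    have ex: "- ((inverse (e k))\<^sup>2 * u / 2) = - (u / (2 * (e k)\<^sup>2))" for u
      by (simp add: inverse_eq_divide power_divide)
    have "complex_of_real (LINT z::real^'n|lborel. exp (- ((inverse (e k))\<^sup>2 * (norm z)\<^sup>2 / 2))) =
        of_real ((sqrt (2 * pi) / inverse (e k)) ^ CARD('n))"
      using gauss_nd(2)[of "inverse (e k)" "0::real^'n"] e[of k] by simp
    then have v: "(LINT z::real^'n|lborel. exp (- ((inverse (e k))\<^sup>2 * (norm z)\<^sup>2 / 2))) = (sqrt (2 * pi) * e k) ^ CARD('n)"
      unfolding of_real_eq_iff by (simp add: field_simps)
    have Ki: "integrable lborel (K k)"
      unfolding K_def using i unfolding ex by (rule integrable_mult_right)
    have "(LINT z|lborel. K k z) = (sqrt (2 * pi) / e k) ^ CARD('n) * (sqrt (2 * pi) * e k) ^ CARD('n)"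
      using v unfolding K_def ex by (simp only: integral_mult_right_zero)
    also have "\<dots> = (2 * pi) ^ CARD('n)"
      unfolding power_mult_distrib[symmetric] using e[of k] by simp
    finally show ?thesis using nn_integral_eq_integral[OF Ki] K0 by simp
  qed
  have bd: "cmod (fourier h \<xi>) \<le> (LINT x|lborel. cmod (h x))" for \<xi> by (rule fourier_bound[OF h1])
  define B where "B = (LINT x|lborel. cmod (h x))"
  have B: "B \<ge> 0" unfolding B_def by (intro Bochner_Integration.integral_nonneg) auto
  define G where "G = (\<lambda>k \<xi>. cnj (fourier h \<xi>) * of_real (E k \<xi>))"
  have [measurable]: "G k \<in> borel_measurable borel" for k by (auto simp: G_def)
  have Gi: "integrable lborel (G k)" for k
    by (rule Bochner_Integration.integrable_bound[OF integrable_mult_right[OF Ei, of B k]])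
      (use bd E0 B in \<open>auto simp: G_def norm_mult B_def less_imp_le abs_mult intro!: mult_mono\<close>)
  have V: "fourier (G k) x = (LINT y|lborel. cnj (h y) * of_real (K k (y - x)))" for k x
  proof -
    have c: "cnj (fourier h \<xi>) = (LINT y|lborel. cis (y \<bullet> \<xi>) * cnj (h y))" for \<xi>
    proof -
      have "cnj (fourier h \<xi>) = (LINT y|lborel. cnj (cis (- (y \<bullet> \<xi>)) * h y))"
        by (subst fourier_eq[OF L2_borel[OF h2]], rule Bochner_Integration.integral_cnj[symmetric])
      then show ?thesis by (simp add: cis_cnj)
    qed
    have "fourier (G k) x = (LINT \<xi>|lborel. (LINT y|lborel. cis ((snd (\<xi>, y) - x) \<bullet> fst (\<xi>, y)) * (of_real (E k \<xi>) * cnj (h y))))"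
    proof -
      have "cis (- (\<xi> \<bullet> x)) * G k \<xi> = (LINT y|lborel. cis ((y - x) \<bullet> \<xi>) * (of_real (E k \<xi>) * cnj (h y)))" for \<xi>
      proof -
        have "cis ((y - x) \<bullet> \<xi>) = cis (- (\<xi> \<bullet> x)) * cis (y \<bullet> \<xi>)" for y
          by (simp add: inner_diff_left inner_commute[of \<xi> x] cis_mult)
        then have "(\<lambda>y. cis ((y - x) \<bullet> \<xi>) * (of_real (E k \<xi>) * cnj (h y))) =
            (\<lambda>y. (cis (- (\<xi> \<bullet> x)) * of_real (E k \<xi>)) * (cis (y \<bullet> \<xi>) * cnj (h y)))"
          by (simp add: mult_ac)
        then have "(LINT y|lborel. cis ((y - x) \<bullet> \<xi>) * (of_real (E k \<xi>) * cnj (h y))) =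
            (cis (- (\<xi> \<bullet> x)) * of_real (E k \<xi>)) * (LINT y|lborel. cis (y \<bullet> \<xi>) * cnj (h y))"
          by (simp only: integral_mult_right_zero)
        then show ?thesis by (simp only: G_def c mult_ac)
      qed
      then show ?thesis by (subst fourier_eq) simp_all
    qed
    also have "\<dots> = (LINT y|lborel. (LINT \<xi>|lborel. cis ((snd (\<xi>, y) - x) \<bullet> fst (\<xi>, y)) * (of_real (E k \<xi>) * cnj (h y))))"
      by (rule Fubini_kernel[symmetric, where k = "\<lambda>z. cis ((snd z - x) \<bullet> fst z)"])
        (use Ei h1 in auto)
    also have "\<dots> = (LINT y|lborel. cnj (h y) * (LINT \<xi>|lborel. cis ((y - x) \<bullet> \<xi>) * of_real (E k \<xi>)))"
    proof -
      have "(\<lambda>\<xi>. cis ((snd (\<xi>, y) - x) \<bullet> fst (\<xi>, y)) * (of_real (E k \<xi>) * cnj (h y))) =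
          (\<lambda>\<xi>. cnj (h y) * (cis ((y - x) \<bullet> \<xi>) * of_real (E k \<xi>)))" for y
        by (simp add: mult_ac)
      then show ?thesis by (simp only: integral_mult_right_zero)
    qed
    also have "\<dots> = (LINT y|lborel. cnj (h y) * of_real (K k (y - x)))"
      unfolding E_def K_def gauss_nd(2)[OF e] ..
    finally show ?thesis .
  qed
  have main: "(\<integral>\<^sup>+\<xi>. ennreal ((cmod (fourier h \<xi>))\<^sup>2 * E k \<xi>) \<partial>lborel) \<le> ennreal ((2 * pi) ^ CARD('n) * sqnorm h)" for k
  proof -
    have i1: "integrable lborel (\<lambda>\<xi>. (cmod (fourier h \<xi>))\<^sup>2 * E k \<xi>)"
    proof (rule Bochner_Integration.integrable_bound[OF integrable_mult_right[OF Ei, of "B\<^sup>2" k]])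
      show "AE \<xi> in lborel. norm ((cmod (fourier h \<xi>))\<^sup>2 * E k \<xi>) \<le> norm (B\<^sup>2 * E k \<xi>)"
        using bd E0 by (intro AE_I2) (auto simp: abs_mult B_def[symmetric] intro!: mult_right_mono power_mono)
    qed measurable
    have "complex_of_real (LINT \<xi>|lborel. (cmod (fourier h \<xi>))\<^sup>2 * E k \<xi>) = (LINT \<xi>|lborel. fourier h \<xi> * G k \<xi>)"
      unfolding integral_complex_of_real[symmetric]
      by (intro Bochner_Integration.integral_cong) (auto simp: G_def complex_norm_square[symmetric] mult.assoc[symmetric])
    also have "\<dots> = (LINT x|lborel. h x * fourier (G k) x)"
      by (rule fourier_duality[OF h1 Gi])
    finally have "(LINT \<xi>|lborel. (cmod (fourier h \<xi>))\<^sup>2 * E k \<xi>) \<le> cmod (LINT x|lborel. h x * fourier (G k) x)"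
      by (metis Re_complex_of_real complex_Re_le_cmod)
    then have "ennreal (LINT \<xi>|lborel. (cmod (fourier h \<xi>))\<^sup>2 * E k \<xi>) \<le> ennreal (cmod (LINT x|lborel. h x * fourier (G k) x))"
      by (rule ennreal_leI)
    also have "\<dots> \<le> (\<integral>\<^sup>+x. ennreal (cmod (h x * fourier (G k) x)) \<partial>lborel)"
    proof (cases "integrable lborel (\<lambda>x. h x * fourier (G k) x)")
      case True
      then show ?thesis by (rule integral_norm_bound_ennreal)
    qed (simp add: not_integrable_integral_eq)
    also have "\<dots> \<le> (\<integral>\<^sup>+x. (\<integral>\<^sup>+y. ennreal (cmod (h x)) * (ennreal (cmod (h y)) * ennreal (K k (y - x))) \<partial>lborel) \<partial>lborel)"
    proof (rule nn_integral_mono)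
      fix x
      have "ennreal (cmod (fourier (G k) x)) \<le> (\<integral>\<^sup>+y. ennreal (cmod (cnj (h y) * of_real (K k (y - x)))) \<partial>lborel)"
      proof (cases "integrable lborel (\<lambda>y. cnj (h y) * of_real (K k (y - x)))")
        case True
        then show ?thesis unfolding V by (rule integral_norm_bound_ennreal)
      qed (simp add: V not_integrable_integral_eq)
      also have "\<dots> = (\<integral>\<^sup>+y. ennreal (cmod (h y)) * ennreal (K k (y - x)) \<partial>lborel)"
        using K0 by (simp add: norm_mult ennreal_mult)
      finally have "ennreal (cmod (h x)) * ennreal (cmod (fourier (G k) x)) \<le> ennreal (cmod (h x)) * (\<integral>\<^sup>+y. ennreal (cmod (h y)) * ennreal (K k (y - x)) \<partial>lborel)"
        by (intro mult_left_mono) auto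
      then show "ennreal (cmod (h x * fourier (G k) x)) \<le> (\<integral>\<^sup>+y. ennreal (cmod (h x)) * (ennreal (cmod (h y)) * ennreal (K k (y - x))) \<partial>lborel)"
        by (simp add: norm_mult ennreal_mult nn_integral_cmult)
    qed
    also have "\<dots> \<le> (\<integral>\<^sup>+x. (\<integral>\<^sup>+y. ennreal ((cmod (h x))\<^sup>2 / 2) * ennreal (K k (y - x)) + ennreal ((cmod (h y))\<^sup>2 / 2) * ennreal (K k (y - x)) \<partial>lborel) \<partial>lborel)"
    proof (intro nn_integral_mono)
      fix x y
      have "cmod (h x) * cmod (h y) \<le> (cmod (h x))\<^sup>2 / 2 + (cmod (h y))\<^sup>2 / 2"
        using sum_squares_bound[of "cmod (h x)" "cmod (h y)"] by simp
      then have "ennreal (cmod (h x)) * ennreal (cmod (h y)) \<le> ennreal ((cmod (h x))\<^sup>2 / 2) + ennreal ((cmod (h y))\<^sup>2 / 2)"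
        by (simp add: ennreal_mult[symmetric] ennreal_plus[symmetric] ennreal_leI del: ennreal_plus)
      then have "ennreal (cmod (h x)) * ennreal (cmod (h y)) * ennreal (K k (y - x)) \<le> (ennreal ((cmod (h x))\<^sup>2 / 2) + ennreal ((cmod (h y))\<^sup>2 / 2)) * ennreal (K k (y - x))"
        by (rule mult_right_mono) auto
      then show "ennreal (cmod (h x)) * (ennreal (cmod (h y)) * ennreal (K k (y - x))) \<le> ennreal ((cmod (h x))\<^sup>2 / 2) * ennreal (K k (y - x)) + ennreal ((cmod (h y))\<^sup>2 / 2) * ennreal (K k (y - x))"
        by (simp only: mult.assoc distrib_right)
    qed
    also have "\<dots> = (\<integral>\<^sup>+x. (\<integral>\<^sup>+y. ennreal ((cmod (h x))\<^sup>2 / 2) * ennreal (K k (y - x)) \<partial>lborel) \<partial>lborel) +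
        (\<integral>\<^sup>+x. (\<integral>\<^sup>+y. ennreal ((cmod (h y))\<^sup>2 / 2) * ennreal (K k (y - x)) \<partial>lborel) \<partial>lborel)"
      by (simp add: nn_integral_add)
    also have "(\<integral>\<^sup>+x. (\<integral>\<^sup>+y. ennreal ((cmod (h y))\<^sup>2 / 2) * ennreal (K k (y - x)) \<partial>lborel) \<partial>lborel) =
       (\<integral>\<^sup>+y. (\<integral>\<^sup>+x. ennreal ((cmod (h y))\<^sup>2 / 2) * ennreal (K k (y - x)) \<partial>lborel) \<partial>lborel)"
      by (rule lborel_pair.Fubini') measurable
    also have "(\<integral>\<^sup>+y. (\<integral>\<^sup>+x. ennreal ((cmod (h y))\<^sup>2 / 2) * ennreal (K k (y - x)) \<partial>lborel) \<partial>lborel) =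
       (\<integral>\<^sup>+y. ennreal ((cmod (h y))\<^sup>2 / 2) * ennreal ((2 * pi) ^ CARD('n)) \<partial>lborel)"
    proof (intro nn_integral_cong)
      fix y
      have "(\<integral>\<^sup>+x. ennreal (K k (y - x)) \<partial>lborel) = ennreal ((2 * pi) ^ CARD('n))"
        using nn_integral_reflect[of "\<lambda>z. ennreal (K k z)" y] Kint by simp
      then show "(\<integral>\<^sup>+x. ennreal ((cmod (h y))\<^sup>2 / 2) * ennreal (K k (y - x)) \<partial>lborel) = ennreal ((cmod (h y))\<^sup>2 / 2) * ennreal ((2 * pi) ^ CARD('n))"
        by (simp add: nn_integral_cmult)
    qed
    also have "(\<integral>\<^sup>+x. (\<integral>\<^sup>+y. ennreal ((cmod (h x))\<^sup>2 / 2) * ennreal (K k (y - x)) \<partial>lborel) \<partial>lborel) =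
       (\<integral>\<^sup>+x. ennreal ((cmod (h x))\<^sup>2 / 2) * ennreal ((2 * pi) ^ CARD('n)) \<partial>lborel)"
    proof (intro nn_integral_cong)
      fix x
      have "(\<integral>\<^sup>+y. ennreal (K k (y - x)) \<partial>lborel) = ennreal ((2 * pi) ^ CARD('n))"
        using nn_integral_translate[of "\<lambda>z. ennreal (K k z)" "- x"] Kint by simp
      then show "(\<integral>\<^sup>+y. ennreal ((cmod (h x))\<^sup>2 / 2) * ennreal (K k (y - x)) \<partial>lborel) = ennreal ((cmod (h x))\<^sup>2 / 2) * ennreal ((2 * pi) ^ CARD('n))"
        by (simp add: nn_integral_cmult)
    qed
    also have "(\<integral>\<^sup>+x. ennreal ((cmod (h x))\<^sup>2 / 2) * ennreal ((2 * pi) ^ CARD('n)) \<partial>lborel) +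
        (\<integral>\<^sup>+x. ennreal ((cmod (h x))\<^sup>2 / 2) * ennreal ((2 * pi) ^ CARD('n)) \<partial>lborel) =
        (\<integral>\<^sup>+x. ennreal ((cmod (h x))\<^sup>2) * ennreal ((2 * pi) ^ CARD('n)) \<partial>lborel)"
      by (subst nn_integral_add[symmetric], measurable)
        (auto intro!: nn_integral_cong simp: distrib_right[symmetric] ennreal_plus[symmetric] simp del: ennreal_plus)
    also have "\<dots> = ennreal ((2 * pi) ^ CARD('n) * sqnorm h)"
      by (simp add: nn_integral_multc sqnorm_ennreal[OF h2, symmetric] ennreal_mult sqnorm_nonneg mult.commute)
    finally show ?thesis
      by (subst nn_integral_eq_integral[OF i1]) (auto simp: E0 less_imp_le)
  qed
  have "(\<integral>\<^sup>+\<xi>. ennreal ((cmod (fourier h \<xi>))\<^sup>2) \<partial>lborel) = (\<integral>\<^sup>+\<xi>. liminf (\<lambda>k. ennreal ((cmod (fourier h \<xi>))\<^sup>2 * E k \<xi>)) \<partial>lborel)"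
  proof (intro nn_integral_cong)
    fix \<xi> :: "real^'n"
    have "(\<lambda>k. exp (- ((e k)\<^sup>2 * (norm \<xi>)\<^sup>2 / 2))) \<longlonglongrightarrow> exp (- (0\<^sup>2 * (norm \<xi>)\<^sup>2 / 2))"
      unfolding e_def by (intro tendsto_intros LIMSEQ_inverse_real_of_nat) simp
    then have "(\<lambda>k. E k \<xi>) \<longlonglongrightarrow> 1" by (simp add: E_def)
    then have "(\<lambda>k. ennreal ((cmod (fourier h \<xi>))\<^sup>2 * E k \<xi>)) \<longlonglongrightarrow> ennreal ((cmod (fourier h \<xi>))\<^sup>2 * 1)"
      by (intro tendsto_ennrealI tendsto_mult tendsto_const)
    then show "ennreal ((cmod (fourier h \<xi>))\<^sup>2) = liminf (\<lambda>k. ennreal ((cmod (fourier h \<xi>))\<^sup>2 * E k \<xi>))"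
      by (simp add: lim_imp_Liminf)
  qed
  also have "\<dots> \<le> liminf (\<lambda>k. \<integral>\<^sup>+\<xi>. ennreal ((cmod (fourier h \<xi>))\<^sup>2 * E k \<xi>) \<partial>lborel)"
    by (rule nn_integral_liminf) measurable
  also have "\<dots> \<le> ennreal ((2 * pi) ^ CARD('n) * sqnorm h)"
    by (rule Liminf_le) (use main in auto)
  finally show ?thesis
    by (intro L2_of_nn_integral) (auto simp: sqnorm_nonneg)
qed

text \<open>Completeness of \<open>L\<^sup>2\<close> for rapidly converging sequences, in a form that supplies an integrable
  majorant of the squares. With \<open>d\<^sub>k\<close> the modulus of the \<open>k\<close>-th increment, the series of the \<open>2\<^sup>k d\<^sub>k\<^sup>2\<close> has finite
  integral and, by the inequality of Cauchy and Schwarz, dominates half the square of the sum of the \<open>d\<^sub>k\<close>.\<close>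

lemma L2_fast_Cauchy:
  fixes a :: "nat \<Rightarrow> 'a::euclidean_space \<Rightarrow> complex"
  assumes a: "\<And>k. L2 (a k)" and M: "\<And>k. sqnorm (\<lambda>x. a (Suc k) x - a k x) \<le> M * (1/4) ^ k"
  obtains A w where "A \<in> borel_measurable borel" "integrable lborel w" "AE x in lborel. (\<lambda>k. a k x) \<longlonglongrightarrow> A x"
    "\<And>k. AE x in lborel. (cmod (a k x))\<^sup>2 \<le> w x"
proof -
  note [measurable] = L2_borel[OF a]
  define d where "d = (\<lambda>k x. a (Suc k) x - a k x)"
  have d: "L2 (d k)" for k unfolding d_def by (intro L2_diff a)
  note [measurable] = L2_borel[OF d]
  define S where "S = (\<lambda>x. \<Sum>k. ennreal (2 ^ k * (cmod (d k x))\<^sup>2))"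
  have [measurable]: "S \<in> borel_measurable borel" unfolding S_def by measurable
  have M0: "M \<ge> 0" using M[of 0] sqnorm_nonneg[of "\<lambda>x. a (Suc 0) x - a 0 x"] by simp
  have "(\<integral>\<^sup>+x. S x \<partial>lborel) = (\<Sum>k. \<integral>\<^sup>+x. ennreal (2 ^ k * (cmod (d k x))\<^sup>2) \<partial>lborel)"
    unfolding S_def by (rule nn_integral_suminf) measurable
  also have "\<dots> \<le> (\<Sum>k. ennreal (M * (1/2) ^ k))"
  proof (rule suminf_le)
    fix k
    have "(\<integral>\<^sup>+x. ennreal (2 ^ k * (cmod (d k x))\<^sup>2) \<partial>lborel) = ennreal (2 ^ k * sqnorm (d k))"
      by (simp add: ennreal_mult nn_integral_cmult sqnorm_ennreal[OF d] sqnorm_nonneg)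
    also have "\<dots> \<le> ennreal (2 ^ k * (M * (1/4) ^ k))"
      using M[of k] by (intro ennreal_leI mult_left_mono) (auto simp: d_def)
    also have "2 ^ k * (M * (1/4) ^ k) = M * (1/2) ^ k"
      by (simp add: power_mult_distrib[symmetric] mult.left_commute)
    finally show "(\<integral>\<^sup>+x. ennreal (2 ^ k * (cmod (d k x))\<^sup>2) \<partial>lborel) \<le> ennreal (M * (1/2) ^ k)" .
  qed auto
  also have "\<dots> = ennreal (\<Sum>k. M * (1/2) ^ k)"
    by (rule suminf_ennreal2) (use M0 in \<open>auto intro!: summable_mult\<close>)
  also have "\<dots> < \<infinity>" by simp
  finally have Sfin: "(\<integral>\<^sup>+x. S x \<partial>lborel) < \<infinity>" .
  have Sae: "AE x in lborel. S x \<noteq> \<infinity>"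
    by (rule nn_integral_PInf_AE) (use Sfin in auto)
  define s where "s = (\<lambda>x. enn2real (S x))"
  have [measurable]: "s \<in> borel_measurable borel" by (simp add: s_def)
  have s0: "s x \<ge> 0" for x by (simp add: s_def)
  have si: "integrable lborel s"
  proof (rule integrableI_nonneg)
    have "(\<integral>\<^sup>+x. ennreal (s x) \<partial>lborel) = (\<integral>\<^sup>+x. S x \<partial>lborel)"
      by (rule nn_integral_cong_AE) (use Sae in \<open>auto simp: s_def less_top\<close>)
    then show "(\<integral>\<^sup>+x. ennreal (s x) \<partial>lborel) < \<infinity>" using Sfin by simp
  qed (auto simp: s0)
  have partial: "(\<Sum>j<N. cmod (d j x))\<^sup>2 \<le> 2 * s x" if "S x \<noteq> \<infinity>" for N x
  proof -
    \<comment> \<open>The weights are split such that the first factor is square summable.\<close>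
    have "(\<Sum>j<N. cmod (d j x)) = (\<Sum>j<N. sqrt ((1/2) ^ j) * (sqrt (2 ^ j) * cmod (d j x)))"
      by (intro sum.cong refl) (simp add: real_sqrt_mult[symmetric] power_mult_distrib[symmetric] mult.assoc[symmetric])
    then have "(\<Sum>j<N. cmod (d j x))\<^sup>2 \<le> (\<Sum>j<N. (sqrt ((1/2) ^ j))\<^sup>2) * (\<Sum>j<N. (sqrt (2 ^ j) * cmod (d j x))\<^sup>2)"
      by (simp only: Cauchy_Schwarz_ineq_sum)
    also have "\<dots> = (\<Sum>j<N. (1/2) ^ j) * (\<Sum>j<N. 2 ^ j * (cmod (d j x))\<^sup>2)"
      by (simp add: power_mult_distrib)
    also have "\<dots> \<le> 2 * s x"
    proof (rule mult_mono)
      have "(\<Sum>j<N. (1/2) ^ j) = 2 - 2 * (1/2 :: real) ^ N" by (induction N) auto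
      then show "(\<Sum>j<N. (1/2) ^ j) \<le> (2::real)" by simp
      have "ennreal (\<Sum>j<N. 2 ^ j * (cmod (d j x))\<^sup>2) = (\<Sum>j<N. ennreal (2 ^ j * (cmod (d j x))\<^sup>2))"
        by (rule sum_ennreal[symmetric]) auto
      also have "\<dots> \<le> S x" unfolding S_def by (rule sum_le_suminf) auto
      also have "S x = ennreal (s x)" using that by (simp add: s_def less_top)
      finally show "(\<Sum>j<N. 2 ^ j * (cmod (d j x))\<^sup>2) \<le> s x" using s0 by (simp add: ennreal_le_iff)
    qed (auto intro!: sum_nonneg)
    finally show ?thesis .
  qed
  have tele: "a N x = a 0 x + (\<Sum>j<N. d j x)" for N x
    unfolding d_def using sum_lessThan_telescope[of "\<lambda>j. a j x" N] by simp
  have cvg: "convergent (\<lambda>k. a k x)" if "S x \<noteq> \<infinity>" for x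
  proof -
    have "summable (\<lambda>j. cmod (d j x))"
    proof (rule summableI_nonneg_bounded)
      fix N
      have "(\<Sum>j<N. cmod (d j x)) = sqrt ((\<Sum>j<N. cmod (d j x))\<^sup>2)" by (simp add: sum_nonneg)
      also have "\<dots> \<le> sqrt (2 * s x)" using partial[OF that] by (intro real_sqrt_le_mono)
      finally show "(\<Sum>j<N. cmod (d j x)) \<le> sqrt (2 * s x)" .
    qed auto
    then have "summable (\<lambda>j. d j x)" by (rule summable_norm_cancel)
    then have "convergent (\<lambda>N. \<Sum>j<N. d j x)" by (simp add: summable_iff_convergent)
    then have "convergent (\<lambda>N. a 0 x + (\<Sum>j<N. d j x))" by (intro convergent_add convergent_const)
    then show ?thesis by (simp flip: tele)
  qed
  have bound: "(cmod (a k x))\<^sup>2 \<le> 2 * (cmod (a 0 x))\<^sup>2 + 4 * s x" if "S x \<noteq> \<infinity>" for k x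
  proof -
    have "(cmod (\<Sum>j<k. d j x))\<^sup>2 \<le> (\<Sum>j<k. cmod (d j x))\<^sup>2" by (intro power_mono norm_sum) auto
    then show ?thesis
      using cmod_add_sq[of "a 0 x" "\<Sum>j<k. d j x"] partial[OF that, of k] unfolding tele[of k x] by linarith
  qed
  show ?thesis
  proof (rule that[of "\<lambda>x. lim (\<lambda>k. a k x)" "\<lambda>x. 2 * (cmod (a 0 x))\<^sup>2 + 4 * s x"])
    show "integrable lborel (\<lambda>x. 2 * (cmod (a 0 x))\<^sup>2 + 4 * s x)"
      by (intro Bochner_Integration.integrable_add integrable_mult_right L2_integrable_sq a si)
    show "AE x in lborel. (\<lambda>k. a k x) \<longlonglongrightarrow> lim (\<lambda>k. a k x)"
      using Sae by eventually_elim (use cvg convergent_LIMSEQ_iff in blast)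
    show "AE x in lborel. (cmod (a k x))\<^sup>2 \<le> 2 * (cmod (a 0 x))\<^sup>2 + 4 * s x" for k
      using Sae by eventually_elim (use bound in blast)
  qed measurable
qed

lemma ball_tail_small:
  fixes A :: "'a::euclidean_space \<Rightarrow> complex"
  assumes A: "L2 A" and "\<delta> > 0"
  shows "\<exists>R\<ge>real k. sqnorm (\<lambda>x. indicator (- cball 0 R) x * A x) \<le> \<delta>"
proof -
  note [measurable] = L2_borel[OF A]
  have "(\<lambda>m. sqnorm (\<lambda>x. indicator (- cball 0 (real m)) x * A x)) \<longlonglongrightarrow> (LINT x::'a|lborel. 0)"
    unfolding sqnorm_def
  proof (rule integral_dominated_convergence)
    show "integrable lborel (\<lambda>x. (cmod (A x))\<^sup>2)" by (rule L2_integrable_sq[OF A])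
    show "AE x in lborel. (\<lambda>m. (cmod (indicator (- cball 0 (real m)) x * A x))\<^sup>2) \<longlonglongrightarrow> 0"
    proof (intro AE_I2)
      fix x :: 'a
      obtain N where "norm x \<le> real N" using real_arch_simple by blast
      then have "\<forall>m\<ge>N. (cmod (indicator (- cball 0 (real m)) x * A x))\<^sup>2 = 0"
        by (auto simp: indicator_def)
      then show "(\<lambda>m. (cmod (indicator (- cball 0 (real m)) x * A x))\<^sup>2) \<longlonglongrightarrow> 0"
        by (intro tendsto_eventually) (auto simp: eventually_sequentially)
    qed
    show "AE x in lborel. norm ((cmod (indicator (- cball 0 (real m)) x * A x))\<^sup>2) \<le> (cmod (A x))\<^sup>2" for m
      by (intro AE_I2) (auto simp: indicator_def)
  qed measurable
  then have "(\<lambda>m. sqnorm (\<lambda>x. indicator (- cball 0 (real m)) x * A x)) \<longlonglongrightarrow> 0" by simp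
  then have "\<forall>\<^sub>F m in sequentially. sqnorm (\<lambda>x. indicator (- cball 0 (real m)) x * A x) < \<delta>"
    by (rule order_tendstoD) fact
  then obtain N where N: "\<And>m. m \<ge> N \<Longrightarrow> sqnorm (\<lambda>x. indicator (- cball 0 (real m)) x * A x) < \<delta>"
    by (auto simp: eventually_sequentially)
  show ?thesis
    using N[of "max N k"] by (intro exI[of _ "real (max N k)"]) auto
qed

text \<open>The Fourier transform of a square-integrable function, characterised by testing against Schwartz
  functions. It is the limit of the transforms of truncations to balls, whose radii are chosen such that the
  limit exists by \<open>L2_fast_Cauchy\<close>.\<close>

lemma L2_fourier_exists:
  fixes A :: "real^'n::finite \<Rightarrow> complex"
  assumes A: "L2 A"
  shows "\<exists>a. L2 a \<and> sqnorm a \<le> (2 * pi) ^ CARD('n) * sqnorm A \<and>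
     (\<forall>\<phi>\<in>schwartz_functions. (LINT x|lborel. a x * \<phi> x) = (LINT \<xi>|lborel. A \<xi> * fourier \<phi> \<xi>))"
proof -
  note [measurable] = L2_borel[OF A]
  \<comment> \<open>The radii tend to infinity, and the part outside the \<open>k\<close>-th ball has norm at most \<open>2\<^sup>-\<^sup>k\<close>.\<close>
  have "\<exists>R. \<forall>k. R k \<ge> real k \<and> sqnorm (\<lambda>x. indicator (- cball 0 (R k)) x * A x) \<le> (1/4) ^ k"
    using ball_tail_small[OF A] by (intro choice) simp
  then obtain R where R: "\<And>k. R k \<ge> real k" "\<And>k. sqnorm (\<lambda>x. indicator (- cball 0 (R k)) x * A x) \<le> (1/4) ^ k"
    by blast
  define B where "B = (\<lambda>k x. indicator (cball 0 (R k)) x * A x)"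
  have [measurable]: "B k \<in> borel_measurable borel" for k
    unfolding B_def by (intro borel_measurable_times borel_measurable_indicator L2_borel A) auto
  have B2: "L2 (B k)" for k
    by (rule L2_bound[OF _ L2_integrable_sq[OF A]]) (auto simp: B_def indicator_def)
  have nB: "sqnorm (B k) \<le> sqnorm A" for k
    unfolding sqnorm_def
    by (intro Bochner_Integration.integral_mono L2_integrable_sq A B2) (auto simp: B_def indicator_def)
  have B1: "integrable lborel (B k)" for k
  proof -
    have "integrable lborel (indicator (cball 0 (R k)) :: real^'n \<Rightarrow> real)"
      by (rule integrable_real_indicator) (use emeasure_bounded_finite[OF bounded_cball, of 0 "R k"] in auto)
    then have "L2 (\<lambda>x::real^'n. indicator (cball 0 (R k)) x)"
      by (intro L2_bound[where g = "indicator (cball 0 (R k))"]) (auto simp: indicator_def)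
    then show ?thesis unfolding B_def by (rule L2_mult_integrable[OF _ A])
  qed
  have nd: "sqnorm (\<lambda>x. B (Suc k) x - B k x) \<le> 4 * (1/4) ^ k" for k
  proof -
    let ?t = "\<lambda>k x. indicator (- cball 0 (R k)) x * A x"
    have t: "L2 (?t k)" for k
      by (rule L2_bound[OF _ L2_integrable_sq[OF A]]) (auto simp: indicator_def)
    have "sqnorm (\<lambda>x. B (Suc k) x - B k x) \<le> (LINT x|lborel. 2 * (cmod (?t k x))\<^sup>2 + 2 * (cmod (?t (Suc k) x))\<^sup>2)"
      unfolding sqnorm_def
    proof (intro Bochner_Integration.integral_mono L2_integrable_sq L2_diff B2 Bochner_Integration.integrable_add integrable_mult_right t)
      fix x
      show "(cmod (B (Suc k) x - B k x))\<^sup>2 \<le> 2 * (cmod (?t k x))\<^sup>2 + 2 * (cmod (?t (Suc k) x))\<^sup>2"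
        by (auto simp: B_def indicator_def)
    qed
    also have "\<dots> = 2 * sqnorm (?t k) + 2 * sqnorm (?t (Suc k))"
      unfolding sqnorm_def by (subst Bochner_Integration.integral_add)
        (auto intro!: integrable_mult_right L2_integrable_sq t simp del: mult_eq_0_iff)
    also have "\<dots> \<le> 2 * (1/4) ^ k + 2 * (1/4) ^ Suc k" using R(2)[of k] R(2)[of "Suc k"] by linarith
    also have "\<dots> \<le> 4 * (1/4) ^ k" by simp
    finally show ?thesis .
  qed
  define a where "a = (\<lambda>k. fourier (B k))"
  have a2: "L2 (a k)" and na: "sqnorm (a k) \<le> (2 * pi) ^ CARD('n) * sqnorm (B k)" for k
    using fourier_sqnorm_le[OF B1 B2, of k] by (auto simp: a_def)
  have ad: "sqnorm (\<lambda>x. a (Suc k) x - a k x) \<le> ((2 * pi) ^ CARD('n) * 4) * (1/4) ^ k" for k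
  proof -
    have "a (Suc k) x - a k x = fourier (\<lambda>x. B (Suc k) x - B k x) x" for x
      using fourier_add[OF B1 integrable_mult_right[OF B1, of "-1"], of "Suc k" k x]
        fourier_cmult[of "-1" "B k" x] by (simp add: a_def)
    then have "sqnorm (\<lambda>x. a (Suc k) x - a k x) = sqnorm (fourier (\<lambda>x. B (Suc k) x - B k x))" by simp
    also have "\<dots> \<le> (2 * pi) ^ CARD('n) * sqnorm (\<lambda>x. B (Suc k) x - B k x)"
      using fourier_sqnorm_le[OF Bochner_Integration.integrable_diff[OF B1 B1] L2_diff[OF B2 B2]] by blast
    also have "\<dots> \<le> (2 * pi) ^ CARD('n) * (4 * (1/4) ^ k)" by (intro mult_left_mono nd) auto
    finally show ?thesis by simp
  qed
  obtain L w where [measurable]: "L \<in> borel_measurable borel" and w: "integrable lborel w"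
    and lim: "AE x in lborel. (\<lambda>k. a k x) \<longlonglongrightarrow> L x" and le: "\<And>k. AE x in lborel. (cmod (a k x))\<^sup>2 \<le> w x"
    using L2_fast_Cauchy[OF a2 ad] by blast
  note [measurable] = L2_borel[OF a2]
  have cs: "(\<lambda>k. (cmod (a k x))\<^sup>2) \<longlonglongrightarrow> (cmod (L x))\<^sup>2" if "(\<lambda>k. a k x) \<longlonglongrightarrow> L x" for x
    by (intro tendsto_intros that)
  have L2L: "integrable lborel (\<lambda>x. (cmod (L x))\<^sup>2)" and nlim: "(\<lambda>k. sqnorm (a k)) \<longlonglongrightarrow> sqnorm L"
  proof -
    have 1: "AE x in lborel. (\<lambda>k. (cmod (a k x))\<^sup>2) \<longlonglongrightarrow> (cmod (L x))\<^sup>2"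
      using lim by eventually_elim (rule cs)
    have 2: "AE x in lborel. norm ((cmod (a k x))\<^sup>2) \<le> w x" for k using le[of k] by simp
    show "integrable lborel (\<lambda>x. (cmod (L x))\<^sup>2)"
      by (rule integrable_dominated_convergence[OF _ _ w 1 2]) measurable
    show "(\<lambda>k. sqnorm (a k)) \<longlonglongrightarrow> sqnorm L"
      unfolding sqnorm_def by (rule integral_dominated_convergence[OF _ _ w 1 2]) measurable
  qed
  have L: "L2 L" using L2L by (simp add: L2_def)
  have "sqnorm (a k) \<le> (2 * pi) ^ CARD('n) * sqnorm A" for k
    by (rule order_trans[OF na]) (intro mult_left_mono nB, simp)
  then have nL: "sqnorm L \<le> (2 * pi) ^ CARD('n) * sqnorm A"
    by (intro LIMSEQ_le_const2[OF nlim]) blast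
  have "(LINT x|lborel. L x * \<phi> x) = (LINT \<xi>|lborel. A \<xi> * fourier \<phi> \<xi>)" if \<phi>: "\<phi> \<in> schwartz_functions" for \<phi>
  proof (rule LIMSEQ_unique)
    note [measurable] = schwartz_borel[OF \<phi>]
    have F: "fourier \<phi> \<in> schwartz_functions" by (rule fourier_schwartz[OF \<phi>])
    show "(\<lambda>k. LINT x|lborel. a k x * \<phi> x) \<longlonglongrightarrow> (LINT x|lborel. L x * \<phi> x)"
    proof (rule integral_dominated_convergence)
      show "integrable lborel (\<lambda>x. w x + (cmod (\<phi> x))\<^sup>2)"
        by (intro Bochner_Integration.integrable_add w L2_integrable_sq schwartz_L2 \<phi>)
      show "AE x in lborel. (\<lambda>k. a k x * \<phi> x) \<longlonglongrightarrow> L x * \<phi> x"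
        using lim by eventually_elim (intro tendsto_intros)
      show "AE x in lborel. norm (a k x * \<phi> x) \<le> w x + (cmod (\<phi> x))\<^sup>2" for k
        using le[of k]
      proof eventually_elim
        case (elim x)
        then show ?case using prod_le_sum_squares[of "cmod (a k x)" "cmod (\<phi> x)"] by (simp add: norm_mult)
      qed
    qed measurable
    have "(LINT x|lborel. a k x * \<phi> x) = (LINT \<xi>|lborel. B k \<xi> * fourier \<phi> \<xi>)" for k
      unfolding a_def by (rule fourier_duality[OF B1 schwartz_integrable(1)[OF \<phi>]])
    moreover have "(\<lambda>k. LINT \<xi>|lborel. B k \<xi> * fourier \<phi> \<xi>) \<longlonglongrightarrow> (LINT \<xi>|lborel. A \<xi> * fourier \<phi> \<xi>)"
    proof (rule integral_dominated_convergence)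
      show "integrable lborel (\<lambda>\<xi>. cmod (A \<xi> * fourier \<phi> \<xi>))"
        by (intro integrable_norm L2_mult_integrable A schwartz_L2 F)
      show "AE \<xi> in lborel. (\<lambda>k. B k \<xi> * fourier \<phi> \<xi>) \<longlonglongrightarrow> A \<xi> * fourier \<phi> \<xi>"
      proof (intro AE_I2)
        fix \<xi> :: "real^'n"
        obtain N where "norm \<xi> \<le> real N" using real_arch_simple by blast
        then have "\<forall>k\<ge>N. B k \<xi> = A \<xi>"
          using R(1) by (auto simp: B_def indicator_def) (meson of_nat_le_iff order_trans)
        then show "(\<lambda>k. B k \<xi> * fourier \<phi> \<xi>) \<longlonglongrightarrow> A \<xi> * fourier \<phi> \<xi>"
          by (intro tendsto_eventually) (auto simp: eventually_sequentially)
      qed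
      show "AE \<xi> in lborel. norm (B k \<xi> * fourier \<phi> \<xi>) \<le> cmod (A \<xi> * fourier \<phi> \<xi>)" for k
        by (intro AE_I2) (auto simp: B_def indicator_def)
    qed measurable
    ultimately show "(\<lambda>k. LINT x|lborel. a k x * \<phi> x) \<longlonglongrightarrow> (LINT \<xi>|lborel. A \<xi> * fourier \<phi> \<xi>)" by simp
  qed
  then show ?thesis using L nL by blast
qed

text \<open>\<open>A\<close> is the Fourier transform of \<open>a\<close>, where both are in \<open>L\<^sup>2\<close>. The relation is used instead of
  a function since \<open>a\<close> and \<open>A\<close> determine each other only almost everywhere.\<close>

definition fourier_pair :: "(real^'n::finite \<Rightarrow> complex) \<Rightarrow> (real^'n \<Rightarrow> complex) \<Rightarrow> bool" where
  "fourier_pair a A \<longleftrightarrow> L2 a \<and> L2 A \<and>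
     (\<forall>\<phi>\<in>schwartz_functions. (LINT x|lborel. a x * \<phi> x) = (LINT \<xi>|lborel. A \<xi> * inv_fourier \<phi> \<xi>))"

lemma fourier_pair_exists_right:
  fixes a :: "real^'n::finite \<Rightarrow> complex"
  assumes a: "L2 a"
  shows "\<exists>A. fourier_pair a A \<and> sqnorm A \<le> (2 * pi) ^ CARD('n) * sqnorm a"
proof -
  obtain A where A: "L2 A" "sqnorm A \<le> (2 * pi) ^ CARD('n) * sqnorm a"
     "\<And>\<phi>. \<phi>\<in>schwartz_functions \<Longrightarrow> (LINT x|lborel. A x * \<phi> x) = (LINT \<xi>|lborel. a \<xi> * fourier \<phi> \<xi>)"
    using L2_fourier_exists[OF a] by blast
  have "(LINT x|lborel. a x * \<phi> x) = (LINT \<xi>|lborel. A \<xi> * inv_fourier \<phi> \<xi>)" if "\<phi>\<in>schwartz_functions" for \<phi>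
    using A(3)[OF inv_fourier_schwartz[OF that]] by (simp add: fourier_inv_fourier[OF that])
  then show ?thesis using a A by (auto simp: fourier_pair_def)
qed

text \<open>The inverse transform is the transform of the reflected function, divided by \<open>(2\<pi>)\<^sup>n\<close>.\<close>

lemma fourier_pair_exists_left:
  fixes A :: "real^'n::finite \<Rightarrow> complex"
  assumes A: "L2 A"
  shows "\<exists>a. fourier_pair a A \<and> sqnorm a * (2 * pi) ^ CARD('n) \<le> sqnorm A"
proof -
  note [measurable] = L2_borel[OF A]
  define c where "c = complex_of_real (inverse ((2 * pi) ^ CARD('n)))"
  define B where "B = (\<lambda>\<xi>. c * A (- \<xi>))"
  have B: "L2 B" unfolding B_def by (intro L2_cmult L2_uminus A)
  have nB: "sqnorm B = (inverse ((2 * pi) ^ CARD('n)))\<^sup>2 * sqnorm A"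
    using L2_uminus(2)[OF A] unfolding B_def sqnorm_def by (simp add: norm_mult power_mult_distrib c_def norm_inverse norm_power)
  obtain a where a: "L2 a" "sqnorm a \<le> (2 * pi) ^ CARD('n) * sqnorm B"
     "\<And>\<phi>. \<phi>\<in>schwartz_functions \<Longrightarrow> (LINT x|lborel. a x * \<phi> x) = (LINT \<xi>|lborel. B \<xi> * fourier \<phi> \<xi>)"
    using L2_fourier_exists[OF B] by blast
  have "(LINT x|lborel. a x * \<phi> x) = (LINT \<xi>|lborel. A \<xi> * inv_fourier \<phi> \<xi>)" if \<phi>: "\<phi>\<in>schwartz_functions" for \<phi>
  proof -
    note [measurable] = schwartz_borel[OF \<phi>]
    have "(LINT \<xi>|lborel. B \<xi> * fourier \<phi> \<xi>) = (LINT \<xi>|lborel. B (- \<xi>) * fourier \<phi> (- \<xi>))"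
      using integral_uminus(2)[of "\<lambda>\<xi>. B \<xi> * fourier \<phi> \<xi>"] by (simp add: B_def)
    then show ?thesis
      unfolding a(3)[OF \<phi>] by (simp add: B_def inv_fourier_eq c_def divide_inverse mult_ac)
  qed
  moreover have "sqnorm a * (2 * pi) ^ CARD('n) \<le> sqnorm A"
  proof -
    have "sqnorm a * (2 * pi) ^ CARD('n) \<le> ((2 * pi) ^ CARD('n) * sqnorm B) * (2 * pi) ^ CARD('n)"
      by (intro mult_right_mono a) auto
    also have "\<dots> = sqnorm A"
    proof -
      have *: "Q \<noteq> 0 \<Longrightarrow> (Q * ((inverse Q)\<^sup>2 * v)) * Q = v" for Q v :: real by (simp add: power2_eq_square)
      show ?thesis unfolding nB by (rule *) simp
    qed
    finally show ?thesis .
  qed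
  ultimately show ?thesis using a A by (auto simp: fourier_pair_def)
qed

text \<open>Both transforms satisfy the upper bound, and they are inverse to each other up to null sets.\<close>

lemma fourier_pair_sqnorm:
  fixes a :: "real^'n::finite \<Rightarrow> complex"
  assumes "fourier_pair a A"
  shows "sqnorm A = (2 * pi) ^ CARD('n) * sqnorm a"
proof (rule antisym)
  obtain A' where A': "fourier_pair a A'" "sqnorm A' \<le> (2 * pi) ^ CARD('n) * sqnorm a"
    using fourier_pair_exists_right[of a] assms unfolding fourier_pair_def by blast
  have "AE x in lborel. A' x = A x"
  proof (rule L2_eq_AE)
    fix \<phi> :: "real^'n \<Rightarrow> complex" assume \<phi>: "\<phi> \<in> schwartz_functions"
    have F: "fourier \<phi> \<in> schwartz_functions" by (rule fourier_schwartz[OF \<phi>])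
    show "(LINT x|lborel. A' x * \<phi> x) = (LINT x|lborel. A x * \<phi> x)"
      using A'(1) assms F inv_fourier_fourier[OF \<phi>] unfolding fourier_pair_def by metis
  qed (use assms A' in \<open>auto simp: fourier_pair_def\<close>)
  then have "sqnorm A = sqnorm A'"
    using L2_cong_AE[of A' A] A'(1) assms L2_borel by (auto simp: fourier_pair_def)
  then show "sqnorm A \<le> (2 * pi) ^ CARD('n) * sqnorm a" using A' by simp
next
  obtain a' where a': "fourier_pair a' A" "sqnorm a' * (2 * pi) ^ CARD('n) \<le> sqnorm A"
    using fourier_pair_exists_left[of A] assms unfolding fourier_pair_def by blast
  have "AE x in lborel. a' x = a x"
    by (rule L2_eq_AE) (use assms a' in \<open>auto simp: fourier_pair_def\<close>)
  then have "sqnorm a = sqnorm a'"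
    using L2_cong_AE[of a' a] a'(1) assms L2_borel by (auto simp: fourier_pair_def)
  then show "(2 * pi) ^ CARD('n) * sqnorm a \<le> sqnorm A" using a' by (simp add: mult.commute)
qed

lemma fourier_pair_add_cmult:
  assumes "fourier_pair a A" "fourier_pair b B"
  shows "fourier_pair (\<lambda>x. a x + c * b x) (\<lambda>\<xi>. A \<xi> + c * B \<xi>)"
  unfolding fourier_pair_def
proof (intro conjI ballI)
  show "L2 (\<lambda>x. a x + c * b x)" "L2 (\<lambda>x. A x + c * B x)"
    using assms by (auto simp: fourier_pair_def intro!: L2_add L2_cmult)
  fix \<phi> :: "real^'a \<Rightarrow> complex" assume \<phi>: "\<phi> \<in> schwartz_functions"
  note V = inv_fourier_schwartz[OF \<phi>]
  have i: "integrable lborel (\<lambda>x. a x * \<phi> x)" "integrable lborel (\<lambda>x. b x * \<phi> x)"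
    "integrable lborel (\<lambda>x. A x * inv_fourier \<phi> x)" "integrable lborel (\<lambda>x. B x * inv_fourier \<phi> x)"
    using assms by (auto simp: fourier_pair_def intro!: L2_mult_integrable schwartz_L2 \<phi> V)
  then show "(LINT x|lborel. (a x + c * b x) * \<phi> x) = (LINT \<xi>|lborel. (A \<xi> + c * B \<xi>) * inv_fourier \<phi> \<xi>)"
    using assms \<phi> by (simp add: fourier_pair_def distrib_right mult.assoc)
qed

lemma fourier_pair_cnj:
  assumes "fourier_pair a A"
  shows "fourier_pair (\<lambda>x. cnj (a x)) (\<lambda>\<xi>. cnj (A (- \<xi>)))"
  unfolding fourier_pair_def
proof (intro conjI ballI)
  show "L2 (\<lambda>x. cnj (a x))" "L2 (\<lambda>x. cnj (A (- x)))"
    using assms by (auto simp: fourier_pair_def intro!: L2_cnj L2_uminus)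
  fix \<phi> :: "real^'a \<Rightarrow> complex" assume \<phi>: "\<phi> \<in> schwartz_functions"
  have \<phi>': "(\<lambda>x. cnj (\<phi> x)) \<in> schwartz_functions" by (rule schwartz_cnj[OF \<phi>])
  note [measurable] = schwartz_borel[OF \<phi>] schwartz_borel[OF inv_fourier_schwartz[OF \<phi>]]
  have [measurable]: "A \<in> borel_measurable borel" using assms by (auto simp: fourier_pair_def L2_def)
  have "(LINT x|lborel. cnj (a x) * \<phi> x) = (LINT x|lborel. cnj (a x * cnj (\<phi> x)))" by simp
  also have "\<dots> = cnj (LINT x|lborel. a x * cnj (\<phi> x))" by (rule Bochner_Integration.integral_cnj)
  also have "\<dots> = cnj (LINT \<xi>|lborel. A \<xi> * inv_fourier (\<lambda>x. cnj (\<phi> x)) \<xi>)"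
    using assms \<phi>' by (simp add: fourier_pair_def)
  also have "\<dots> = (LINT \<xi>|lborel. cnj (A \<xi> * inv_fourier (\<lambda>x. cnj (\<phi> x)) \<xi>))"
    by (rule Bochner_Integration.integral_cnj[symmetric])
  also have "\<dots> = (LINT \<xi>|lborel. cnj (A \<xi>) * inv_fourier \<phi> (- \<xi>))"
    by (simp add: inv_fourier_cnj)
  also have "\<dots> = (LINT \<xi>|lborel. cnj (A (- \<xi>)) * inv_fourier \<phi> (- (- \<xi>)))"
    by (rule integral_uminus(2)[symmetric]) measurable
  finally show "(LINT x|lborel. cnj (a x) * \<phi> x) = (LINT \<xi>|lborel. cnj (A (- \<xi>)) * inv_fourier \<phi> \<xi>)"
    by simp
qed

lemma polarization_cmod:
  "4 * (u * cnj v) = of_real ((cmod (u + 1 * v))\<^sup>2) - of_real ((cmod (u + (-1) * v))\<^sup>2) +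
     \<i> * of_real ((cmod (u + \<i> * v))\<^sup>2) - \<i> * of_real ((cmod (u + (- \<i>) * v))\<^sup>2)"
  unfolding complex_eq_iff cmod_power2
  by (simp add: power2_eq_square) (simp add: algebra_simps)

lemma polarization:
  assumes "L2 f" "L2 g"
  shows "4 * (LINT x|lborel. f x * cnj (g x)) = of_real (sqnorm (\<lambda>x. f x + 1 * g x)) - of_real (sqnorm (\<lambda>x. f x + (-1) * g x)) +
     \<i> * of_real (sqnorm (\<lambda>x. f x + \<i> * g x)) - \<i> * of_real (sqnorm (\<lambda>x. f x + (- \<i>) * g x))"
proof -
  have i: "complex_integrable lborel (\<lambda>x. complex_of_real ((cmod (f x + c * g x))\<^sup>2))" for c
    by (intro complex_of_real_integrable_eq[THEN iffD2] L2_integrable_sq L2_add L2_cmult assms)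
  have "4 * (LINT x|lborel. f x * cnj (g x)) = (LINT x|lborel. 4 * (f x * cnj (g x)))"
    by (rule integral_mult_right_zero[symmetric])
  also have "\<dots> = (LINT x|lborel. of_real ((cmod (f x + 1 * g x))\<^sup>2)) - (LINT x|lborel. of_real ((cmod (f x + (-1) * g x))\<^sup>2)) +
     \<i> * (LINT x|lborel. of_real ((cmod (f x + \<i> * g x))\<^sup>2)) - \<i> * (LINT x|lborel. of_real ((cmod (f x + (- \<i>) * g x))\<^sup>2))"
    unfolding polarization_cmod
    by (simp only: i Bochner_Integration.integral_add Bochner_Integration.integral_diff integral_mult_right_zero
      Bochner_Integration.integrable_add Bochner_Integration.integrable_diff integrable_mult_right)
  finally show ?thesis unfolding sqnorm_def by (simp only: integral_complex_of_real)
qed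

text \<open>Polarisation of the equality of norms, applied to \<open>a\<close> and the conjugate of \<open>b\<close>.\<close>

lemma fourier_pair_parseval:
  fixes a :: "real^'n::finite \<Rightarrow> complex"
  assumes "fourier_pair a A" "fourier_pair b B"
  shows "(LINT \<xi>|lborel. A \<xi> * B (- \<xi>)) = of_real ((2 * pi) ^ CARD('n)) * (LINT x|lborel. a x * b x)"
proof -
  let ?d = "\<lambda>x. cnj (b x)" and ?D = "\<lambda>\<xi>. cnj (B (- \<xi>))"
  have d: "fourier_pair ?d ?D" by (rule fourier_pair_cnj[OF assms(2)])
  have n: "sqnorm (\<lambda>\<xi>. A \<xi> + c * ?D \<xi>) = (2 * pi) ^ CARD('n) * sqnorm (\<lambda>x. a x + c * ?d x)" for c
    by (rule fourier_pair_sqnorm[OF fourier_pair_add_cmult[OF assms(1) d]])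
  have "4 * (LINT \<xi>|lborel. A \<xi> * cnj (?D \<xi>)) = of_real ((2 * pi) ^ CARD('n)) * (4 * (LINT x|lborel. a x * cnj (?d x)))"
    using assms(1) d unfolding fourier_pair_def
    by (subst (1 2) polarization) (auto simp only: n of_real_mult right_diff_distrib distrib_left mult_ac)
  then show ?thesis by (simp only: complex_cnj_cnj) simp
qed

section \<open>Multiple brackets\<close>

lemma block_norm_sq: "(block_norm b l \<xi>)\<^sup>2 = (\<Sum>i | b i = l. (\<xi> $ i)\<^sup>2)"
  unfolding block_norm_def by (intro real_sqrt_pow2 sum_nonneg) auto

lemma block_norm_L2_set: "block_norm b l \<xi> = L2_set (\<lambda>i. \<xi> $ i) {i. b i = l}"
  by (simp add: block_norm_def L2_set_def)

lemma block_norm_nonneg: "block_norm b l \<xi> \<ge> 0"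
  by (simp add: block_norm_L2_set)

lemma block_norm_triangle: "block_norm b l (\<xi> + \<eta>) \<le> block_norm b l \<xi> + block_norm b l \<eta>"
proof -
  have "(\<lambda>i. (\<xi> + \<eta>) $ i) = (\<lambda>i. \<xi> $ i + \<eta> $ i)" by auto
  then show ?thesis unfolding block_norm_L2_set by (simp only: L2_set_triangle_ineq)
qed

lemma block_norm_uminus: "block_norm b l (- \<xi>) = block_norm b l \<xi>"
  by (simp add: block_norm_def)

lemma bracket_pos: "bracket b s \<xi> > 0"
proof -
  have "1 + (block_norm b l \<xi>)\<^sup>2 \<noteq> 0" for l using zero_le_power2[of "block_norm b l \<xi>"] by linarith
  then show ?thesis unfolding bracket_def by (intro prod_pos ballI) simp
qed

lemma bracket_ne_0 [simp]: "bracket b s \<xi> \<noteq> 0"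
  using bracket_pos[of b s \<xi>] by simp

lemma bracket_nonneg: "bracket b s \<xi> \<ge> 0"
  using bracket_pos[of b s \<xi>] by simp

lemma bracket_uminus: "bracket b s (- \<xi>) = bracket b s \<xi>"
  by (simp add: bracket_def block_norm_uminus)

lemma bracket_neg: "bracket b (- s) \<xi> = inverse (bracket b s \<xi>)"
  by (simp add: bracket_def powr_minus prod_inversef[symmetric])

lemma bracket_mono: "(\<And>l. s $ l \<le> t $ l) \<Longrightarrow> bracket b s \<xi> \<le> bracket b t \<xi>"
  unfolding bracket_def by (intro prod_mono) (auto intro!: powr_mono divide_right_mono)

lemma multiplier_bracket: "multiplier (\<lambda>\<xi>. complex_of_real (bracket b s \<xi>))"
  unfolding bracket_def block_norm_sq of_real_prod by (intro multiplier_prod multiplier.bracket)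

lemma bracket_borel [measurable]: "bracket b s \<in> borel_measurable borel"
proof -
  have "(\<lambda>\<xi>. Re (complex_of_real (bracket b s \<xi>))) \<in> borel_measurable borel"
    by (rule measurable_compose[OF smooth_borel[OF multiplier_smooth[OF multiplier_bracket]] borel_measurable_Re])
  then show ?thesis by simp
qed

section \<open>Sobolev spaces on the Fourier side\<close>

text \<open>The representatives provided by the spaces \<^const>\<open>Lp_space\<close> are Lebesgue measurable; a Borel version
  is needed in order to apply Fubini's theorem.\<close>

lemma Lp2_borel_version:
  fixes f :: "'a::euclidean_space \<Rightarrow> complex"
  assumes "f \<in> Lp_space 2"
  shows "\<exists>g. L2 g \<and> (AE x in lborel. f x = g x)"
proof -
  have m: "f \<in> borel_measurable lebesgue" and i: "integrable lebesgue (\<lambda>x. (cmod (f x))\<^sup>2)"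
    using assms by (auto simp: Lp_space_def)
  obtain g1 where g1: "g1 \<in> borel_measurable lborel" "AE x in lborel. Re (f x) = g1 x"
    using completion_ex_borel_measurable_real[OF measurable_compose[OF m borel_measurable_Re]] by auto
  obtain g2 where g2: "g2 \<in> borel_measurable lborel" "AE x in lborel. Im (f x) = g2 x"
    using completion_ex_borel_measurable_real[OF measurable_compose[OF m borel_measurable_Im]] by auto
  define g where "g = (\<lambda>x. Complex (g1 x) (g2 x))"
  have [measurable]: "g1 \<in> borel_measurable borel" "g2 \<in> borel_measurable borel" using g1 g2 by auto
  have "g = (\<lambda>x. complex_of_real (g1 x) + \<i> * complex_of_real (g2 x))"
    by (auto simp: g_def complex_eq_iff)
  then have g [measurable]: "g \<in> borel_measurable borel" by simp
  have ae: "AE x in lborel. f x = g x"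
    using g1(2) g2(2) by eventually_elim (simp add: g_def complex_eq_iff)
  have "integrable lebesgue (\<lambda>x. (cmod (g x))\<^sup>2)"
  proof (rule integrable_cong_AE_imp[OF i])
    show "(\<lambda>x. (cmod (g x))\<^sup>2) \<in> borel_measurable lebesgue"
      by (intro measurable_completion) simp
    show "AE x in lebesgue. (cmod (f x))\<^sup>2 = (cmod (g x))\<^sup>2"
      using AE_completion[OF ae] by eventually_elim simp
  qed
  then have "integrable lborel (\<lambda>x. (cmod (g x))\<^sup>2)"
    by (subst (asm) integrable_completion) auto
  then show ?thesis unfolding L2_def using g ae by blast
qed

lemma L2_Lp2: "L2 g \<Longrightarrow> g \<in> Lp_space 2"
  by (auto simp: L2_def Lp_space_def integrable_completion intro!: measurable_completion)

lemma lint_lebesgue_AE: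
  fixes f g :: "'a::euclidean_space \<Rightarrow> complex"
  assumes "f \<in> borel_measurable lebesgue" "g \<in> borel_measurable borel" "AE x in lborel. f x = g x"
  shows "(LINT x|lebesgue. f x) = (LINT x|lborel. g x)"
proof -
  have "(LINT x|lebesgue. f x) = (LINT x|lebesgue. g x)"
    by (rule integral_cong_AE) (use assms AE_completion[OF assms(3)] in \<open>auto intro!: measurable_completion\<close>)
  then show ?thesis using lint_lebesgue[OF assms(2)] by simp
qed

lemma is_density_AE:
  fixes f g :: "real^'n::finite \<Rightarrow> complex"
  assumes "f \<in> borel_measurable lebesgue" "g \<in> borel_measurable borel" "AE x in lborel. f x = g x"
  shows "is_density f w \<longleftrightarrow> (\<forall>\<phi>\<in>schwartz_functions. w \<phi> = (LINT x|lborel. g x * \<phi> x))"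
proof -
  have "(LINT x|lebesgue. f x * \<phi> x) = (LINT x|lborel. g x * \<phi> x)" if "\<phi> \<in> schwartz_functions" for \<phi>
  proof (rule lint_lebesgue_AE)
    have [measurable]: "\<phi> \<in> borel_measurable borel" by (rule schwartz_borel[OF that])
    have "\<phi> \<in> borel_measurable lebesgue" by (intro measurable_completion) simp
    then show "(\<lambda>x. f x * \<phi> x) \<in> borel_measurable lebesgue" by (intro borel_measurable_times assms)
    show "(\<lambda>x. g x * \<phi> x) \<in> borel_measurable borel" using assms(2) by measurable
    show "AE x in lborel. f x * \<phi> x = g x * \<phi> x" using assms(3) by eventually_elim simp
  qed
  then show ?thesis by (simp add: is_density_def)
qed

lemma in_L2_iff: "in_L2 w \<longleftrightarrow> (\<exists>g. L2 g \<and> (\<forall>\<phi>\<in>schwartz_functions. w \<phi> = (LINT x|lborel. g x * \<phi> x)))"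
proof
  assume "in_L2 w"
  then obtain f where f: "f \<in> Lp_space 2" "is_density f w" by (auto simp: in_L2_def)
  obtain g where g: "L2 g" "AE x in lborel. f x = g x" using Lp2_borel_version[OF f(1)] by blast
  then show "\<exists>g. L2 g \<and> (\<forall>\<phi>\<in>schwartz_functions. w \<phi> = (LINT x|lborel. g x * \<phi> x))"
    using f is_density_AE[of f g w] L2_borel[of g] by (auto simp: Lp_space_def)
next
  assume "\<exists>g. L2 g \<and> (\<forall>\<phi>\<in>schwartz_functions. w \<phi> = (LINT x|lborel. g x * \<phi> x))"
  then obtain g where g: "L2 g" "\<forall>\<phi>\<in>schwartz_functions. w \<phi> = (LINT x|lborel. g x * \<phi> x)" by blast
  then show "in_L2 w"
    using is_density_AE[of g g w] L2_Lp2[OF g(1)] L2_borel[OF g(1)] by (auto simp: in_L2_def Lp_space_def)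
qed

text \<open>The density selected by \<^const>\<open>L2_density\<close> is arbitrary, but any two densities agree almost
  everywhere.\<close>

lemma L2_density_AE:
  assumes g: "L2 g" "\<forall>\<phi>\<in>schwartz_functions. w \<phi> = (LINT x|lborel. g x * \<phi> x)"
  shows "L2_density w \<in> borel_measurable lebesgue" "AE x in lborel. L2_density w x = g x"
proof -
  have "is_density g w" "g \<in> Lp_space 2"
    using is_density_AE[of g g w] L2_Lp2[OF g(1)] L2_borel[OF g(1)] g(2) by (auto simp: Lp_space_def)
  then have "L2_density w \<in> Lp_space 2 \<and> is_density (L2_density w) w"
    unfolding L2_density_def by (intro someI_ex[of "\<lambda>f. f \<in> Lp_space 2 \<and> is_density f w"]) blast
  then have d: "L2_density w \<in> Lp_space 2" "is_density (L2_density w) w" by auto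
  then show m: "L2_density w \<in> borel_measurable lebesgue" by (simp add: Lp_space_def)
  obtain h where h: "L2 h" "AE x in lborel. L2_density w x = h x" using Lp2_borel_version[OF d(1)] by blast
  have "\<forall>\<phi>\<in>schwartz_functions. w \<phi> = (LINT x|lborel. h x * \<phi> x)"
    using is_density_AE[OF m L2_borel[OF h(1)] h(2)] d(2) by simp
  then have "AE x in lborel. h x = g x"
    using g by (intro L2_eq_AE h g(1)) simp
  then show "AE x in lborel. L2_density w x = g x" using h(2) by eventually_elim simp
qed

lemma L2_norm_eq:
  assumes g: "L2 g" "\<forall>\<phi>\<in>schwartz_functions. w \<phi> = (LINT x|lborel. g x * \<phi> x)"
  shows "L2_norm w = sqrt (sqnorm g)"
proof -
  note d = L2_density_AE[OF g]
  note [measurable] = L2_borel[OF g(1)]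
  have "(LINT x|lebesgue. (cmod (L2_density w x))\<^sup>2) = (LINT x|lebesgue. (cmod (g x))\<^sup>2)"
  proof (rule integral_cong_AE)
    show "(\<lambda>x. (cmod (L2_density w x))\<^sup>2) \<in> borel_measurable lebesgue"
      using d(1) by measurable
    show "(\<lambda>x. (cmod (g x))\<^sup>2) \<in> borel_measurable lebesgue" by (intro measurable_completion) simp
    show "AE x in lebesgue. (cmod (L2_density w x))\<^sup>2 = (cmod (g x))\<^sup>2"
      using AE_completion[OF d(2)] by eventually_elim simp
  qed
  also have "\<dots> = sqnorm g" unfolding sqnorm_def by (rule lint_lebesgue) simp
  finally show ?thesis by (simp add: L2_norm_def)
qed

definition weighted :: "('n::finite \<Rightarrow> 'j::finite) \<Rightarrow> real^'j \<Rightarrow> (real^'n \<Rightarrow> complex) \<Rightarrow> real^'n \<Rightarrow> complex" where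
  "weighted b s F = (\<lambda>\<xi>. of_real (bracket b s \<xi>) * F \<xi>)"

text \<open>\<open>F\<close> is the Fourier transform of \<open>u\<close>, and \<open>u\<close> is of Sobolev order \<open>s\<close>.\<close>

definition fourier_rep :: "('n::finite \<Rightarrow> 'j::finite) \<Rightarrow> real^'j \<Rightarrow> 'n functional \<Rightarrow> (real^'n \<Rightarrow> complex) \<Rightarrow> bool" where
  "fourier_rep b s u F \<longleftrightarrow> F \<in> borel_measurable borel \<and> L2 (weighted b s F) \<and>
     (\<forall>\<phi>\<in>schwartz_functions. u \<phi> = (LINT \<xi>|lborel. F \<xi> * inv_fourier \<phi> \<xi>))"

lemma fourier_repD:
  assumes "fourier_rep b s u F"
  shows "F \<in> borel_measurable borel" "L2 (weighted b s F)"
    "\<And>\<phi>. \<phi> \<in> schwartz_functions \<Longrightarrow> u \<phi> = (LINT \<xi>|lborel. F \<xi> * inv_fourier \<phi> \<xi>)"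
  using assms by (auto simp: fourier_rep_def)

lemma L2_weighted_mono:
  assumes "L2 (weighted b t F)" "F \<in> borel_measurable borel" "\<And>l. s $ l \<le> t $ l"
  shows "L2 (weighted b s F)"
proof (rule L2_bound[OF _ L2_integrable_sq[OF assms(1)]])
  show "weighted b s F \<in> borel_measurable borel" using assms(2) unfolding weighted_def by measurable
  show "(cmod (weighted b s F \<xi>))\<^sup>2 \<le> (cmod (weighted b t F \<xi>))\<^sup>2" for \<xi>
    using bracket_mono[OF assms(3), of b \<xi>] bracket_nonneg[of b s \<xi>]
    by (auto simp: weighted_def norm_mult bracket_nonneg abs_of_nonneg intro!: power_mono mult_right_mono)
qed

lemma fourier_rep_mono: "fourier_rep b t u F \<Longrightarrow> (\<And>l. s $ l \<le> t $ l) \<Longrightarrow> fourier_rep b s u F"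
  by (auto simp: fourier_rep_def intro: L2_weighted_mono)

lemma L2_weighted_uminus: "L2 (weighted b s F) \<Longrightarrow> L2 (weighted b s (\<lambda>\<xi>. F (- \<xi>)))"
  using L2_uminus(1)[of "weighted b s F"] by (simp add: weighted_def bracket_uminus)

lemma schwartz_weighted: "f \<in> schwartz_functions \<Longrightarrow> weighted b s f \<in> schwartz_functions"
  unfolding weighted_def by (intro schwartz_multiplier multiplier_bracket)

lemma weighted_weighted_neg: "weighted b s (weighted b (- s) F) = F" "weighted b (- s) (weighted b s F) = F"
  by (simp_all add: weighted_def bracket_neg fun_eq_iff field_simps)

lemma weighted_mult_integrable:
  assumes "L2 (weighted b s F)" "L2 (weighted b (- s) G)"
  shows "integrable lborel (\<lambda>\<xi>. F \<xi> * G \<xi>)"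
proof -
  have "(\<lambda>\<xi>. F \<xi> * G \<xi>) = (\<lambda>\<xi>. weighted b s F \<xi> * weighted b (- s) G \<xi>)"
    by (simp add: weighted_def bracket_neg fun_eq_iff field_simps)
  then show ?thesis using L2_mult_integrable[OF assms] by simp
qed

lemma bracket_D_apply:
  "bracket_D b s u \<phi> = u (fourier (weighted b s (inv_fourier \<phi>)))"
  by (simp add: bracket_D_def fourier_multiplier_def inv_fourier_distr_def fun_mult_def fourier_distr_def weighted_def)

text \<open>If \<open>G\<close> is the transform of the density of \<open>\<langle>\<langle>D\<rangle>\<rangle>\<^sup>s u\<close>, then \<open>\<langle>\<langle>\<xi>\<rangle>\<rangle>\<^sup>-\<^sup>s G\<close> is the transform
  of \<open>u\<close>: test \<open>\<langle>\<langle>D\<rangle>\<rangle>\<^sup>s u\<close> against \<open>\<langle>\<langle>D\<rangle>\<rangle>\<^sup>-\<^sup>s \<phi>\<close>.\<close>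

lemma sobolev_space_fourier_rep:
  fixes u :: "'n::finite functional"
  assumes "u \<in> sobolev_space b s"
  shows "\<exists>F. fourier_rep b s u F"
proof -
  obtain g where g: "L2 g" "\<forall>\<phi>\<in>schwartz_functions. bracket_D b s u \<phi> = (LINT x|lborel. g x * \<phi> x)"
    using assms by (auto simp: sobolev_space_def in_L2_iff)
  obtain G where G: "fourier_pair g G" using fourier_pair_exists_right[OF g(1)] by blast
  have GL: "L2 G" using G by (simp add: fourier_pair_def)
  define F where "F = weighted b (- s) G"
  have "F \<in> borel_measurable borel" using L2_borel[OF GL] by (simp add: F_def weighted_def)
  moreover have "L2 (weighted b s F)" using GL by (simp add: F_def weighted_weighted_neg)
  moreover have "u \<phi> = (LINT \<xi>|lborel. F \<xi> * inv_fourier \<phi> \<xi>)" if \<phi>: "\<phi> \<in> schwartz_functions" for \<phi>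
  proof -
    let ?\<psi> = "fourier (weighted b (- s) (inv_fourier \<phi>))"
    have S: "weighted b (- s) (inv_fourier \<phi>) \<in> schwartz_functions" by (intro schwartz_weighted inv_fourier_schwartz \<phi>)
    have \<psi>: "?\<psi> \<in> schwartz_functions" by (rule fourier_schwartz[OF S])
    have v: "inv_fourier ?\<psi> = weighted b (- s) (inv_fourier \<phi>)" by (rule inv_fourier_fourier[OF S])
    have "bracket_D b s u ?\<psi> = u \<phi>"
      unfolding bracket_D_apply v weighted_weighted_neg fourier_inv_fourier[OF \<phi>] ..
    then have "u \<phi> = (LINT x|lborel. g x * ?\<psi> x)" using g(2) \<psi> by simp
    also have "\<dots> = (LINT \<xi>|lborel. G \<xi> * weighted b (- s) (inv_fourier \<phi>) \<xi>)"
      using G \<psi> v by (simp add: fourier_pair_def)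
    finally show ?thesis by (simp add: F_def weighted_def mult_ac)
  qed
  ultimately show ?thesis by (auto simp: fourier_rep_def)
qed

lemma fourier_rep_density:
  fixes u :: "'n::finite functional"
  assumes "fourier_rep b s u F"
  shows "\<exists>g. fourier_pair g (weighted b s F) \<and> (\<forall>\<phi>\<in>schwartz_functions. bracket_D b s u \<phi> = (LINT x|lborel. g x * \<phi> x))"
proof -
  obtain g where g: "fourier_pair g (weighted b s F)" using fourier_pair_exists_left[OF fourier_repD(2)[OF assms]] by blast
  have "bracket_D b s u \<phi> = (LINT x|lborel. g x * \<phi> x)" if \<phi>: "\<phi> \<in> schwartz_functions" for \<phi>
  proof -
    have S: "weighted b s (inv_fourier \<phi>) \<in> schwartz_functions" by (intro schwartz_weighted inv_fourier_schwartz \<phi>)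
    have "bracket_D b s u \<phi> = (LINT \<xi>|lborel. F \<xi> * weighted b s (inv_fourier \<phi>) \<xi>)"
      unfolding bracket_D_apply
      using fourier_repD(3)[OF assms fourier_schwartz[OF S]] inv_fourier_fourier[OF S] by simp
    also have "\<dots> = (LINT \<xi>|lborel. weighted b s F \<xi> * inv_fourier \<phi> \<xi>)" by (simp add: weighted_def mult_ac)
    also have "\<dots> = (LINT x|lborel. g x * \<phi> x)" using g \<phi> by (simp add: fourier_pair_def)
    finally show ?thesis .
  qed
  then show ?thesis using g by blast
qed

text \<open>The polynomial decay of the inverse transform of \<open>\<phi>\<close> beats the growth of \<open>\<langle>\<langle>\<xi>\<rangle>\<rangle>\<^sup>-\<^sup>s\<close> and leaves
  a square-integrable factor to be paired with \<open>\<langle>\<langle>\<xi>\<rangle>\<rangle>\<^sup>s F\<close>.\<close>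

lemma fourier_density_continuous:
  fixes F :: "real^'n::finite \<Rightarrow> complex"
  assumes [measurable]: "F \<in> borel_measurable borel" and F: "L2 (weighted b s F)"
  shows "\<exists>C\<ge>0. \<exists>N. \<forall>\<phi>\<in>schwartz_functions. cmod (LINT \<xi>|lborel. F \<xi> * inv_fourier \<phi> \<xi>) \<le> C * schwartz_seminorm N \<phi>"
proof -
  obtain D l where D: "D \<ge> 0" "\<And>\<xi>. cmod (of_real (bracket b (- s) \<xi>)) \<le> D * (1 + norm \<xi>) ^ l"
    using multiplier_growth[OF multiplier_bracket[of b "- s"]] by blast
  obtain C N where C: "C \<ge> 0" and N: "\<And>\<phi> \<xi>. \<phi> \<in> schwartz_functions \<Longrightarrow>
      (1 + norm (\<xi>::real^'n)) ^ (l + 2 * CARD('n)) * cmod (fourier \<phi> \<xi>) \<le> C * schwartz_seminorm N \<phi>"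
    using fourier_decay[of "l + 2 * CARD('n)"] by blast
  define p where "p = (\<lambda>\<xi>::real^'n. inverse ((1 + norm \<xi>) ^ (2 * CARD('n))))"
  have p0: "p \<xi> > 0" for \<xi>
    unfolding p_def by (intro positive_imp_inverse_positive zero_less_power) (auto intro: add_pos_nonneg)
  have p1: "p \<xi> \<le> 1" for \<xi>
    unfolding p_def by (intro inverse_le_1_iff[THEN iffD2]) (auto intro!: one_le_power)
  have pL: "L2 (\<lambda>\<xi>. of_real (p \<xi>))"
  proof (rule L2_bound)
    show "integrable lborel p" unfolding p_def by (rule integrable_poly_decay)
    show "(cmod (of_real (p \<xi>)))\<^sup>2 \<le> p \<xi>" for \<xi>
      using p0[of \<xi>] p1[of \<xi>] by (simp add: power2_eq_square mult_left_le)
  qed (simp add: p_def)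
  have i: "integrable lborel (\<lambda>\<xi>. cmod (weighted b s F \<xi> * of_real (p \<xi>)))"
    by (intro integrable_norm L2_mult_integrable F pL)
  define W where "W = (LINT \<xi>|lborel. cmod (weighted b s F \<xi> * of_real (p \<xi>)))"
  have W: "W \<ge> 0" unfolding W_def by (intro Bochner_Integration.integral_nonneg) auto
  define c where "c = inverse ((2 * pi) ^ CARD('n))"
  have c: "c > 0" by (simp add: c_def)
  have "cmod (LINT \<xi>|lborel. F \<xi> * inv_fourier \<phi> \<xi>) \<le> (W * (D * (C * c))) * schwartz_seminorm N \<phi>" if \<phi>: "\<phi> \<in> schwartz_functions" for \<phi>
  proof -
    have b: "norm (F \<xi> * inv_fourier \<phi> \<xi>) \<le> cmod (weighted b s F \<xi> * of_real (p \<xi>)) * (D * (C * c) * schwartz_seminorm N \<phi>)" for \<xi>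
    proof -
      let ?q = "(1 + norm \<xi>) ^ l"
      have q: "?q > 0" by (intro zero_less_power) (auto intro: add_pos_nonneg)
      have qq: "(1 + norm \<xi>) ^ (l + 2 * CARD('n)) = ?q * inverse (p \<xi>)"
        by (simp add: p_def power_add)
      have "cmod (inv_fourier \<phi> \<xi>) = cmod (fourier \<phi> (- \<xi>)) * c"
        unfolding inv_fourier_eq norm_divide norm_of_real c_def by (simp add: divide_inverse)
      moreover have "?q * inverse (p \<xi>) * cmod (fourier \<phi> (- \<xi>)) \<le> C * schwartz_seminorm N \<phi>"
        using N[OF \<phi>, of "- \<xi>"] unfolding qq[symmetric] by simp
      then have "cmod (fourier \<phi> (- \<xi>)) * ?q \<le> C * schwartz_seminorm N \<phi> * p \<xi>"
        using p0[of \<xi>] by (simp add: field_simps)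
      ultimately have 1: "cmod (inv_fourier \<phi> \<xi>) * ?q \<le> C * schwartz_seminorm N \<phi> * p \<xi> * c"
        using c by (simp add: mult_right_mono mult.commute mult.left_commute)
      have "norm (F \<xi> * inv_fourier \<phi> \<xi>) = cmod (weighted b s F \<xi>) * (cmod (of_real (bracket b (- s) \<xi>)) * cmod (inv_fourier \<phi> \<xi>))"
        using bracket_pos[of b s \<xi>] by (simp add: weighted_def norm_mult bracket_neg abs_of_pos norm_inverse)
      also have "\<dots> \<le> cmod (weighted b s F \<xi>) * ((D * ?q) * cmod (inv_fourier \<phi> \<xi>))"
        by (intro mult_left_mono mult_right_mono D) auto
      also have "\<dots> = cmod (weighted b s F \<xi>) * (D * (cmod (inv_fourier \<phi> \<xi>) * ?q))" by simp
      also have "\<dots> \<le> cmod (weighted b s F \<xi>) * (D * (C * schwartz_seminorm N \<phi> * p \<xi> * c))"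
        by (intro mult_left_mono 1 D) auto
      also have "\<dots> = cmod (weighted b s F \<xi> * of_real (p \<xi>)) * (D * (C * c) * schwartz_seminorm N \<phi>)"
        using p0[of \<xi>] by (simp add: norm_mult abs_of_pos)
      finally show ?thesis .
    qed
    have i2: "integrable lborel (\<lambda>\<xi>. cmod (weighted b s F \<xi> * of_real (p \<xi>)) * (D * (C * c) * schwartz_seminorm N \<phi>))"
      by (intro integrable_mult_left i)
    have v: "L2 (weighted b (- s) (inv_fourier \<phi>))" by (intro schwartz_L2 schwartz_weighted inv_fourier_schwartz \<phi>)
    have "cmod (LINT \<xi>|lborel. F \<xi> * inv_fourier \<phi> \<xi>) \<le> (LINT \<xi>|lborel. cmod (weighted b s F \<xi> * of_real (p \<xi>)) * (D * (C * c) * schwartz_seminorm N \<phi>))"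
      by (rule Bochner_Integration.integral_norm_bound_integral[OF weighted_mult_integrable[OF F v] i2]) (rule b)
    also have "\<dots> = (W * (D * (C * c))) * schwartz_seminorm N \<phi>" by (simp add: W_def)
    finally show ?thesis .
  qed
  moreover have "W * (D * (C * c)) \<ge> 0" using W D C c by simp
  ultimately show ?thesis by blast
qed

lemma inv_fourier_add:
  fixes f g :: "real^'n::finite \<Rightarrow> complex"
  assumes "f \<in> schwartz_functions" "g \<in> schwartz_functions"
  shows "inv_fourier (\<lambda>x. f x + g x) \<xi> = inv_fourier f \<xi> + inv_fourier g \<xi>"
  using fourier_add[OF schwartz_integrable(1)[OF assms(1)] schwartz_integrable(1)[OF assms(2)]]
  by (simp add: inv_fourier_eq add_divide_distrib)

lemma inv_fourier_cmult: "inv_fourier (\<lambda>x. c * f x) \<xi> = c * inv_fourier f \<xi>"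
  by (simp add: inv_fourier_eq fourier_cmult)

lemma fourier_rep_integrable:
  fixes F :: "real^'n::finite \<Rightarrow> complex"
  assumes "L2 (weighted b s F)" "\<phi> \<in> schwartz_functions"
  shows "integrable lborel (\<lambda>\<xi>. F \<xi> * inv_fourier \<phi> \<xi>)"
  by (intro weighted_mult_integrable[OF assms(1)] schwartz_L2 schwartz_weighted inv_fourier_schwartz assms)

lemma fourier_rep_tempered:
  fixes u :: "'n::finite functional"
  assumes r: "fourier_rep b s u F"
  shows "u \<in> tempered_distributions"
proof -
  note i = fourier_rep_integrable[OF fourier_repD(2)[OF r]]
  have "linear_functional_on schwartz_functions u"
    unfolding linear_functional_on_def
  proof (intro conjI ballI allI)
    fix \<phi> \<psi> :: "real^'n \<Rightarrow> complex" assume S: "\<phi> \<in> schwartz_functions" "\<psi> \<in> schwartz_functions"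
    show "u (\<lambda>x. \<phi> x + \<psi> x) = u \<phi> + u \<psi>"
      using fourier_repD(3)[OF r] S schwartz_add[OF S] i[OF S(1)] i[OF S(2)]
      by (simp add: inv_fourier_add distrib_left)
  next
    fix c and \<phi> :: "real^'n \<Rightarrow> complex" assume S: "\<phi> \<in> schwartz_functions"
    show "u (\<lambda>x. c * \<phi> x) = c * u \<phi>"
      using fourier_repD(3)[OF r] S schwartz_cmult[OF S, of c]
      by (simp add: inv_fourier_cmult mult.left_commute)
  qed
  moreover have "\<exists>C N. \<forall>\<phi>\<in>schwartz_functions. cmod (u \<phi>) \<le> C * schwartz_seminorm N \<phi>"
    using fourier_density_continuous[OF fourier_repD(1,2)[OF r]] fourier_repD(3)[OF r] by fastforce
  ultimately show ?thesis by (simp add: tempered_distributions_def schwartz_seminorm_def)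
qed

lemma fourier_rep_sobolev:
  fixes u :: "'n::finite functional"
  assumes r: "fourier_rep b s u F"
  shows "u \<in> sobolev_space b s" "sobolev_norm b s u = sqrt (sqnorm (weighted b s F) / (2 * pi) ^ CARD('n))"
proof -
  obtain g where g: "fourier_pair g (weighted b s F)" "\<forall>\<phi>\<in>schwartz_functions. bracket_D b s u \<phi> = (LINT x|lborel. g x * \<phi> x)"
    using fourier_rep_density[OF r] by blast
  have L: "L2 g" using g by (simp add: fourier_pair_def)
  show "u \<in> sobolev_space b s"
    using fourier_rep_tempered[OF r] L g(2) by (auto simp: sobolev_space_def in_L2_iff)
  have "sobolev_norm b s u = sqrt (sqnorm g)"
    unfolding sobolev_norm_def by (rule L2_norm_eq[OF L g(2)])
  moreover have "sqnorm g = sqnorm (weighted b s F) / (2 * pi) ^ CARD('n)"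
    using fourier_pair_sqnorm[OF g(1)] by simp
  ultimately show "sobolev_norm b s u = sqrt (sqnorm (weighted b s F) / (2 * pi) ^ CARD('n))" by simp
qed

lemma fourier_rep_pairing:
  fixes f g :: "'n::finite functional"
  assumes f: "fourier_rep b s f F" and g: "fourier_rep b t g G" and st: "\<And>l. - s $ l \<le> t $ l"
  shows "sobolev_pairing b s f g = (LINT \<xi>|lborel. F \<xi> * G (- \<xi>)) / of_real ((2 * pi) ^ CARD('n))"
proof -
  have g': "fourier_rep b (- s) g G" by (rule fourier_rep_mono[OF g]) (simp add: st)
  obtain f1 where f1: "fourier_pair f1 (weighted b s F)" "\<forall>\<phi>\<in>schwartz_functions. bracket_D b s f \<phi> = (LINT x|lborel. f1 x * \<phi> x)"
    using fourier_rep_density[OF f] by blast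
  obtain g1 where g1: "fourier_pair g1 (weighted b (- s) G)" "\<forall>\<phi>\<in>schwartz_functions. bracket_D b (- s) g \<phi> = (LINT x|lborel. g1 x * \<phi> x)"
    using fourier_rep_density[OF g'] by blast
  have L: "L2 f1" "L2 g1" using f1 g1 by (auto simp: fourier_pair_def)
  note df = L2_density_AE[OF L(1) f1(2)] and dg = L2_density_AE[OF L(2) g1(2)]
  have "sobolev_pairing b s f g = (LINT x|lborel. f1 x * g1 x)"
    unfolding sobolev_pairing_def
  proof (rule lint_lebesgue_AE)
    show "(\<lambda>x. L2_density (bracket_D b s f) x * L2_density (bracket_D b (- s) g) x) \<in> borel_measurable lebesgue"
      by (intro borel_measurable_times df dg)
    show "(\<lambda>x. f1 x * g1 x) \<in> borel_measurable borel" by (intro borel_measurable_times L2_borel L)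
    show "AE x in lborel. L2_density (bracket_D b s f) x * L2_density (bracket_D b (- s) g) x = f1 x * g1 x"
      using df(2) dg(2) by eventually_elim simp
  qed
  also have "\<dots> = (LINT \<xi>|lborel. weighted b s F \<xi> * weighted b (- s) G (- \<xi>)) / of_real ((2 * pi) ^ CARD('n))"
    unfolding fourier_pair_parseval[OF f1(1) g1(1)] by simp
  also have "(\<lambda>\<xi>. weighted b s F \<xi> * weighted b (- s) G (- \<xi>)) = (\<lambda>\<xi>. F \<xi> * G (- \<xi>))"
    by (simp add: weighted_def bracket_uminus bracket_neg fun_eq_iff field_simps)
  finally show ?thesis .
qed

section \<open>The convolution estimate\<close>

text \<open>The elementary inequality behind the estimate, for the three brackets \<open>X = \<langle>\<xi>\<rangle>\<close>, \<open>Y = \<langle>\<xi> - \<eta>\<rangle>\<close>,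
  \<open>Z = \<langle>\<eta>\<rangle>\<close> in the region \<open>Y \<le> Z\<close>. If \<open>\<sigma> \<ge> 0\<close> then \<open>X \<le> 2Z\<close> bounds \<open>X\<^sup>\<sigma>\<close>; if \<open>\<sigma> < 0\<close> then \<open>X \<ge> Z/(2Y)\<close> does. In
  both cases \<open>Z\<^sup>\<sigma>\<^sup>-\<^sup>t\<close>, whose exponent is not positive, is replaced by \<open>Y\<^sup>\<sigma>\<^sup>-\<^sup>t\<close>.\<close>

lemma kernel_scalar:
  fixes X Y Z :: real
  assumes X: "X \<ge> 1" and Y: "Y \<ge> 1" and Z: "Z \<ge> 1" and XYZ: "X \<le> Y + Z" and ZXY: "Z \<le> 2 * X * Y" and YZ: "Y \<le> Z"
    and \<sigma>: "\<sigma> \<le> t" "\<sigma> \<le> s + t - \<delta>" and \<delta>: "\<delta> \<le> s + t"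
  shows "X powr \<sigma> * Y powr (- s) * Z powr (- t) \<le> 2 powr \<bar>\<sigma>\<bar> * Y powr (- \<delta>)"
proof -
  have ZY: "Z powr (\<sigma> - t) \<le> Y powr (\<sigma> - t)" using Y YZ \<sigma> by (intro powr_mono2') auto
  show ?thesis
  proof (cases "\<sigma> \<ge> 0")
    case True
    have "X powr \<sigma> \<le> (2 * Z) powr \<sigma>" using True X XYZ YZ by (intro powr_mono2) auto
    also have "\<dots> = 2 powr \<sigma> * Z powr \<sigma>" using Z by (simp add: powr_mult)
    finally have "X powr \<sigma> * Y powr (- s) * Z powr (- t) \<le> (2 powr \<sigma> * Z powr \<sigma>) * Y powr (- s) * Z powr (- t)"
      by (intro mult_right_mono) auto
    also have "\<dots> = 2 powr \<sigma> * (Z powr (\<sigma> - t) * Y powr (- s))"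
      using Z by (simp add: powr_diff powr_minus field_simps)
    also have "\<dots> \<le> 2 powr \<sigma> * (Y powr (\<sigma> - t) * Y powr (- s))"
      by (intro mult_left_mono mult_right_mono ZY) auto
    also have "Y powr (\<sigma> - t) * Y powr (- s) = Y powr (\<sigma> - t - s)" using Y by (simp flip: powr_add)
    also have "2 powr \<sigma> * Y powr (\<sigma> - t - s) \<le> 2 powr \<sigma> * Y powr (- \<delta>)"
      using Y \<sigma> by (intro mult_left_mono powr_mono) auto
    finally show ?thesis using True by simp
  next
    case False
    have "Z / (2 * Y) \<le> X" using ZXY Y by (simp add: divide_le_eq mult_ac)
    then have "X powr \<sigma> \<le> (Z / (2 * Y)) powr \<sigma>" using False Z Y by (intro powr_mono2') auto
    also have "\<dots> = 2 powr (- \<sigma>) * Z powr \<sigma> * Y powr (- \<sigma>)"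
      using Z Y by (simp add: powr_divide powr_mult powr_minus field_simps)
    finally have "X powr \<sigma> * Y powr (- s) * Z powr (- t) \<le> (2 powr (- \<sigma>) * Z powr \<sigma> * Y powr (- \<sigma>)) * Y powr (- s) * Z powr (- t)"
      by (intro mult_right_mono) auto
    also have "\<dots> = 2 powr (- \<sigma>) * (Z powr (\<sigma> - t) * (Y powr (- \<sigma>) * Y powr (- s)))"
      using Z by (simp add: powr_diff powr_minus field_simps)
    also have "\<dots> \<le> 2 powr (- \<sigma>) * (Y powr (\<sigma> - t) * (Y powr (- \<sigma>) * Y powr (- s)))"
      by (intro mult_left_mono mult_right_mono ZY) auto
    also have "Y powr (\<sigma> - t) * (Y powr (- \<sigma>) * Y powr (- s)) = Y powr (- (s + t))"
      unfolding powr_add[symmetric] by (rule arg_cong) simp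
    also have "2 powr (- \<sigma>) * Y powr (- (s + t)) \<le> 2 powr (- \<sigma>) * Y powr (- \<delta>)"
      using Y \<delta> by (intro mult_left_mono powr_mono) auto
    finally show ?thesis using False by simp
  qed
qed

definition block_bracket :: "('n::finite \<Rightarrow> 'j::finite) \<Rightarrow> 'j \<Rightarrow> real^'n \<Rightarrow> real" where
  "block_bracket b l \<xi> = sqrt (1 + (block_norm b l \<xi>)\<^sup>2)"

lemma block_bracket_ge_1: "block_bracket b l \<xi> \<ge> 1"
  by (simp add: block_bracket_def)

lemma block_bracket_sq: "(block_bracket b l \<xi>)\<^sup>2 = 1 + (block_norm b l \<xi>)\<^sup>2"
  by (simp add: block_bracket_def)

lemma block_bracket_powr: "block_bracket b l \<xi> powr a = (1 + (block_norm b l \<xi>)\<^sup>2) powr (a / 2)"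
proof -
  have "1 + (block_norm b l \<xi>)\<^sup>2 \<ge> 0" by simp
  then show ?thesis by (simp add: block_bracket_def powr_powr flip: powr_half_sqrt)
qed

lemma bracket_eq_prod: "bracket b s \<xi> = (\<Prod>l\<in>UNIV. block_bracket b l \<xi> powr (s $ l))"
  by (simp add: bracket_def block_bracket_powr)

lemma block_bracket_triangle: "block_bracket b l (\<xi> + \<eta>) \<le> block_bracket b l \<xi> + block_bracket b l \<eta>"
proof (rule power2_le_imp_le)
  have "block_norm b l \<xi> \<le> block_bracket b l \<xi>" "block_norm b l \<eta> \<le> block_bracket b l \<eta>"
    unfolding block_bracket_def by (auto intro: real_le_rsqrt)
  then have "block_norm b l \<xi> * block_norm b l \<eta> \<le> block_bracket b l \<xi> * block_bracket b l \<eta>"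
    by (intro mult_mono) (use block_norm_nonneg block_bracket_ge_1[of b l \<xi>] in auto)
  moreover have "(block_norm b l (\<xi> + \<eta>))\<^sup>2 \<le> (block_norm b l \<xi> + block_norm b l \<eta>)\<^sup>2"
    by (intro power_mono block_norm_triangle block_norm_nonneg)
  ultimately show "(block_bracket b l (\<xi> + \<eta>))\<^sup>2 \<le> (block_bracket b l \<xi> + block_bracket b l \<eta>)\<^sup>2"
    unfolding block_bracket_sq power2_sum by linarith
  show "0 \<le> block_bracket b l \<xi> + block_bracket b l \<eta>" using block_bracket_ge_1[of b l \<xi>] block_bracket_ge_1[of b l \<eta>] by linarith
qed

text \<open>Peetre's inequality, from \<open>A + B \<le> 2AB\<close> for \<open>A, B \<ge> 1\<close>.\<close>

lemma block_bracket_peetre: "block_bracket b l (\<xi> + \<eta>) \<le> 2 * block_bracket b l \<xi> * block_bracket b l \<eta>"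
proof -
  have "0 \<le> (block_bracket b l \<xi> - 1) * (block_bracket b l \<eta> - 1)"
    using block_bracket_ge_1[of b l \<xi>] block_bracket_ge_1[of b l \<eta>] by (intro mult_nonneg_nonneg) auto
  moreover have "1 * 1 \<le> block_bracket b l \<xi> * block_bracket b l \<eta>"
    using block_bracket_ge_1[of b l \<xi>] block_bracket_ge_1[of b l \<eta>] by (intro mult_mono) auto
  ultimately have "block_bracket b l \<xi> + block_bracket b l \<eta> \<le> 2 * block_bracket b l \<xi> * block_bracket b l \<eta>"
    by (simp add: algebra_simps)
  then show ?thesis using block_bracket_triangle[of b l \<xi> \<eta>] by linarith
qed

lemma block_bracket_uminus: "block_bracket b l (- \<xi>) = block_bracket b l \<xi>"
  by (simp add: block_bracket_def block_norm_uminus)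

text \<open>The kernel is symmetric under the exchange of \<open>(\<xi> - \<eta>, s)\<close> and \<open>(\<eta>, t)\<close>, so that the elementary inequality
  covers both regions.\<close>

lemma kernel_block:
  assumes \<sigma>: "\<sigma> \<le> s" "\<sigma> \<le> t" "\<sigma> \<le> s + t - \<delta>" and \<delta>: "\<delta> \<le> s + t"
  shows "(block_bracket b l \<xi> powr \<sigma> * block_bracket b l (\<xi> - \<eta>) powr (- s) * block_bracket b l \<eta> powr (- t))\<^sup>2
    \<le> 4 powr \<bar>\<sigma>\<bar> * (block_bracket b l (\<xi> - \<eta>) powr (- (2 * \<delta>)) + block_bracket b l \<eta> powr (- (2 * \<delta>)))"
proof -
  let ?X = "block_bracket b l \<xi>" and ?Y = "block_bracket b l (\<xi> - \<eta>)" and ?Z = "block_bracket b l \<eta>"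
  have 1: "?X \<le> ?Y + ?Z" using block_bracket_triangle[of b l "\<xi> - \<eta>" \<eta>] by simp
  have 2: "?Z \<le> 2 * ?X * ?Y" using block_bracket_peetre[of b l \<xi> "- (\<xi> - \<eta>)"] unfolding block_bracket_uminus by simp
  have 3: "?Y \<le> 2 * ?X * ?Z" using block_bracket_peetre[of b l \<xi> "- \<eta>"] unfolding block_bracket_uminus by simp
  have sq: "(2 powr \<bar>\<sigma>\<bar> * W powr (- \<delta>))\<^sup>2 = 4 powr \<bar>\<sigma>\<bar> * W powr (- (2 * \<delta>))" if "W \<ge> 1" for W :: real
  proof -
    have "(2 powr \<bar>\<sigma>\<bar>)\<^sup>2 = (2 powr \<bar>\<sigma>\<bar> * 2 powr \<bar>\<sigma>\<bar> :: real)" by (rule power2_eq_square)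
    also have "\<dots> = 4 powr \<bar>\<sigma>\<bar>" by (subst powr_mult[symmetric]) auto
    finally have "(2 powr \<bar>\<sigma>\<bar>)\<^sup>2 = (4 powr \<bar>\<sigma>\<bar> :: real)" .
    moreover have "(W powr (- \<delta>))\<^sup>2 = W powr (- (2 * \<delta>))"
      using that by (simp add: power2_eq_square flip: powr_add)
    ultimately show ?thesis by (simp add: power_mult_distrib)
  qed
  have p: "0 \<le> ?X powr \<sigma> * ?Y powr (- s) * ?Z powr (- t)" by simp
  show ?thesis
  proof (cases "?Y \<le> ?Z")
    case True
    have "?X powr \<sigma> * ?Y powr (- s) * ?Z powr (- t) \<le> 2 powr \<bar>\<sigma>\<bar> * ?Y powr (- \<delta>)"
      by (rule kernel_scalar[OF block_bracket_ge_1 block_bracket_ge_1 block_bracket_ge_1 1 2 True]) (use assms in auto)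
    then have "(?X powr \<sigma> * ?Y powr (- s) * ?Z powr (- t))\<^sup>2 \<le> 4 powr \<bar>\<sigma>\<bar> * ?Y powr (- (2 * \<delta>))"
      unfolding sq[OF block_bracket_ge_1, symmetric] using p by (rule power_mono)
    then show ?thesis by (rule order_trans) (intro mult_left_mono, auto)
  next
    case False
    have "?X powr \<sigma> * ?Z powr (- t) * ?Y powr (- s) \<le> 2 powr \<bar>\<sigma>\<bar> * ?Z powr (- \<delta>)"
      by (rule kernel_scalar[OF block_bracket_ge_1 block_bracket_ge_1 block_bracket_ge_1 _ 3]) (use assms False 1 in auto)
    then have "?X powr \<sigma> * ?Y powr (- s) * ?Z powr (- t) \<le> 2 powr \<bar>\<sigma>\<bar> * ?Z powr (- \<delta>)"
      by (simp only: mult_ac)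
    then have "(?X powr \<sigma> * ?Y powr (- s) * ?Z powr (- t))\<^sup>2 \<le> 4 powr \<bar>\<sigma>\<bar> * ?Z powr (- (2 * \<delta>))"
      unfolding sq[OF block_bracket_ge_1, symmetric] using p by (rule power_mono)
    then show ?thesis by (rule order_trans) (intro mult_left_mono, auto)
  qed
qed

text \<open>Distributes the decay in a block evenly over its coordinates. The condition \<open>\<delta> > n\<^sub>l/2\<close>, which
  makes \<open>\<langle>\<xi>\<^sub>l\<rangle>\<^sup>-\<^sup>2\<^sup>\<delta>\<close> integrable, becomes an exponent greater than \<open>1/2\<close> of \<open>1 + \<xi>\<^sub>i\<^sup>2\<close> for each coordinate.\<close>

lemma block_bracket_le_prod:
  assumes "\<delta> \<ge> 0"
  shows "block_bracket b l v powr (- (2 * \<delta>)) \<le> (\<Prod>i | b i = l. (1 + (v $ i)\<^sup>2) powr (- (\<delta> / block_dim b l)))"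
proof (cases "block_dim b l = 0")
  case True
  then have e: "{i. b i = l} = {}" by (simp add: block_dim_def)
  have "block_bracket b l v powr (- (2 * \<delta>)) \<le> block_bracket b l v powr 0"
    using block_bracket_ge_1 assms by (intro powr_mono) auto
  also have "\<dots> = 1" using block_bracket_ge_1[of b l v] by simp
  finally show ?thesis by (simp only: e prod.empty)
next
  case False
  let ?N = "1 + (block_norm b l v)\<^sup>2" and ?d = "real (block_dim b l)"
  have N: "?N > 0" by (simp add: add_pos_nonneg)
  have "block_bracket b l v powr (- (2 * \<delta>)) = ?N powr (- \<delta>)" by (simp add: block_bracket_powr)
  also have "\<dots> = (?N powr (- (\<delta> / ?d))) powr ?d" using False by (simp add: powr_powr)
  also have "\<dots> = (?N powr (- (\<delta> / ?d))) ^ block_dim b l"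
    using N by (subst powr_realpow) auto
  also have "\<dots> = (\<Prod>i | b i = l. ?N powr (- (\<delta> / ?d)))" by (simp add: block_dim_def)
  also have "\<dots> \<le> (\<Prod>i | b i = l. (1 + (v $ i)\<^sup>2) powr (- (\<delta> / block_dim b l)))"
  proof (intro prod_mono conjI)
    fix i assume "i \<in> {i. b i = l}"
    then have "(v $ i)\<^sup>2 \<le> (block_norm b l v)\<^sup>2" unfolding block_norm_sq by (intro member_le_sum) auto
    then show "?N powr (- (\<delta> / ?d)) \<le> (1 + (v $ i)\<^sup>2) powr (- (\<delta> / ?d))"
      using assms by (intro powr_mono2') (auto simp: add_pos_nonneg)
  qed auto
  finally show ?thesis .
qed

text \<open>The exponents for which convolution maps \<open>\<langle>\<langle>\<xi>\<rangle>\<rangle>\<^sup>-\<^sup>sL\<^sup>2 \<times> \<langle>\<langle>\<xi>\<rangle>\<rangle>\<^sup>-\<^sup>tL\<^sup>2\<close> to \<open>\<langle>\<langle>\<xi>\<rangle>\<rangle>\<^sup>-\<^sup>\<sigma>L\<^sup>2\<close>. The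
  auxiliary exponent \<open>\<delta>\<close> corresponds to \<open>n\<^sub>l/2 + \<epsilon>\<^sub>l\<close>.\<close>

definition convolution_exponents :: "('n::finite \<Rightarrow> 'j::finite) \<Rightarrow> real^'j \<Rightarrow> real^'j \<Rightarrow> real^'j \<Rightarrow> real^'j \<Rightarrow> bool" where
  "convolution_exponents b s t \<sigma> \<delta> \<longleftrightarrow> (\<forall>l. block_dim b l / 2 < \<delta> $ l \<and> \<delta> $ l \<le> s $ l + t $ l \<and>
     \<sigma> $ l \<le> s $ l \<and> \<sigma> $ l \<le> t $ l \<and> \<sigma> $ l \<le> s $ l + t $ l - \<delta> $ l)"

text \<open>The kernel is a product over the blocks. Each squared factor is bounded by a sum of a function of
  \<open>\<xi>\<^sub>l - \<eta>\<^sub>l\<close> and a function of \<open>\<eta>\<^sub>l\<close>. Expanding the product over all sets \<open>I\<close> of blocks gives products of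
  functions of single coordinates, of \<open>\<xi> - \<eta>\<close> in the blocks of \<open>I\<close> and of \<open>\<eta>\<close> in the others, whose integrals
  do not depend on \<open>\<xi>\<close>.\<close>

lemma kernel_integral_bound:
  fixes b :: "'n::finite \<Rightarrow> 'j::finite"
  assumes e: "convolution_exponents b s t \<sigma> \<delta>"
  shows "\<exists>C\<ge>0. \<forall>\<xi>. (\<integral>\<^sup>+\<eta>. ennreal ((bracket b \<sigma> \<xi> * bracket b (- s) (\<xi> - \<eta>) * bracket b (- t) \<eta>)\<^sup>2) \<partial>lborel) \<le> ennreal C"
proof -
  have eD: "block_dim b l / 2 < \<delta> $ l" "\<delta> $ l \<le> s $ l + t $ l" "\<sigma> $ l \<le> s $ l" "\<sigma> $ l \<le> t $ l" "\<sigma> $ l \<le> s $ l + t $ l - \<delta> $ l" for l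
    using e by (auto simp: convolution_exponents_def)
  have \<delta>0: "\<delta> $ l \<ge> 0" for l
  proof -
    have "0 \<le> real (block_dim b l) / 2" by simp
    then show ?thesis using eD(1)[of l] by linarith
  qed
  define \<beta> where "\<beta> = (\<lambda>i. \<delta> $ (b i) / block_dim b (b i))"
  have \<beta>: "\<beta> i > 1 / 2" for i
  proof -
    have "block_dim b (b i) > 0" by (auto simp: block_dim_def card_gt_0_iff)
    then show ?thesis using eD(1)[of "b i"] by (simp add: \<beta>_def field_simps)
  qed
  define w where "w = (\<lambda>i (x::real). (1 + x\<^sup>2) powr (- \<beta> i))"
  have w: "integrable lborel (w i)" for i unfolding w_def by (rule integrable_japanese_1d[OF \<beta>])
  have w0: "w i x \<ge> 0" for i x by (simp add: w_def)
  have [measurable]: "w i \<in> borel_measurable borel" for i by (simp add: w_def)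
  define K where "K = (\<Prod>l\<in>UNIV. 4 powr \<bar>\<sigma> $ l\<bar>)"
  have K: "K \<ge> 0" unfolding K_def by (intro prod_nonneg) auto
  \<comment> \<open>The term of the expansion that belongs to the set \<open>I\<close> of blocks.\<close>
  define P where "P = (\<lambda>I \<xi> (\<eta>::real^'n). \<Prod>i\<in>UNIV. w i (if b i \<in> I then \<xi> $ i - \<eta> $ i else \<eta> $ i))"
  have P0: "P I \<xi> \<eta> \<ge> 0" for I \<xi> \<eta> unfolding P_def by (intro prod_nonneg) (auto simp: w0)
  define J where "J = (\<Prod>i\<in>(UNIV::'n set). LINT x|lborel. w i x)"
  have f: "integrable lborel (\<lambda>x. w i (if b i \<in> I then \<xi> $ i - x else x))"
     "(LINT x|lborel. w i (if b i \<in> I then \<xi> $ i - x else x)) = (LINT x|lborel. w i x)" for i I and \<xi> :: "real^'n"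
    using w integral_reflect[of "w i" "\<xi> $ i"] by (cases "b i \<in> I"; simp)+
  have Pi: "integrable lborel (P I \<xi>)" and PJ: "(LINT \<eta>|lborel. P I \<xi> \<eta>) = J" for I \<xi>
    using integral_lborel_prod[of "\<lambda>i x. w i (if b i \<in> I then \<xi> $ i - x else x)", OF f(1)] unfolding P_def J_def f(2) by auto
  have bound: "(bracket b \<sigma> \<xi> * bracket b (- s) (\<xi> - \<eta>) * bracket b (- t) \<eta>)\<^sup>2 \<le> K * (\<Sum>I\<in>Pow UNIV. P I \<xi> \<eta>)" for \<xi> \<eta>
  proof -
    have "(bracket b \<sigma> \<xi> * bracket b (- s) (\<xi> - \<eta>) * bracket b (- t) \<eta>)\<^sup>2 =
       (\<Prod>l\<in>UNIV. (block_bracket b l \<xi> powr (\<sigma> $ l) * block_bracket b l (\<xi> - \<eta>) powr (- s $ l) * block_bracket b l \<eta> powr (- t $ l))\<^sup>2)"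
      by (simp only: bracket_eq_prod prod.distrib[symmetric] prod_power_distrib vector_uminus_component)
    also have "\<dots> \<le> (\<Prod>l\<in>UNIV. 4 powr \<bar>\<sigma> $ l\<bar> * (block_bracket b l (\<xi> - \<eta>) powr (- (2 * \<delta> $ l)) + block_bracket b l \<eta> powr (- (2 * \<delta> $ l))))"
      by (intro prod_mono conjI kernel_block eD) auto
    also have "\<dots> = K * (\<Prod>l\<in>UNIV. block_bracket b l (\<xi> - \<eta>) powr (- (2 * \<delta> $ l)) + block_bracket b l \<eta> powr (- (2 * \<delta> $ l)))"
      by (simp add: K_def prod.distrib)
    also have "(\<Prod>l\<in>UNIV. block_bracket b l (\<xi> - \<eta>) powr (- (2 * \<delta> $ l)) + block_bracket b l \<eta> powr (- (2 * \<delta> $ l))) =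
       (\<Sum>I\<in>Pow UNIV. (\<Prod>l\<in>I. block_bracket b l (\<xi> - \<eta>) powr (- (2 * \<delta> $ l))) * (\<Prod>l\<in>UNIV - I. block_bracket b l \<eta> powr (- (2 * \<delta> $ l))))"
      by (rule prod_add) simp
    also have "\<dots> \<le> (\<Sum>I\<in>Pow UNIV. P I \<xi> \<eta>)"
    proof (rule sum_mono)
      fix I :: "'j set"
      have "(\<Prod>l\<in>I. block_bracket b l (\<xi> - \<eta>) powr (- (2 * \<delta> $ l))) * (\<Prod>l\<in>UNIV - I. block_bracket b l \<eta> powr (- (2 * \<delta> $ l))) =
         (\<Prod>l\<in>UNIV. if l \<in> I then block_bracket b l (\<xi> - \<eta>) powr (- (2 * \<delta> $ l)) else block_bracket b l \<eta> powr (- (2 * \<delta> $ l)))"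
        by (simp add: prod.If_cases Compl_eq_Diff_UNIV)
      also have "\<dots> \<le> (\<Prod>l\<in>UNIV. \<Prod>i | i \<in> UNIV \<and> b i = l. w i (if b i \<in> I then \<xi> $ i - \<eta> $ i else \<eta> $ i))"
      proof (intro prod_mono conjI)
        fix l
        show "(if l \<in> I then block_bracket b l (\<xi> - \<eta>) powr (- (2 * \<delta> $ l)) else block_bracket b l \<eta> powr (- (2 * \<delta> $ l)))
          \<le> (\<Prod>i | i \<in> UNIV \<and> b i = l. w i (if b i \<in> I then \<xi> $ i - \<eta> $ i else \<eta> $ i))"
        proof (cases "l \<in> I")
          case True
          then have "(\<Prod>i | i \<in> UNIV \<and> b i = l. w i (if b i \<in> I then \<xi> $ i - \<eta> $ i else \<eta> $ i)) =
              (\<Prod>i | b i = l. (1 + ((\<xi> - \<eta>) $ i)\<^sup>2) powr (- (\<delta> $ l / block_dim b l)))"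
            by (intro prod.cong) (auto simp: w_def \<beta>_def)
          then show ?thesis using True block_bracket_le_prod[OF \<delta>0[of l], of b l "\<xi> - \<eta>"] by simp
        next
          case False
          then have "(\<Prod>i | i \<in> UNIV \<and> b i = l. w i (if b i \<in> I then \<xi> $ i - \<eta> $ i else \<eta> $ i)) =
              (\<Prod>i | b i = l. (1 + (\<eta> $ i)\<^sup>2) powr (- (\<delta> $ l / block_dim b l)))"
            by (intro prod.cong) (auto simp: w_def \<beta>_def)
          then show ?thesis using False block_bracket_le_prod[OF \<delta>0[of l], of b l \<eta>] by simp
        qed
      qed auto
      also have "\<dots> = P I \<xi> \<eta>"
        unfolding P_def by (rule prod.group) auto
      finally show "(\<Prod>l\<in>I. block_bracket b l (\<xi> - \<eta>) powr (- (2 * \<delta> $ l))) * (\<Prod>l\<in>UNIV - I. block_bracket b l \<eta> powr (- (2 * \<delta> $ l))) \<le> P I \<xi> \<eta>" .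
    qed
    finally show ?thesis using K by (simp add: mult_left_mono)
  qed
  define C where "C = K * (\<Sum>I\<in>Pow (UNIV::'j set). J)"
  have J: "J \<ge> 0" unfolding J_def by (intro prod_nonneg ballI Bochner_Integration.integral_nonneg w0)
  have "(\<integral>\<^sup>+\<eta>. ennreal ((bracket b \<sigma> \<xi> * bracket b (- s) (\<xi> - \<eta>) * bracket b (- t) \<eta>)\<^sup>2) \<partial>lborel) \<le> ennreal C" for \<xi>
  proof -
    have i: "integrable lborel (\<lambda>\<eta>. K * (\<Sum>I\<in>Pow UNIV. P I \<xi> \<eta>))"
      by (intro integrable_mult_right Bochner_Integration.integrable_sum Pi)
    have "(\<integral>\<^sup>+\<eta>. ennreal ((bracket b \<sigma> \<xi> * bracket b (- s) (\<xi> - \<eta>) * bracket b (- t) \<eta>)\<^sup>2) \<partial>lborel) \<le>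
        (\<integral>\<^sup>+\<eta>. ennreal (K * (\<Sum>I\<in>Pow UNIV. P I \<xi> \<eta>)) \<partial>lborel)"
      by (intro nn_integral_mono ennreal_leI bound)
    also have "\<dots> = ennreal (LINT \<eta>|lborel. K * (\<Sum>I\<in>Pow UNIV. P I \<xi> \<eta>))"
      by (rule nn_integral_eq_integral[OF i]) (auto intro!: mult_nonneg_nonneg K sum_nonneg P0)
    also have "(LINT \<eta>|lborel. K * (\<Sum>I\<in>Pow UNIV. P I \<xi> \<eta>)) = C"
      unfolding C_def by (simp only: integral_mult_right_zero Bochner_Integration.integral_sum Pi PJ)
    finally show ?thesis .
  qed
  moreover have "C \<ge> 0" unfolding C_def by (intro mult_nonneg_nonneg K sum_nonneg J)
  ultimately show ?thesis by blast
qed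

definition convolution :: "(real^'n::finite \<Rightarrow> complex) \<Rightarrow> (real^'n \<Rightarrow> complex) \<Rightarrow> real^'n \<Rightarrow> complex" where
  "convolution F G \<xi> = (LINT \<eta>|lborel. F (\<xi> - \<eta>) * G \<eta>)"

text \<open>The convolution of the moduli, with values in the extended reals, so that its estimate yields the
  absolute convergence of the convolution almost everywhere.\<close>

definition abs_convolution :: "(real^'n::finite \<Rightarrow> complex) \<Rightarrow> (real^'n \<Rightarrow> complex) \<Rightarrow> real^'n \<Rightarrow> ennreal" where
  "abs_convolution F G \<xi> = (\<integral>\<^sup>+\<eta>. ennreal (cmod (F (\<xi> - \<eta>) * G \<eta>)) \<partial>lborel)"

lemma abs_convolution_borel [measurable (raw)]:
  assumes [measurable]: "F \<in> borel_measurable borel" "G \<in> borel_measurable borel"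
  shows "abs_convolution F G \<in> borel_measurable borel"
  unfolding abs_convolution_def by measurable

lemma convolution_borel [measurable (raw)]:
  assumes [measurable]: "F \<in> borel_measurable borel" "G \<in> borel_measurable borel"
  shows "convolution F G \<in> borel_measurable borel"
  unfolding convolution_def by measurable

lemma convolution_le_abs_convolution: "ennreal (cmod (convolution F G \<xi>)) \<le> abs_convolution F G \<xi>"
proof (cases "integrable lborel (\<lambda>\<eta>. F (\<xi> - \<eta>) * G \<eta>)")
  case True
  then show ?thesis unfolding convolution_def abs_convolution_def by (rule integral_norm_bound_ennreal)
qed (simp add: convolution_def not_integrable_integral_eq)

lemma weighted_borel: "F \<in> borel_measurable borel \<Longrightarrow> weighted b s F \<in> borel_measurable borel"
  unfolding weighted_def by measurable

text \<open>Cauchy-Schwarz in \<open>\<eta>\<close> separates the kernel from \<open>A(\<xi> - \<eta>)B(\<eta>)\<close>, where \<open>A\<close> and \<open>B\<close> are the weighted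
  moduli of \<open>F\<close> and \<open>G\<close>. The kernel contributes a constant, and \<open>A(\<xi> - \<eta>)\<^sup>2B(\<eta>)\<^sup>2\<close> is integrated by Tonelli's
  theorem.\<close>

lemma abs_convolution_bound:
  fixes b :: "'n::finite \<Rightarrow> 'j::finite"
  assumes e: "convolution_exponents b s t \<sigma> \<delta>"
  shows "\<exists>C\<ge>0. \<forall>F G. F \<in> borel_measurable borel \<longrightarrow> G \<in> borel_measurable borel \<longrightarrow> L2 (weighted b s F) \<longrightarrow> L2 (weighted b t G) \<longrightarrow>
     (\<integral>\<^sup>+\<xi>. (ennreal (bracket b \<sigma> \<xi>) * abs_convolution F G \<xi>)\<^sup>2 \<partial>lborel) \<le> ennreal (C * (sqnorm (weighted b s F) * sqnorm (weighted b t G)))"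
proof -
  obtain C where C: "C \<ge> 0" "\<And>\<xi>. (\<integral>\<^sup>+\<eta>. ennreal ((bracket b \<sigma> \<xi> * bracket b (- s) (\<xi> - \<eta>) * bracket b (- t) \<eta>)\<^sup>2) \<partial>lborel) \<le> ennreal C"
    using kernel_integral_bound[OF e] by blast
  have "(\<integral>\<^sup>+\<xi>. (ennreal (bracket b \<sigma> \<xi>) * abs_convolution F G \<xi>)\<^sup>2 \<partial>lborel) \<le> ennreal (C * (sqnorm (weighted b s F) * sqnorm (weighted b t G)))"
    if [measurable]: "F \<in> borel_measurable borel" "G \<in> borel_measurable borel" and L: "L2 (weighted b s F)" "L2 (weighted b t G)" for F G
  proof -
    define A where "A = (\<lambda>\<xi>. ennreal (cmod (weighted b s F \<xi>)))"
    define B where "B = (\<lambda>\<xi>. ennreal (cmod (weighted b t G \<xi>)))"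
    have [measurable]: "A \<in> borel_measurable borel" "B \<in> borel_measurable borel"
      using L2_borel[OF L(1)] L2_borel[OF L(2)] by (auto simp: A_def B_def)
    define k where "k = (\<lambda>\<xi> \<eta>. bracket b \<sigma> \<xi> * bracket b (- s) (\<xi> - \<eta>) * bracket b (- t) \<eta>)"
    have k0: "k \<xi> \<eta> \<ge> 0" for \<xi> \<eta> by (simp add: k_def bracket_nonneg)
    have [measurable]: "(\<lambda>\<eta>. k \<xi> \<eta>) \<in> borel_measurable borel" for \<xi> unfolding k_def by measurable
    have pt: "(ennreal (bracket b \<sigma> \<xi>) * abs_convolution F G \<xi>)\<^sup>2 \<le> ennreal C * (\<integral>\<^sup>+\<eta>. (A (\<xi> - \<eta>) * B \<eta>)\<^sup>2 \<partial>lborel)" for \<xi>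
    proof -
      have "ennreal (bracket b \<sigma> \<xi>) * abs_convolution F G \<xi> = (\<integral>\<^sup>+\<eta>. ennreal (bracket b \<sigma> \<xi>) * ennreal (cmod (F (\<xi> - \<eta>) * G \<eta>)) \<partial>lborel)"
        unfolding abs_convolution_def by (rule nn_integral_cmult[symmetric]) measurable
      also have "\<dots> = (\<integral>\<^sup>+\<eta>. ennreal (k \<xi> \<eta>) * (A (\<xi> - \<eta>) * B \<eta>) \<partial>lborel)"
      proof (intro nn_integral_cong)
        fix \<eta>
        have "bracket b \<sigma> \<xi> * cmod (F (\<xi> - \<eta>) * G \<eta>) = k \<xi> \<eta> * (cmod (weighted b s F (\<xi> - \<eta>)) * cmod (weighted b t G \<eta>))"
          by (simp add: k_def weighted_def norm_mult bracket_neg abs_of_nonneg bracket_nonneg field_simps)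
        then show "ennreal (bracket b \<sigma> \<xi>) * ennreal (cmod (F (\<xi> - \<eta>) * G \<eta>)) = ennreal (k \<xi> \<eta>) * (A (\<xi> - \<eta>) * B \<eta>)"
          by (simp only: A_def B_def ennreal_mult[symmetric] bracket_nonneg k0 norm_ge_zero mult_nonneg_nonneg)
      qed
      finally have "(ennreal (bracket b \<sigma> \<xi>) * abs_convolution F G \<xi>)\<^sup>2 \<le> (\<integral>\<^sup>+\<eta>. (ennreal (k \<xi> \<eta>))\<^sup>2 \<partial>lborel) * (\<integral>\<^sup>+\<eta>. (A (\<xi> - \<eta>) * B \<eta>)\<^sup>2 \<partial>lborel)"
        by (simp only:) (intro Cauchy_Schwarz_nn_integral; measurable)
      also have "\<dots> \<le> ennreal C * (\<integral>\<^sup>+\<eta>. (A (\<xi> - \<eta>) * B \<eta>)\<^sup>2 \<partial>lborel)"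
        using C(2)[of \<xi>] by (intro mult_right_mono) (simp_all add: k_def ennreal_power bracket_nonneg)
      finally show ?thesis .
    qed
    have "(\<integral>\<^sup>+\<xi>. (ennreal (bracket b \<sigma> \<xi>) * abs_convolution F G \<xi>)\<^sup>2 \<partial>lborel) \<le> (\<integral>\<^sup>+\<xi>. ennreal C * (\<integral>\<^sup>+\<eta>. (A (\<xi> - \<eta>) * B \<eta>)\<^sup>2 \<partial>lborel) \<partial>lborel)"
      by (intro nn_integral_mono pt)
    also have "\<dots> = ennreal C * (\<integral>\<^sup>+\<xi>. (\<integral>\<^sup>+\<eta>. (A (\<xi> - \<eta>) * B \<eta>)\<^sup>2 \<partial>lborel) \<partial>lborel)"
      by (rule nn_integral_cmult) measurable
    also have "(\<integral>\<^sup>+\<xi>. (\<integral>\<^sup>+\<eta>. (A (\<xi> - \<eta>) * B \<eta>)\<^sup>2 \<partial>lborel) \<partial>lborel) = (\<integral>\<^sup>+\<eta>. (\<integral>\<^sup>+\<xi>. (A (\<xi> - \<eta>) * B \<eta>)\<^sup>2 \<partial>lborel) \<partial>lborel)"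
      by (rule lborel_pair.Fubini'[symmetric]) measurable
    also have "\<dots> = (\<integral>\<^sup>+\<eta>. (\<integral>\<^sup>+\<xi>. (A \<xi>)\<^sup>2 \<partial>lborel) * (B \<eta>)\<^sup>2 \<partial>lborel)"
    proof (intro nn_integral_cong)
      fix \<eta>
      have "(\<integral>\<^sup>+\<xi>. (A (\<xi> - \<eta>))\<^sup>2 \<partial>lborel) = (\<integral>\<^sup>+\<xi>. (A \<xi>)\<^sup>2 \<partial>lborel)"
        using nn_integral_translate[of "\<lambda>\<xi>. (A \<xi>)\<^sup>2" "- \<eta>"] by simp
      then show "(\<integral>\<^sup>+\<xi>. (A (\<xi> - \<eta>) * B \<eta>)\<^sup>2 \<partial>lborel) = (\<integral>\<^sup>+\<xi>. (A \<xi>)\<^sup>2 \<partial>lborel) * (B \<eta>)\<^sup>2"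
        by (simp add: power_mult_distrib nn_integral_multc)
    qed
    also have "\<dots> = (\<integral>\<^sup>+\<xi>. (A \<xi>)\<^sup>2 \<partial>lborel) * (\<integral>\<^sup>+\<eta>. (B \<eta>)\<^sup>2 \<partial>lborel)"
      by (rule nn_integral_cmult) measurable
    also have "(\<integral>\<^sup>+\<xi>. (A \<xi>)\<^sup>2 \<partial>lborel) = ennreal (sqnorm (weighted b s F))"
      using sqnorm_ennreal[OF L(1)] by (simp add: A_def ennreal_power)
    also have "(\<integral>\<^sup>+\<xi>. (B \<xi>)\<^sup>2 \<partial>lborel) = ennreal (sqnorm (weighted b t G))"
      using sqnorm_ennreal[OF L(2)] by (simp add: B_def ennreal_power)
    finally show ?thesis using C(1) by (simp add: ennreal_mult sqnorm_nonneg)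
  qed
  then show ?thesis using C(1) by blast
qed

lemma convolution_bound:
  fixes b :: "'n::finite \<Rightarrow> 'j::finite"
  assumes e: "convolution_exponents b s t \<sigma> \<delta>"
  shows "\<exists>C\<ge>0. \<forall>F G. F \<in> borel_measurable borel \<longrightarrow> G \<in> borel_measurable borel \<longrightarrow> L2 (weighted b s F) \<longrightarrow> L2 (weighted b t G) \<longrightarrow>
     L2 (weighted b \<sigma> (convolution F G)) \<and> sqnorm (weighted b \<sigma> (convolution F G)) \<le> C * (sqnorm (weighted b s F) * sqnorm (weighted b t G))"
proof -
  obtain C where C: "C \<ge> 0" "\<And>F G. F \<in> borel_measurable borel \<Longrightarrow> G \<in> borel_measurable borel \<Longrightarrow> L2 (weighted b s F) \<Longrightarrow> L2 (weighted b t G) \<Longrightarrow>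
     (\<integral>\<^sup>+\<xi>. (ennreal (bracket b \<sigma> \<xi>) * abs_convolution F G \<xi>)\<^sup>2 \<partial>lborel) \<le> ennreal (C * (sqnorm (weighted b s F) * sqnorm (weighted b t G)))"
    using abs_convolution_bound[OF e] by blast
  have "L2 (weighted b \<sigma> (convolution F G)) \<and> sqnorm (weighted b \<sigma> (convolution F G)) \<le> C * (sqnorm (weighted b s F) * sqnorm (weighted b t G))"
    if F: "F \<in> borel_measurable borel" and G: "G \<in> borel_measurable borel" and L: "L2 (weighted b s F)" "L2 (weighted b t G)" for F G
  proof (rule L2_of_nn_integral)
    show "weighted b \<sigma> (convolution F G) \<in> borel_measurable borel" by (intro weighted_borel convolution_borel F G)
    have "(\<integral>\<^sup>+\<xi>. ennreal ((cmod (weighted b \<sigma> (convolution F G) \<xi>))\<^sup>2) \<partial>lborel) \<le> (\<integral>\<^sup>+\<xi>. (ennreal (bracket b \<sigma> \<xi>) * abs_convolution F G \<xi>)\<^sup>2 \<partial>lborel)"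
    proof (rule nn_integral_mono)
      fix \<xi>
      have "ennreal ((cmod (weighted b \<sigma> (convolution F G) \<xi>))\<^sup>2) = (ennreal (bracket b \<sigma> \<xi>) * ennreal (cmod (convolution F G \<xi>)))\<^sup>2"
        by (simp add: weighted_def norm_mult abs_of_nonneg bracket_nonneg ennreal_mult[symmetric] ennreal_power)
      also have "\<dots> \<le> (ennreal (bracket b \<sigma> \<xi>) * abs_convolution F G \<xi>)\<^sup>2"
        by (intro power_mono mult_left_mono convolution_le_abs_convolution) auto
      finally show "ennreal ((cmod (weighted b \<sigma> (convolution F G) \<xi>))\<^sup>2) \<le> (ennreal (bracket b \<sigma> \<xi>) * abs_convolution F G \<xi>)\<^sup>2" .
    qed
    also have "\<dots> \<le> ennreal (C * (sqnorm (weighted b s F) * sqnorm (weighted b t G)))" by (rule C(2)[OF F G L])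
    finally show "(\<integral>\<^sup>+\<xi>. ennreal ((cmod (weighted b \<sigma> (convolution F G) \<xi>))\<^sup>2) \<partial>lborel) \<le> ennreal (C * (sqnorm (weighted b s F) * sqnorm (weighted b t G)))" .
    show "0 \<le> C * (sqnorm (weighted b s F) * sqnorm (weighted b t G))" by (intro mult_nonneg_nonneg sqnorm_nonneg C(1))
  qed
  then show ?thesis using C(1) by blast
qed

text \<open>The integrability that Fubini's theorem requires whenever a convolution is tested or paired.\<close>

lemma convolution_integrable:
  fixes b :: "'n::finite \<Rightarrow> 'j::finite"
  assumes e: "convolution_exponents b s t \<sigma> \<delta>"
    and [measurable]: "F \<in> borel_measurable borel" "G \<in> borel_measurable borel" "H \<in> borel_measurable borel"
    and L: "L2 (weighted b s F)" "L2 (weighted b t G)" "L2 (weighted b (- \<sigma>) H)"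
  shows "integrable (lborel \<Otimes>\<^sub>M lborel) (\<lambda>(\<xi>, \<eta>). H \<xi> * (F (\<xi> - \<eta>) * G \<eta>))"
proof (rule integrableI_bounded)
  show "(\<lambda>(\<xi>, \<eta>). H \<xi> * (F (\<xi> - \<eta>) * G \<eta>)) \<in> borel_measurable (lborel \<Otimes>\<^sub>M lborel)" by measurable
  define h where "h = (\<lambda>\<xi>. ennreal (cmod (weighted b (- \<sigma>) H \<xi>)))"
  define m where "m = (\<lambda>\<xi>. ennreal (bracket b \<sigma> \<xi>) * abs_convolution F G \<xi>)"
  have [measurable]: "h \<in> borel_measurable borel" "m \<in> borel_measurable borel"
    using L2_borel[OF L(3)] by (auto simp: h_def m_def)
  obtain C where C: "(\<integral>\<^sup>+\<xi>. (m \<xi>)\<^sup>2 \<partial>lborel) \<le> ennreal C"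
    using abs_convolution_bound[OF e] assms(2,3) L(1,2) unfolding m_def by blast
  have "(\<integral>\<^sup>+x. ennreal (norm (case x of (\<xi>, \<eta>) \<Rightarrow> H \<xi> * (F (\<xi> - \<eta>) * G \<eta>))) \<partial>(lborel \<Otimes>\<^sub>M lborel)) =
     (\<integral>\<^sup>+\<xi>. (\<integral>\<^sup>+\<eta>. ennreal (norm (H \<xi> * (F (\<xi> - \<eta>) * G \<eta>))) \<partial>lborel) \<partial>lborel)"
    by (subst lborel.nn_integral_fst[symmetric]) simp_all
  also have "\<dots> = (\<integral>\<^sup>+\<xi>. h \<xi> * m \<xi> \<partial>lborel)"
  proof (intro nn_integral_cong)
    fix \<xi>
    have "(\<integral>\<^sup>+\<eta>. ennreal (norm (H \<xi> * (F (\<xi> - \<eta>) * G \<eta>))) \<partial>lborel) = ennreal (cmod (H \<xi>)) * abs_convolution F G \<xi>"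
      unfolding abs_convolution_def by (subst nn_integral_cmult[symmetric]) (auto simp: norm_mult ennreal_mult)
    also have "cmod (H \<xi>) = cmod (weighted b (- \<sigma>) H \<xi>) * bracket b \<sigma> \<xi>"
      by (simp add: weighted_def norm_mult bracket_neg norm_inverse abs_of_nonneg bracket_nonneg)
    finally show "(\<integral>\<^sup>+\<eta>. ennreal (norm (H \<xi> * (F (\<xi> - \<eta>) * G \<eta>))) \<partial>lborel) = h \<xi> * m \<xi>"
      by (simp add: h_def m_def ennreal_mult bracket_nonneg mult.assoc)
  qed
  also have "\<dots> < \<infinity>"
  proof -
    have "(\<integral>\<^sup>+\<xi>. h \<xi> * m \<xi> \<partial>lborel)\<^sup>2 \<le> (\<integral>\<^sup>+\<xi>. (h \<xi>)\<^sup>2 \<partial>lborel) * (\<integral>\<^sup>+\<xi>. (m \<xi>)\<^sup>2 \<partial>lborel)"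
      by (rule Cauchy_Schwarz_nn_integral) measurable
    also have "(\<integral>\<^sup>+\<xi>. (h \<xi>)\<^sup>2 \<partial>lborel) = ennreal (sqnorm (weighted b (- \<sigma>) H))"
      using sqnorm_ennreal[OF L(3)] by (simp add: h_def ennreal_power)
    also have "ennreal (sqnorm (weighted b (- \<sigma>) H)) * (\<integral>\<^sup>+\<xi>. (m \<xi>)\<^sup>2 \<partial>lborel) \<le> ennreal (sqnorm (weighted b (- \<sigma>) H)) * ennreal C"
      using C by (rule mult_left_mono) simp
    also have "\<dots> < \<infinity>" by (simp add: ennreal_mult_less_top)
    finally have "(\<integral>\<^sup>+\<xi>. h \<xi> * m \<xi> \<partial>lborel)\<^sup>2 < \<infinity>" .
    then show ?thesis
      by (cases "(\<integral>\<^sup>+\<xi>. h \<xi> * m \<xi> \<partial>lborel) = top") (simp_all add: power2_eq_square less_top)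
  qed
  finally show "(\<integral>\<^sup>+x. ennreal (norm (case x of (\<xi>, \<eta>) \<Rightarrow> H \<xi> * (F (\<xi> - \<eta>) * G \<eta>))) \<partial>(lborel \<Otimes>\<^sub>M lborel)) < \<infinity>" .
qed

section \<open>Multiplication and duality on the Fourier side\<close>

lemma fun_mult_fun_mult: "fun_mult a (fun_mult c u) = fun_mult (\<lambda>x. c x * a x) u"
  by (simp add: fun_mult_def mult.assoc)

text \<open>The effect on the Fourier transform of multiplying a functional by \<open>a\<close>. The inverse transform at
  \<open>- \<zeta>\<close> is the Fourier transform of \<open>a\<close> divided by \<open>(2\<pi>)\<^sup>n\<close>.\<close>

definition spectral_mult :: "(real^'n::finite \<Rightarrow> complex) \<Rightarrow> (real^'n \<Rightarrow> complex) \<Rightarrow> real^'n \<Rightarrow> complex" where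
  "spectral_mult a F = convolution (\<lambda>\<zeta>. inv_fourier a (- \<zeta>)) F"

text \<open>Multiplication by a Schwartz function preserves every Sobolev order, because the transform of the
  Schwartz function may be given an arbitrarily large order \<open>T\<close>.\<close>

lemma convolution_exponents_mul:
  fixes b :: "'n::finite \<Rightarrow> 'j::finite"
  obtains T \<delta> where "convolution_exponents b T s s \<delta>"
proof (rule that)
  \<comment> \<open>The summand \<open>\<bar>s\<bar>\<close> of \<open>T\<close> gives \<open>\<delta> \<le> T + s\<close>, the other summand is \<open>\<delta>\<close> and gives \<open>s \<le> T + s - \<delta>\<close>.\<close>
  show "convolution_exponents b (\<chi> l. \<bar>s $ l\<bar> + (block_dim b l / 2 + 1)) s s (\<chi> l. block_dim b l / 2 + 1)"
    by (auto simp: convolution_exponents_def abs_real_def)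
qed

lemma schwartz_weighted_L2: "f \<in> schwartz_functions \<Longrightarrow> L2 (weighted b s f)"
  by (intro schwartz_L2 schwartz_weighted)

lemma fourier_rep_fun_mult:
  fixes f :: "'n::finite functional"
  assumes r: "fourier_rep b s f F" and a: "a \<in> schwartz_functions"
  shows "fourier_rep b s (fun_mult a f) (spectral_mult a F)"
proof -
  obtain T \<delta> where e: "convolution_exponents b T s s \<delta>" by (rule convolution_exponents_mul)
  define A where "A = (\<lambda>\<zeta>. inv_fourier a (- \<zeta>))"
  have va: "inv_fourier a \<in> schwartz_functions" by (rule inv_fourier_schwartz[OF a])
  have A: "A \<in> schwartz_functions" unfolding A_def by (rule schwartz_uminus[OF va])
  note [measurable] = fourier_repD(1)[OF r] schwartz_borel[OF A] schwartz_borel[OF va]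
  have "L2 (weighted b s (convolution A F))"
    using convolution_bound[OF e] schwartz_borel[OF A] fourier_repD(1,2)[OF r] schwartz_weighted_L2[OF A] by blast
  moreover have "fun_mult a f \<phi> = (LINT \<xi>|lborel. convolution A F \<xi> * inv_fourier \<phi> \<xi>)" if \<phi>: "\<phi> \<in> schwartz_functions" for \<phi>
  proof -
    have v\<phi>: "inv_fourier \<phi> \<in> schwartz_functions" by (rule inv_fourier_schwartz[OF \<phi>])
    note [measurable] = schwartz_borel[OF v\<phi>]
    have int: "integrable (lborel \<Otimes>\<^sub>M lborel) (\<lambda>(\<xi>, \<eta>). inv_fourier \<phi> \<xi> * (A (\<xi> - \<eta>) * F \<eta>))"
      by (rule convolution_integrable[OF e schwartz_borel[OF A] fourier_repD(1)[OF r] schwartz_borel[OF v\<phi>] schwartz_weighted_L2[OF A] fourier_repD(2)[OF r] schwartz_weighted_L2[OF v\<phi>]])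
    have "fun_mult a f \<phi> = (LINT \<eta>|lborel. F \<eta> * inv_fourier (\<lambda>x. a x * \<phi> x) \<eta>)"
      unfolding fun_mult_def by (rule fourier_repD(3)[OF r schwartz_mult[OF a \<phi>]])
    also have "\<dots> = (LINT \<eta>|lborel. (LINT \<xi>|lborel. inv_fourier \<phi> \<xi> * (A (\<xi> - \<eta>) * F \<eta>)))"
    proof (intro Bochner_Integration.integral_cong refl)
      fix \<eta>
      have "inv_fourier (\<lambda>x. a x * \<phi> x) \<eta> = (LINT \<zeta>|lborel. inv_fourier a \<zeta> * inv_fourier \<phi> (\<eta> - \<zeta>))"
        by (rule inv_fourier_mult[OF a \<phi>])
      also have "\<dots> = (LINT \<xi>|lborel. inv_fourier a (\<eta> - \<xi>) * inv_fourier \<phi> (\<eta> - (\<eta> - \<xi>)))"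
        by (rule integral_reflect(2)[symmetric]) measurable
      finally have "F \<eta> * inv_fourier (\<lambda>x. a x * \<phi> x) \<eta> = (LINT \<xi>|lborel. F \<eta> * (inv_fourier a (\<eta> - \<xi>) * inv_fourier \<phi> \<xi>))"
        by simp
      then show "F \<eta> * inv_fourier (\<lambda>x. a x * \<phi> x) \<eta> = (LINT \<xi>|lborel. inv_fourier \<phi> \<xi> * (A (\<xi> - \<eta>) * F \<eta>))"
        by (simp add: A_def mult_ac)
    qed
    also have "\<dots> = (LINT \<xi>|lborel. (LINT \<eta>|lborel. inv_fourier \<phi> \<xi> * (A (\<xi> - \<eta>) * F \<eta>)))"
      by (rule lborel_pair.Fubini_integral[OF int])
    also have "\<dots> = (LINT \<xi>|lborel. convolution A F \<xi> * inv_fourier \<phi> \<xi>)"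
      by (simp add: convolution_def mult.commute)
    finally show ?thesis .
  qed
  ultimately show ?thesis
    unfolding spectral_mult_def A_def[symmetric] fourier_rep_def by (auto intro: convolution_borel fourier_repD(1)[OF r] schwartz_borel[OF A])
qed

text \<open>A cutoff may be moved from one factor of the pairing to the other. This makes the value of
  \<^const>\<open>distr_prod\<close> independent of the cutoff that is chosen in its definition.\<close>

lemma pairing_fun_mult:
  fixes f g :: "'n::finite functional"
  assumes f: "fourier_rep b s f F" and g: "fourier_rep b t g G" and st: "\<And>l. - s $ l \<le> t $ l" and a: "a \<in> schwartz_functions"
  shows "sobolev_pairing b s (fun_mult a f) g = sobolev_pairing b s f (fun_mult a g)"
proof -
  obtain T \<delta> where e: "convolution_exponents b T s s \<delta>" by (rule convolution_exponents_mul)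
  define A where "A = (\<lambda>\<zeta>. inv_fourier a (- \<zeta>))"
  have A: "A \<in> schwartz_functions" unfolding A_def by (intro schwartz_uminus inv_fourier_schwartz a)
  note [measurable] = fourier_repD(1)[OF f] fourier_repD(1)[OF g] schwartz_borel[OF A]
  have g': "fourier_rep b (- s) g G" by (rule fourier_rep_mono[OF g]) (simp add: st)
  have int: "integrable (lborel \<Otimes>\<^sub>M lborel) (\<lambda>(\<xi>, \<eta>). G (- \<xi>) * (A (\<xi> - \<eta>) * F \<eta>))"
    by (rule convolution_integrable[OF e schwartz_borel[OF A] fourier_repD(1)[OF f] _ schwartz_weighted_L2[OF A] fourier_repD(2)[OF f] L2_weighted_uminus[OF fourier_repD(2)[OF g']]]) measurable
  have "(LINT \<xi>|lborel. spectral_mult a F \<xi> * G (- \<xi>)) = (LINT \<xi>|lborel. (LINT \<eta>|lborel. G (- \<xi>) * (A (\<xi> - \<eta>) * F \<eta>)))"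
    unfolding spectral_mult_def A_def[symmetric] convolution_def by (simp add: mult.commute)
  also have "\<dots> = (LINT \<eta>|lborel. (LINT \<xi>|lborel. G (- \<xi>) * (A (\<xi> - \<eta>) * F \<eta>)))"
    by (rule lborel_pair.Fubini_integral[OF int, symmetric])
  also have "\<dots> = (LINT \<eta>|lborel. F \<eta> * spectral_mult a G (- \<eta>))"
  proof (intro Bochner_Integration.integral_cong refl)
    fix \<eta>
    have "(LINT \<xi>|lborel. G (- \<xi>) * (A (\<xi> - \<eta>) * F \<eta>)) = (LINT \<xi>|lborel. G (- (- \<xi>)) * (A (- \<xi> - \<eta>) * F \<eta>))"
      by (rule integral_uminus(2)[symmetric]) measurable
    also have "\<dots> = (LINT \<xi>|lborel. F \<eta> * (A (- \<eta> - \<xi>) * G \<xi>))"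
    proof (intro Bochner_Integration.integral_cong refl)
      fix \<xi>
      have "A (- \<xi> - \<eta>) = A (- \<eta> - \<xi>)" by (rule arg_cong) simp
      then show "G (- (- \<xi>)) * (A (- \<xi> - \<eta>) * F \<eta>) = F \<eta> * (A (- \<eta> - \<xi>) * G \<xi>)" by simp
    qed
    also have "\<dots> = F \<eta> * spectral_mult a G (- \<eta>)"
      unfolding spectral_mult_def A_def[symmetric] convolution_def by simp
    finally show "(LINT \<xi>|lborel. G (- \<xi>) * (A (\<xi> - \<eta>) * F \<eta>)) = F \<eta> * spectral_mult a G (- \<eta>)" .
  qed
  finally show ?thesis
    unfolding fourier_rep_pairing[OF fourier_rep_fun_mult[OF f a] g st] fourier_rep_pairing[OF f fourier_rep_fun_mult[OF g a] st] by simp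
qed

lemma convolution_exponents_dual: "convolution_exponents b s t \<sigma> \<delta> \<Longrightarrow> - s $ l \<le> t $ l"
proof -
  assume "convolution_exponents b s t \<sigma> \<delta>"
  then have "block_dim b l / 2 < \<delta> $ l" "\<delta> $ l \<le> s $ l + t $ l" by (auto simp: convolution_exponents_def)
  moreover have "0 \<le> real (block_dim b l) / 2" by simp
  ultimately show ?thesis by linarith
qed

text \<open>The functional that sends \<open>\<phi>\<close> to the pairing of \<open>f\<close> with \<open>\<phi>g\<close> is the product of \<open>f\<close> and \<open>g\<close>, and its
  Fourier transform is \<open>(2\<pi>)\<^sup>-\<^sup>n F * G\<close>.\<close>

lemma pairing_convolution:
  fixes f g :: "'n::finite functional"
  assumes e: "convolution_exponents b s t \<sigma> \<delta>" and f: "fourier_rep b s f F" and g: "fourier_rep b t g G" and \<phi>: "\<phi> \<in> schwartz_functions"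
  shows "sobolev_pairing b s f (fun_mult \<phi> g) = (LINT \<zeta>|lborel. convolution F G \<zeta> * inv_fourier \<phi> \<zeta>) / of_real ((2 * pi) ^ CARD('n))"
proof -
  obtain T \<delta>' where e': "convolution_exponents b T t t \<delta>'" by (rule convolution_exponents_mul)
  note st = convolution_exponents_dual[OF e]
  let ?v = "inv_fourier \<phi>"
  have v: "?v \<in> schwartz_functions" by (rule inv_fourier_schwartz[OF \<phi>])
  have A: "(\<lambda>\<zeta>. ?v (- \<zeta>)) \<in> schwartz_functions" by (rule schwartz_uminus[OF v])
  note [measurable] = fourier_repD(1)[OF f] fourier_repD(1)[OF g] schwartz_borel[OF v]
  have f': "fourier_rep b (- t) f F" by (rule fourier_rep_mono[OF f]) (use st in \<open>simp add: minus_le_iff\<close>)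
  have int1: "integrable (lborel \<Otimes>\<^sub>M lborel) (\<lambda>(\<zeta>, \<eta>). ?v \<zeta> * (F (\<zeta> - \<eta>) * G \<eta>))"
    by (rule convolution_integrable[OF e fourier_repD(1)[OF f] fourier_repD(1)[OF g] schwartz_borel[OF v] fourier_repD(2)[OF f] fourier_repD(2)[OF g] schwartz_weighted_L2[OF v]])
  \<comment> \<open>After the substitution, \<open>F\<close> plays the part of the test factor and \<open>\<phi>\<close> that of a convolution factor.\<close>
  have int2: "integrable (lborel \<Otimes>\<^sub>M lborel) (\<lambda>(\<xi>, \<eta>). F (- \<xi>) * (?v (- (\<xi> - \<eta>)) * G \<eta>))"
    by (rule convolution_integrable[OF e' schwartz_borel[OF A] fourier_repD(1)[OF g] _ schwartz_weighted_L2[OF A] fourier_repD(2)[OF g] L2_weighted_uminus[OF fourier_repD(2)[OF f']]]) measurable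
  have "(LINT \<zeta>|lborel. convolution F G \<zeta> * ?v \<zeta>) = (LINT \<zeta>|lborel. (LINT \<eta>|lborel. ?v \<zeta> * (F (\<zeta> - \<eta>) * G \<eta>)))"
    unfolding convolution_def by (simp add: mult.commute)
  also have "\<dots> = (LINT \<eta>|lborel. (LINT \<zeta>|lborel. ?v \<zeta> * (F (\<zeta> - \<eta>) * G \<eta>)))"
    by (rule lborel_pair.Fubini_integral[OF int1, symmetric])
  also have "\<dots> = (LINT \<eta>|lborel. (LINT \<xi>|lborel. F (- \<xi>) * (?v (- (\<xi> - \<eta>)) * G \<eta>)))"
  proof (rule Bochner_Integration.integral_cong[OF refl])
    fix \<eta>
    have "(LINT \<zeta>|lborel. ?v \<zeta> * (F (\<zeta> - \<eta>) * G \<eta>)) = (LINT \<xi>|lborel. ?v (\<eta> - \<xi>) * (F (\<eta> - \<xi> - \<eta>) * G \<eta>))"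
      by (rule integral_reflect(2)[symmetric]) measurable
    then show "(LINT \<zeta>|lborel. ?v \<zeta> * (F (\<zeta> - \<eta>) * G \<eta>)) = (LINT \<xi>|lborel. F (- \<xi>) * (?v (- (\<xi> - \<eta>)) * G \<eta>))"
      by (simp add: mult.left_commute)
  qed
  also have "\<dots> = (LINT \<xi>|lborel. (LINT \<eta>|lborel. F (- \<xi>) * (?v (- (\<xi> - \<eta>)) * G \<eta>)))"
    by (rule lborel_pair.Fubini_integral[OF int2])
  also have "\<dots> = (LINT \<xi>|lborel. F (- \<xi>) * spectral_mult \<phi> G \<xi>)"
    unfolding spectral_mult_def convolution_def by simp
  also have "\<dots> = (LINT \<xi>|lborel. F (- (- \<xi>)) * spectral_mult \<phi> G (- \<xi>))"
    using fourier_repD(1)[OF f] fourier_repD(1)[OF fourier_rep_fun_mult[OF g \<phi>]] by (intro integral_uminus(2)[symmetric]) measurable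
  finally show ?thesis
    unfolding fourier_rep_pairing[OF f fourier_rep_fun_mult[OF g \<phi>] st] by simp
qed

section \<open>Localisation\<close>

lemma fourier_rep_cong:
  "fourier_rep b s u F \<Longrightarrow> (\<And>\<phi>. \<phi> \<in> schwartz_functions \<Longrightarrow> u' \<phi> = u \<phi>) \<Longrightarrow> fourier_rep b s u' F"
  by (auto simp: fourier_rep_def)

lemma fourier_rep_add:
  assumes "fourier_rep b s u F" "fourier_rep b s v G"
  shows "fourier_rep b s (\<lambda>\<phi>. u \<phi> + v \<phi>) (\<lambda>\<xi>. F \<xi> + G \<xi>)"
  unfolding fourier_rep_def
proof (intro conjI ballI)
  note [measurable] = fourier_repD(1)[OF assms(1)] fourier_repD(1)[OF assms(2)]
  show "(\<lambda>\<xi>. F \<xi> + G \<xi>) \<in> borel_measurable borel" by measurable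
  show "L2 (weighted b s (\<lambda>\<xi>. F \<xi> + G \<xi>))"
    using L2_add[OF fourier_repD(2)[OF assms(1)] fourier_repD(2)[OF assms(2)]] by (simp add: weighted_def distrib_left)
  fix \<phi> :: "real^'a \<Rightarrow> complex" assume \<phi>: "\<phi> \<in> schwartz_functions"
  show "u \<phi> + v \<phi> = (LINT \<xi>|lborel. (F \<xi> + G \<xi>) * inv_fourier \<phi> \<xi>)"
    using fourier_rep_integrable[OF fourier_repD(2)[OF assms(1)] \<phi>] fourier_rep_integrable[OF fourier_repD(2)[OF assms(2)] \<phi>]
      fourier_repD(3)[OF assms(1) \<phi>] fourier_repD(3)[OF assms(2) \<phi>]
    by (simp add: distrib_right)
qed

lemma fourier_rep_sum:
  assumes "finite Z" "\<And>z. z \<in> Z \<Longrightarrow> \<exists>F. fourier_rep b s (g z) F"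
  shows "\<exists>F. fourier_rep b s (\<lambda>\<phi>. \<Sum>z\<in>Z. g z \<phi>) F"
  using assms
proof (induction Z rule: finite_induct)
  case empty
  have "fourier_rep b s (\<lambda>\<phi>. 0) (\<lambda>\<xi>. 0)" by (simp add: fourier_rep_def L2_def weighted_def)
  then show ?case by auto
next
  case (insert z Z)
  then obtain F G where "fourier_rep b s (g z) F" "fourier_rep b s (\<lambda>\<phi>. \<Sum>z\<in>Z. g z \<phi>) G" by blast
  from fourier_rep_add[OF this] show ?case using insert.hyps by auto
qed

lemma linear_functional_sum:
  assumes u: "linear_functional_on test_functions u" and "finite Z" and g: "\<And>z. z \<in> Z \<Longrightarrow> g z \<in> test_functions"
  shows "u (\<lambda>x. \<Sum>z\<in>Z. g z x) = (\<Sum>z\<in>Z. u (g z))"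
proof -
  have z: "(\<lambda>x. 0) \<in> test_functions" by (auto simp: test_functions_iff smooth_const)
  have "(\<lambda>x. \<Sum>z\<in>Z. g z x) \<in> test_functions \<and> u (\<lambda>x. \<Sum>z\<in>Z. g z x) = (\<Sum>z\<in>Z. u (g z))"
    using assms(2) g
  proof (induction Z rule: finite_induct)
    case empty
    have "\<forall>c. \<forall>\<phi>\<in>test_functions. u (\<lambda>x. c * \<phi> x) = c * u \<phi>"
      using u by (simp add: linear_functional_on_def)
    from this[rule_format, OF z, of 0] have "u (\<lambda>x. 0) = 0" by simp
    then show ?case using z by simp
  next
    case (insert a Z)
    then have t: "g a \<in> test_functions" "(\<lambda>x. \<Sum>z\<in>Z. g z x) \<in> test_functions" by auto
    have "\<forall>\<phi>\<in>test_functions. \<forall>\<psi>\<in>test_functions. u (\<lambda>x. \<phi> x + \<psi> x) = u \<phi> + u \<psi>"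
      using u by (simp add: linear_functional_on_def)
    from this[rule_format, OF t] have "u (\<lambda>x. g a x + (\<Sum>z\<in>Z. g z x)) = u (g a) + u (\<lambda>x. \<Sum>z\<in>Z. g z x)" .
    moreover note t
    ultimately show ?case using insert by (simp add: test_add)
  qed
  then show ?thesis by blast
qed

text \<open>Finitely many translates of \<open>\<theta>\<close> have no common zero on a ball containing the support of \<open>\<kappa>\<close>.
  Divide by the sum of their squared moduli, to which a function \<open>E\<close> is added that vanishes on the ball and
  is positive outside, so that the denominator has no zeros at all.\<close>

lemma test_partition:
  fixes \<theta> \<kappa> :: "real^'n::finite \<Rightarrow> complex"
  assumes \<theta>: "\<theta> \<in> test_functions" "\<theta> x0 \<noteq> 0" and \<kappa>: "\<kappa> \<in> test_functions"
  obtains Y a where "finite Y" "\<And>y. y \<in> Y \<Longrightarrow> a y \<in> test_functions" "\<And>x. \<kappa> x = (\<Sum>y\<in>Y. translate y \<theta> x * a y x)"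
proof -
  obtain R0 where R0: "\<And>x. norm x > R0 \<Longrightarrow> \<kappa> x = 0" using \<kappa> by (auto simp: test_functions_iff)
  define R where "R = max R0 0"
  have R: "norm x > R \<Longrightarrow> \<kappa> x = 0" and Rn: "R \<ge> 0" for x using R0 by (auto simp: R_def)
  have st: "smooth (translate y \<theta>)" for y by (intro test_smooth test_translate \<theta>)
  define U where "U = (\<lambda>z. {x. translate (z - x0) \<theta> x \<noteq> 0})"
  have "open (U z)" for z unfolding U_def
    by (intro open_Collect_neq smooth_continuous st continuous_on_const)
  moreover have "cball 0 R \<subseteq> (\<Union>z\<in>cball 0 R. U z)"
    using \<theta>(2) by (auto simp: U_def translate_def)
  ultimately obtain Z where Z: "Z \<subseteq> cball 0 R" "finite Z" "cball 0 R \<subseteq> (\<Union>z\<in>Z. U z)"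
    by (rule compactE_image[OF compact_cball]) blast
  define Y where "Y = (\<lambda>z. z - x0) ` Z"
  have fY: "finite Y" using Z by (simp add: Y_def)
  have cov: "\<exists>y\<in>Y. translate y \<theta> x \<noteq> 0" if "norm x \<le> R" for x
    using Z(3) that by (force simp: Y_def U_def)
  define E where "E = (\<lambda>x::real^'n. complex_of_real (flat_exp 0 (Re (of_real (- R\<^sup>2) + (\<Sum>i\<in>UNIV. complex_of_real (x $ i) * complex_of_real (x $ i))))))"
  have sE: "smooth E" unfolding E_def by (intro smooth_flat_exp smooth_add smooth_const smooth_sum smooth_mult smooth_coord)
  have E: "E x = of_real (flat_exp 0 ((norm x)\<^sup>2 - R\<^sup>2))" for x
    by (simp add: E_def norm_sq_sum flip: power2_eq_square)
  have E0: "E x = 0" if "norm x \<le> R" for x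
  proof -
    have "(norm x)\<^sup>2 \<le> R\<^sup>2" using that by (intro power_mono) auto
    then show ?thesis by (simp add: E flat_exp_def)
  qed
  define D where "D = (\<lambda>x. (\<Sum>y\<in>Y. translate y \<theta> x * cnj (translate y \<theta> x)) + E x)"
  have sD: "smooth D" unfolding D_def by (intro smooth_add smooth_sum smooth_mult smooth_cnj st sE)
  have Dne: "D x \<noteq> 0" for x
  proof -
    have D: "D x = of_real ((\<Sum>y\<in>Y. (cmod (translate y \<theta> x))\<^sup>2) + flat_exp 0 ((norm x)\<^sup>2 - R\<^sup>2))"
      unfolding D_def E by (simp only: complex_norm_square[symmetric] of_real_add of_real_sum)
    have s0: "0 \<le> (\<Sum>y\<in>Y. (cmod (translate y \<theta> x))\<^sup>2)" by (intro sum_nonneg) auto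
    have "(\<Sum>y\<in>Y. (cmod (translate y \<theta> x))\<^sup>2) + flat_exp 0 ((norm x)\<^sup>2 - R\<^sup>2) > 0"
    proof (cases "norm x \<le> R")
      case True
      then obtain y where y: "y \<in> Y" "translate y \<theta> x \<noteq> 0" using cov by blast
      have "0 < (cmod (translate y \<theta> x))\<^sup>2" using y by simp
      also have "\<dots> \<le> (\<Sum>y\<in>Y. (cmod (translate y \<theta> x))\<^sup>2)" using y fY by (intro member_le_sum) auto
      finally show ?thesis using flat_exp_nonneg[of 0 "(norm x)\<^sup>2 - R\<^sup>2"] by linarith
    next
      case False
      then have "R\<^sup>2 < (norm x)\<^sup>2" using Rn by (intro power_strict_mono) auto
      then have "flat_exp 0 ((norm x)\<^sup>2 - R\<^sup>2) > 0" by (simp add: flat_exp_pos_iff)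
      then show ?thesis using s0 by linarith
    qed
    then show ?thesis unfolding D of_real_eq_0_iff by linarith
  qed
  show ?thesis
  proof (rule that[OF fY])
    show "(\<lambda>x. (cnj (translate y \<theta> x) * inverse (D x)) * \<kappa> x) \<in> test_functions" for y
      by (intro test_mult \<kappa> smooth_mult smooth_cnj smooth_inverse st sD Dne)
    show "\<kappa> x = (\<Sum>y\<in>Y. translate y \<theta> x * ((cnj (translate y \<theta> x) * inverse (D x)) * \<kappa> x))" for x
    proof -
      have "(\<Sum>y\<in>Y. translate y \<theta> x * ((cnj (translate y \<theta> x) * inverse (D x)) * \<kappa> x)) =
         (\<Sum>y\<in>Y. translate y \<theta> x * cnj (translate y \<theta> x)) * (inverse (D x) * \<kappa> x)"
        by (simp add: sum_distrib_right mult.assoc)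
      also have "\<dots> = (D x - E x) * (inverse (D x) * \<kappa> x)" by (simp add: D_def)
      also have "\<dots> = \<kappa> x"
        using Dne[of x] E0[of x] R[of x] by (cases "norm x \<le> R") auto
      finally show ?thesis by simp
    qed
  qed
qed

text \<open>A window \<open>\<theta>\<close> all of whose translates map \<open>u\<close> into the Sobolev space can be replaced by any test
  function.\<close>

lemma local_sobolev:
  fixes u :: "'n::finite functional"
  assumes u: "linear_functional_on test_functions u"
    and \<theta>: "\<theta> \<in> test_functions" "\<theta> x0 \<noteq> 0" and loc: "\<And>y. fun_mult (translate y \<theta>) u \<in> sobolev_space b s"
    and \<kappa>: "\<kappa> \<in> test_functions"
  shows "fun_mult \<kappa> u \<in> sobolev_space b s"
proof -
  obtain Y a where Y: "finite Y" "\<And>y. y \<in> Y \<Longrightarrow> a y \<in> test_functions" "\<And>x. \<kappa> x = (\<Sum>y\<in>Y. translate y \<theta> x * a y x)"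
    by (rule test_partition[OF \<theta> \<kappa>]) blast
  have "\<exists>F. fourier_rep b s (fun_mult (a y) (fun_mult (translate y \<theta>) u)) F" if "y \<in> Y" for y
    using sobolev_space_fourier_rep[OF loc[of y]] fourier_rep_fun_mult[OF _ test_schwartz[OF Y(2)[OF that]]] by blast
  then obtain F where F: "fourier_rep b s (\<lambda>\<phi>. \<Sum>y\<in>Y. fun_mult (a y) (fun_mult (translate y \<theta>) u) \<phi>) F"
    using fourier_rep_sum[OF Y(1), of b s "\<lambda>y. fun_mult (a y) (fun_mult (translate y \<theta>) u)"] by blast
  have "fourier_rep b s (fun_mult \<kappa> u) F"
  proof (rule fourier_rep_cong[OF F])
    fix \<phi> :: "real^'n \<Rightarrow> complex" assume \<phi>: "\<phi> \<in> schwartz_functions"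
    have t: "(\<lambda>x. translate y \<theta> x * (a y x * \<phi> x)) \<in> test_functions" if "y \<in> Y" for y
      by (intro test_mult test_smooth test_translate \<theta> test_mult' Y that schwartz_smooth \<phi>)
    have "fun_mult \<kappa> u \<phi> = u (\<lambda>x. \<Sum>y\<in>Y. translate y \<theta> x * (a y x * \<phi> x))"
      unfolding fun_mult_def Y(3) by (simp add: sum_distrib_right mult.assoc)
    also have "\<dots> = (\<Sum>y\<in>Y. u (\<lambda>x. translate y \<theta> x * (a y x * \<phi> x)))"
      by (rule linear_functional_sum[OF u Y(1) t])
    finally show "fun_mult \<kappa> u \<phi> = (\<Sum>y\<in>Y. fun_mult (a y) (fun_mult (translate y \<theta>) u) \<phi>)"
      by (simp add: fun_mult_def)
  qed
  then show ?thesis by (rule fourier_rep_sobolev)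
qed

definition loc_sobolev :: "('n::finite \<Rightarrow> 'j::finite) \<Rightarrow> real^'j \<Rightarrow> 'n functional \<Rightarrow> bool" where
  "loc_sobolev b s u \<longleftrightarrow> (\<forall>\<kappa>\<in>test_functions. fun_mult \<kappa> u \<in> sobolev_space b s)"

lemma loc_sobolev_fourier_rep: "loc_sobolev b s u \<Longrightarrow> \<kappa> \<in> test_functions \<Longrightarrow> \<exists>F. fourier_rep b s (fun_mult \<kappa> u) F"
  unfolding loc_sobolev_def using sobolev_space_fourier_rep by blast

lemma translate_zero:
  assumes "\<And>x. norm x > R \<Longrightarrow> \<theta> x = 0" "norm x > R + norm y"
  shows "translate y \<theta> x = 0"
proof -
  have "norm (x - y) > R" using assms(2) norm_triangle_ineq2[of x y] by linarith
  then show ?thesis using assms(1) by (simp add: translate_def)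
qed

text \<open>As long as \<open>y\<close> stays bounded, the transform of the localised functional is an integral that
  involves \<open>y\<close> only through an exponential factor. It is jointly measurable in \<open>y\<close> and \<open>\<xi>\<close>, and so the norm is
  measurable in \<open>y\<close>. The general case is a pointwise limit of such functions.\<close>

lemma sobolev_norm_translate_borel:
  fixes w :: "'n::finite functional"
  assumes w: "loc_sobolev b s w" and \<theta>: "\<theta> \<in> test_functions"
  shows "(\<lambda>y. sobolev_norm b s (fun_mult (translate y \<theta>) w)) \<in> borel_measurable borel"
proof -
  obtain R where R: "\<And>x. norm x > R \<Longrightarrow> \<theta> x = 0" using \<theta> by (auto simp: test_functions_iff)
  have "\<exists>\<Theta>. \<forall>k. \<Theta> k \<in> test_functions \<and> (\<forall>x::real^'n. norm x \<le> real k \<longrightarrow> \<Theta> k x = 1)"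
    by (intro choice allI) (use cutoff_exists in blast)
  then obtain \<Theta> where \<Theta>: "\<And>k. \<Theta> k \<in> test_functions" "\<And>k x::real^'n. norm x \<le> real k \<Longrightarrow> \<Theta> k x = 1" by blast
  have "\<exists>H. \<forall>k. fourier_rep b s (fun_mult (\<Theta> k) w) (H k)"
    using loc_sobolev_fourier_rep[OF w \<Theta>(1)] by (intro choice) blast
  then obtain H where H: "\<And>k. fourier_rep b s (fun_mult (\<Theta> k) w) (H k)" by blast
  note [measurable] = fourier_repD(1)[OF H]
  define N where "N = (\<lambda>k y. sqrt (sqnorm (weighted b s (spectral_mult (translate y \<theta>) (H k))) / (2 * pi) ^ CARD('n)))"
  have vb [measurable]: "inv_fourier \<theta> \<in> borel_measurable borel"
    by (intro schwartz_borel inv_fourier_schwartz test_schwartz \<theta>)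
  have am: "spectral_mult (translate y \<theta>) (H k) \<xi> = (LINT \<eta>|lborel. cis (y \<bullet> (\<eta> - \<xi>)) * inv_fourier \<theta> (\<eta> - \<xi>) * H k \<eta>)" for k y \<xi>
    unfolding spectral_mult_def convolution_def by (simp add: inv_fourier_translate[OF test_schwartz[OF \<theta>]])
  have meas: "N k \<in> borel_measurable borel" for k
    unfolding N_def sqnorm_def weighted_def am by measurable
  have eq: "sobolev_norm b s (fun_mult (translate y \<theta>) w) = N k y" if "R + norm y \<le> real k" for k y
  proof -
    have "(\<lambda>x. \<Theta> k x * translate y \<theta> x) = translate y \<theta>"
    proof
      fix x
      show "\<Theta> k x * translate y \<theta> x = translate y \<theta> x"
        using \<Theta>(2)[of x k] translate_zero[of R \<theta> y x] R that by (cases "norm x \<le> real k") auto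
    qed
    then have "fun_mult (translate y \<theta>) (fun_mult (\<Theta> k) w) = fun_mult (translate y \<theta>) w"
      by (simp add: fun_mult_fun_mult)
    then show ?thesis
      using fourier_rep_sobolev(2)[OF fourier_rep_fun_mult[OF H[of k] test_schwartz[OF test_translate[OF \<theta>, of y]]]]
      by (simp add: N_def)
  qed
  show ?thesis
  proof (rule borel_measurable_LIMSEQ_real[OF _ meas])
    fix y :: "real^'n"
    obtain k0 where k0: "R + norm y \<le> real k0" using real_arch_simple by blast
    have "\<forall>k\<ge>k0. N k y = sobolev_norm b s (fun_mult (translate y \<theta>) w)"
      using eq[of y] k0 by (metis of_nat_le_iff order_trans)
    then show "(\<lambda>k. N k y) \<longlonglongrightarrow> sobolev_norm b s (fun_mult (translate y \<theta>) w)"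
      by (intro tendsto_eventually) (auto simp: eventually_sequentially)
  qed
qed

section \<open>The product of distributions\<close>

lemma cutoff_for:
  fixes \<phi> :: "real^'n::finite \<Rightarrow> complex"
  assumes "\<phi> \<in> test_functions"
  shows "cutoff_for \<phi> \<in> test_functions" "cutoff_for \<phi> x * \<phi> x = \<phi> x"
proof -
  have "bounded (supp \<phi>)" using assms by (auto simp: test_functions_def compact_imp_bounded)
  then obtain R where R: "\<And>x. x \<in> supp \<phi> \<Longrightarrow> norm x \<le> R" unfolding bounded_iff by blast
  obtain \<theta> :: "real^'n \<Rightarrow> complex" where \<theta>: "\<theta> \<in> test_functions" "\<And>x. norm x \<le> R + 1 \<Longrightarrow> \<theta> x = 1"
    using cutoff_exists[of "R + 1"] by blast
  have "\<exists>\<theta>. \<theta> \<in> test_functions \<and> (\<exists>U. open U \<and> supp \<phi> \<subseteq> U \<and> (\<forall>x\<in>U. \<theta> x = 1))"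
  proof (intro exI conjI)
    show "open (ball (0::real^'n) (R + 1))" by simp
    show "supp \<phi> \<subseteq> ball 0 (R + 1)" using R by (force simp: )
  qed (use \<theta> in auto)
  then have *: "cutoff_for \<phi> \<in> test_functions \<and> (\<exists>U. open U \<and> supp \<phi> \<subseteq> U \<and> (\<forall>x\<in>U. cutoff_for \<phi> x = 1))"
    unfolding cutoff_for_def by (rule someI_ex)
  then show "cutoff_for \<phi> \<in> test_functions" by simp
  have "cutoff_for \<phi> x = 1" if "\<phi> x \<noteq> 0"
  proof -
    have "x \<in> supp \<phi>" using that closure_subset[of "{x. \<phi> x \<noteq> 0}"] by (auto simp: supp_def)
    then show ?thesis using * by blast
  qed
  then show "cutoff_for \<phi> x * \<phi> x = \<phi> x" by (cases "\<phi> x = 0") auto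
qed

text \<open>With \<open>\<psi> = \<theta>\<^sub>1\<theta>\<^sub>2\<phi>\<close> and \<open>\<kappa>\<close> the cutoff chosen for \<open>\<psi>\<close>, the value of the product at \<open>\<psi>\<close> is the
  pairing of \<open>\<kappa>u\<close> and \<open>\<psi>v\<close>. Moving cutoffs between the two factors transforms it first into the pairing of
  \<open>\<Theta>u\<close> and \<open>\<psi>v\<close>, where \<open>\<Theta>\<theta>\<^sub>1 = \<theta>\<^sub>1\<close>, and then into that of \<open>\<theta>\<^sub>1u\<close> and \<open>\<phi>\<theta>\<^sub>2v\<close>.\<close>

lemma distr_prod_fourier_rep:
  fixes u v :: "'n::finite functional"
  assumes e: "convolution_exponents b s t \<sigma> \<delta>" and u: "loc_sobolev b s u" and v: "loc_sobolev b t v"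
    and \<theta>1: "\<theta>1 \<in> test_functions" and \<theta>2: "\<theta>2 \<in> test_functions"
    and F: "fourier_rep b s (fun_mult \<theta>1 u) F" and G: "fourier_rep b t (fun_mult \<theta>2 v) G"
  shows "fourier_rep b \<sigma> (fun_mult (\<lambda>x. \<theta>1 x * \<theta>2 x) (distr_prod b s u v)) (\<lambda>\<xi>. convolution F G \<xi> / of_real ((2 * pi) ^ CARD('n)))"
  unfolding fourier_rep_def
proof (intro conjI ballI)
  let ?c = "complex_of_real ((2 * pi) ^ CARD('n))"
  note st = convolution_exponents_dual[OF e]
  have cb: "convolution F G \<in> borel_measurable borel" by (intro convolution_borel fourier_repD(1)[OF F] fourier_repD(1)[OF G])
  show "(\<lambda>\<xi>. convolution F G \<xi> / ?c) \<in> borel_measurable borel" using cb by measurable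
  have "L2 (weighted b \<sigma> (convolution F G))"
    using convolution_bound[OF e] fourier_repD(1,2)[OF F] fourier_repD(1,2)[OF G] by blast
  then show "L2 (weighted b \<sigma> (\<lambda>\<xi>. convolution F G \<xi> / ?c))"
    using L2_cmult[of "weighted b \<sigma> (convolution F G)" "inverse ?c"] by (simp add: weighted_def divide_inverse mult_ac)
  fix \<phi> :: "real^'n \<Rightarrow> complex" assume \<phi>: "\<phi> \<in> schwartz_functions"
  define \<psi> where "\<psi> = (\<lambda>x. \<theta>1 x * (\<theta>2 x * \<phi> x))"
  have \<theta>\<phi>: "(\<lambda>x. \<theta>2 x * \<phi> x) \<in> test_functions" by (intro test_mult' \<theta>2 schwartz_smooth \<phi>)
  have \<psi>: "\<psi> \<in> test_functions" unfolding \<psi>_def by (intro test_mult test_smooth[OF \<theta>1] \<theta>\<phi>)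
  define \<kappa> where "\<kappa> = cutoff_for \<psi>"
  have \<kappa>: "\<kappa> \<in> test_functions" "\<And>x. \<kappa> x * \<psi> x = \<psi> x" using cutoff_for[OF \<psi>] by (auto simp: \<kappa>_def)
  obtain \<Theta> where \<Theta>: "\<Theta> \<in> test_functions" "\<And>x. \<Theta> x * \<theta>1 x = \<theta>1 x"
    using cutoff_exists'[OF \<theta>1] by blast
  have \<Theta>\<psi>: "\<Theta> x * \<psi> x = \<psi> x" for x using \<Theta>(2)[of x] by (simp add: \<psi>_def mult.assoc[symmetric])
  obtain Fc where Fc: "fourier_rep b s (fun_mult \<kappa> u) Fc" using loc_sobolev_fourier_rep[OF u \<kappa>(1)] by blast
  obtain Ft where Ft: "fourier_rep b s (fun_mult \<Theta> u) Ft" using loc_sobolev_fourier_rep[OF u \<Theta>(1)] by blast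
  obtain Gp where Gp: "fourier_rep b t (fun_mult \<psi> v) Gp" using loc_sobolev_fourier_rep[OF v \<psi>] by blast
  obtain Gq where Gq: "fourier_rep b t (fun_mult (\<lambda>x. \<theta>2 x * \<phi> x) v) Gq" using loc_sobolev_fourier_rep[OF v \<theta>\<phi>] by blast
  have fe: "(\<lambda>x. \<psi> x * \<Theta> x) = \<psi>" "(\<lambda>x. \<psi> x * \<kappa> x) = \<psi>" "(\<lambda>x. \<Theta> x * \<theta>1 x) = \<theta>1"
    "(\<lambda>x. \<theta>2 x * \<phi> x * \<theta>1 x) = \<psi>" "(\<lambda>x. \<kappa> x * \<Theta> x) = (\<lambda>x. \<Theta> x * \<kappa> x)"
    using \<Theta>\<psi> \<kappa>(2) \<Theta>(2) by (auto simp: mult.commute \<psi>_def)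
  have eqs: "fun_mult \<Theta> (fun_mult \<psi> v) = fun_mult \<psi> v" "fun_mult \<kappa> (fun_mult \<psi> v) = fun_mult \<psi> v"
    "fun_mult \<theta>1 (fun_mult \<Theta> u) = fun_mult \<theta>1 u"
    "fun_mult \<theta>1 (fun_mult (\<lambda>x. \<theta>2 x * \<phi> x) v) = fun_mult \<psi> v"
    "fun_mult \<phi> (fun_mult \<theta>2 v) = fun_mult (\<lambda>x. \<theta>2 x * \<phi> x) v"
    "fun_mult \<Theta> (fun_mult \<kappa> u) = fun_mult \<kappa> (fun_mult \<Theta> u)"
    by (simp_all only: fun_mult_fun_mult fe)
  have "fun_mult (\<lambda>x. \<theta>1 x * \<theta>2 x) (distr_prod b s u v) \<phi> = distr_prod b s u v \<psi>"
    by (simp add: fun_mult_def \<psi>_def mult.assoc)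
  also have "\<dots> = sobolev_pairing b s (fun_mult \<kappa> u) (fun_mult \<psi> v)"
    by (simp add: distr_prod_def \<kappa>_def)
  also have "\<dots> = sobolev_pairing b s (fun_mult \<Theta> (fun_mult \<kappa> u)) (fun_mult \<psi> v)"
    using pairing_fun_mult[OF Fc Gp st test_schwartz[OF \<Theta>(1)]] unfolding eqs(1) by (rule sym)
  also have "\<dots> = sobolev_pairing b s (fun_mult \<kappa> (fun_mult \<Theta> u)) (fun_mult \<psi> v)"
    unfolding eqs(6) ..
  also have "\<dots> = sobolev_pairing b s (fun_mult \<Theta> u) (fun_mult \<psi> v)"
    using pairing_fun_mult[OF Ft Gp st test_schwartz[OF \<kappa>(1)]] unfolding eqs(2) .
  also have "\<dots> = sobolev_pairing b s (fun_mult \<theta>1 (fun_mult \<Theta> u)) (fun_mult (\<lambda>x. \<theta>2 x * \<phi> x) v)"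
    using pairing_fun_mult[OF Ft Gq st test_schwartz[OF \<theta>1]] unfolding eqs(4) by (rule sym)
  also have "\<dots> = sobolev_pairing b s (fun_mult \<theta>1 u) (fun_mult \<phi> (fun_mult \<theta>2 v))"
    unfolding eqs(3,5) ..
  also have "\<dots> = (LINT \<zeta>|lborel. convolution F G \<zeta> * inv_fourier \<phi> \<zeta>) / ?c"
    by (rule pairing_convolution[OF e F G \<phi>])
  finally show "fun_mult (\<lambda>x. \<theta>1 x * \<theta>2 x) (distr_prod b s u v) \<phi> = (LINT \<xi>|lborel. convolution F G \<xi> / ?c * inv_fourier \<phi> \<xi>)"
    by simp
qed

lemma distr_prod_loc_sobolev:
  assumes e: "convolution_exponents b s t \<sigma> \<delta>" and u: "loc_sobolev b s u" and v: "loc_sobolev b t v"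
  shows "loc_sobolev b \<sigma> (distr_prod b s u v)"
  unfolding loc_sobolev_def
proof
  fix \<kappa> :: "real^'a \<Rightarrow> complex" assume \<kappa>: "\<kappa> \<in> test_functions"
  obtain \<Theta> where \<Theta>: "\<Theta> \<in> test_functions" "\<And>x. \<Theta> x * \<kappa> x = \<kappa> x"
    using cutoff_exists'[OF \<kappa>] by blast
  obtain F where F: "fourier_rep b s (fun_mult \<Theta> u) F" using loc_sobolev_fourier_rep[OF u \<Theta>(1)] by blast
  obtain G where G: "fourier_rep b t (fun_mult \<kappa> v) G" using loc_sobolev_fourier_rep[OF v \<kappa>] by blast
  show "fun_mult \<kappa> (distr_prod b s u v) \<in> sobolev_space b \<sigma>"
    using fourier_rep_sobolev(1)[OF distr_prod_fourier_rep[OF e u v \<Theta>(1) \<kappa> F G]] by (simp add: \<Theta>(2))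
qed

lemma loc_sobolev_fourier_rep_on_ball:
  fixes w :: "'n::finite functional"
  assumes w: "loc_sobolev b s w"
  obtains F where "F \<in> borel_measurable borel" "L2 (weighted b s F)"
    "\<And>\<phi>. \<phi> \<in> test_functions \<Longrightarrow> (\<And>x. norm x > R \<Longrightarrow> \<phi> x = 0) \<Longrightarrow> w \<phi> = (LINT \<xi>|lborel. F \<xi> * inv_fourier \<phi> \<xi>)"
proof -
  obtain \<theta> :: "real^'n \<Rightarrow> complex" where \<theta>: "\<theta> \<in> test_functions" "\<And>x. norm x \<le> R \<Longrightarrow> \<theta> x = 1"
    using cutoff_exists[of R] by blast
  obtain F where F: "fourier_rep b s (fun_mult \<theta> w) F" using loc_sobolev_fourier_rep[OF w \<theta>(1)] by blast
  show ?thesis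
  proof (rule that[OF fourier_repD(1,2)[OF F]])
    fix \<phi> :: "real^'n \<Rightarrow> complex" assume \<phi>: "\<phi> \<in> test_functions" "\<And>x. norm x > R \<Longrightarrow> \<phi> x = 0"
    have "(\<lambda>x. \<theta> x * \<phi> x) = \<phi>"
    proof
      show "\<theta> x * \<phi> x = \<phi> x" for x using \<theta>(2)[of x] \<phi>(2)[of x] by (cases "norm x \<le> R") auto
    qed
    then have "w \<phi> = fun_mult \<theta> w \<phi>" by (simp add: fun_mult_def)
    then show "w \<phi> = (LINT \<xi>|lborel. F \<xi> * inv_fourier \<phi> \<xi>)"
      using fourier_repD(3)[OF F test_schwartz[OF \<phi>(1)]] by simp
  qed
qed

text \<open>On test functions supported in a fixed ball, \<open>w\<close> coincides with the tempered functional \<open>\<theta>w\<close>,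
  where the test function \<open>\<theta>\<close> equals \<open>1\<close> on the ball.\<close>

lemma loc_sobolev_distribution:
  fixes w :: "'n::finite functional"
  assumes w: "loc_sobolev b s w"
  shows "w \<in> distributions"
proof -
  have "linear_functional_on test_functions w"
    unfolding linear_functional_on_def
  proof (intro conjI ballI allI)
    fix \<phi> \<psi> :: "real^'n \<Rightarrow> complex" assume t: "\<phi> \<in> test_functions" "\<psi> \<in> test_functions"
    obtain R S where RS: "\<And>x. norm x > R \<Longrightarrow> \<phi> x = 0" "\<And>x. norm x > S \<Longrightarrow> \<psi> x = 0"
      using t by (auto simp: test_functions_iff)
    obtain F where F: "L2 (weighted b s F)"
      "\<And>\<phi>. \<phi> \<in> test_functions \<Longrightarrow> (\<And>x. norm x > max R S \<Longrightarrow> \<phi> x = 0) \<Longrightarrow> w \<phi> = (LINT \<xi>|lborel. F \<xi> * inv_fourier \<phi> \<xi>)"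
      using loc_sobolev_fourier_rep_on_ball[OF w, of "max R S"] by metis
    note S = test_schwartz[OF t(1)] test_schwartz[OF t(2)]
    have "w (\<lambda>x. \<phi> x + \<psi> x) = (LINT \<xi>|lborel. F \<xi> * inv_fourier (\<lambda>x. \<phi> x + \<psi> x) \<xi>)"
      by (rule F(2)) (use RS in \<open>auto intro: test_add t\<close>)
    also have "\<dots> = (LINT \<xi>|lborel. F \<xi> * inv_fourier \<phi> \<xi>) + (LINT \<xi>|lborel. F \<xi> * inv_fourier \<psi> \<xi>)"
      using fourier_rep_integrable[OF F(1) S(1)] fourier_rep_integrable[OF F(1) S(2)] by (simp add: inv_fourier_add[OF S] distrib_left)
    also have "(LINT \<xi>|lborel. F \<xi> * inv_fourier \<phi> \<xi>) = w \<phi>" by (rule F(2)[symmetric]) (use RS t in auto)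
    also have "(LINT \<xi>|lborel. F \<xi> * inv_fourier \<psi> \<xi>) = w \<psi>" by (rule F(2)[symmetric]) (use RS t in auto)
    finally show "w (\<lambda>x. \<phi> x + \<psi> x) = w \<phi> + w \<psi>" .
  next
    fix c and \<phi> :: "real^'n \<Rightarrow> complex" assume t: "\<phi> \<in> test_functions"
    obtain R where R: "\<And>x. norm x > R \<Longrightarrow> \<phi> x = 0" using t by (auto simp: test_functions_iff)
    obtain F where F: "L2 (weighted b s F)"
      "\<And>\<phi>. \<phi> \<in> test_functions \<Longrightarrow> (\<And>x. norm x > R \<Longrightarrow> \<phi> x = 0) \<Longrightarrow> w \<phi> = (LINT \<xi>|lborel. F \<xi> * inv_fourier \<phi> \<xi>)"
      using loc_sobolev_fourier_rep_on_ball[OF w, of R] by metis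
    have "w (\<lambda>x. c * \<phi> x) = (LINT \<xi>|lborel. F \<xi> * inv_fourier (\<lambda>x. c * \<phi> x) \<xi>)"
      by (rule F(2)) (use R in \<open>auto intro: test_mult t smooth_const\<close>)
    also have "\<dots> = c * (LINT \<xi>|lborel. F \<xi> * inv_fourier \<phi> \<xi>)"
      by (simp add: inv_fourier_cmult mult.left_commute)
    also have "(LINT \<xi>|lborel. F \<xi> * inv_fourier \<phi> \<xi>) = w \<phi>" by (rule F(2)[symmetric]) (use R t in auto)
    finally show "w (\<lambda>x. c * \<phi> x) = c * w \<phi>" .
  qed
  moreover have "\<exists>C N. \<forall>\<phi>\<in>test_functions. supp \<phi> \<subseteq> K \<longrightarrow>
      cmod (w \<phi>) \<le> C * (\<Sum>\<alpha> | length \<alpha> \<le> N. SUP x. cmod (partials \<alpha> \<phi> x))" if K: "compact K" for K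
  proof -
    obtain R0 where R0: "\<And>x. x \<in> K \<Longrightarrow> norm x \<le> R0"
      using compact_imp_bounded[OF K] unfolding bounded_iff by blast
    define R where "R = max R0 0"
    have R: "R \<ge> 0" "x \<in> K \<Longrightarrow> norm x \<le> R" for x using R0[of x] by (auto simp: R_def)
    obtain F where F: "F \<in> borel_measurable borel" "L2 (weighted b s F)"
      "\<And>\<phi>. \<phi> \<in> test_functions \<Longrightarrow> (\<And>x. norm x > R \<Longrightarrow> \<phi> x = 0) \<Longrightarrow> w \<phi> = (LINT \<xi>|lborel. F \<xi> * inv_fourier \<phi> \<xi>)"
      using loc_sobolev_fourier_rep_on_ball[OF w, of R] by metis
    obtain C N where C: "C \<ge> 0" "\<And>\<phi>. \<phi> \<in> schwartz_functions \<Longrightarrow> cmod (LINT \<xi>|lborel. F \<xi> * inv_fourier \<phi> \<xi>) \<le> C * schwartz_seminorm N \<phi>"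
      using fourier_density_continuous[OF F(1,2)] by blast
    have "cmod (w \<phi>) \<le> (C * (1 + R) ^ N) * (\<Sum>\<alpha> | length \<alpha> \<le> N. SUP x. cmod (partials \<alpha> \<phi> x))"
      if \<phi>: "\<phi> \<in> test_functions" and sub: "supp \<phi> \<subseteq> K" for \<phi>
    proof -
      have z: "\<phi> x = 0" if "norm x > R" for x
        using that sub R(2)[of x] closure_subset[of "{x. \<phi> x \<noteq> 0}"] by (force simp: supp_def)
      have S: "\<phi> \<in> schwartz_functions" by (rule test_schwartz[OF \<phi>])
      have "schwartz_seminorm N \<phi> \<le> (\<Sum>\<alpha> | length \<alpha> \<le> N. (1 + R) ^ N * (SUP x. cmod (partials \<alpha> \<phi> x)))"
        unfolding schwartz_seminorm_def
      proof (intro sum_mono cSUP_least)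
        fix \<alpha> :: "'n list" and x :: "real^'n"
        have "bdd_above (range (\<lambda>x. cmod (partials \<alpha> \<phi> x)))"
          using rapid_bdd[of "partials \<alpha> \<phi>" 0] S by (simp add: schwartz_functions_iff)
        then have le: "cmod (partials \<alpha> \<phi> x) \<le> (SUP x. cmod (partials \<alpha> \<phi> x))" for x
          by (intro cSUP_upper) auto
        have "0 \<le> (SUP x. cmod (partials \<alpha> \<phi> x))" by (rule order_trans[OF norm_ge_zero le])
        have "(1 + norm x) ^ N * cmod (partials \<alpha> \<phi> x) \<le> (1 + R) ^ N * cmod (partials \<alpha> \<phi> x)"
          using partials_zero_outside[of R \<phi> x \<alpha>, OF z] R(1)
          by (cases "norm x > R") (auto intro!: mult_right_mono power_mono)
        also have "\<dots> \<le> (1 + R) ^ N * (SUP x. cmod (partials \<alpha> \<phi> x))"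
          using R(1) by (intro mult_left_mono le) auto
        finally show "(1 + norm x) ^ N * cmod (partials \<alpha> \<phi> x) \<le> (1 + R) ^ N * (SUP x. cmod (partials \<alpha> \<phi> x))" .
      qed auto
      also have "\<dots> = (1 + R) ^ N * (\<Sum>\<alpha> | length \<alpha> \<le> N. SUP x. cmod (partials \<alpha> \<phi> x))"
        by (simp add: sum_distrib_left)
      finally have "C * schwartz_seminorm N \<phi> \<le> C * ((1 + R) ^ N * (\<Sum>\<alpha> | length \<alpha> \<le> N. SUP x. cmod (partials \<alpha> \<phi> x)))"
        by (rule mult_left_mono) (rule C(1))
      then show ?thesis using C(2)[OF S] F(3)[OF \<phi> z] by (simp add: mult.assoc)
    qed
    then show ?thesis by blast
  qed
  ultimately show ?thesis by (simp add: distributions_def)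
qed

section \<open>Lebesgue spaces and the product theorem\<close>

lemma Lp_space_borel:
  fixes f :: "'a::euclidean_space \<Rightarrow> real"
  assumes [measurable]: "f \<in> borel_measurable borel"
  shows "f \<in> Lp_space p \<longleftrightarrow> (if p = \<infinity> then \<exists>C. AE x in lborel. \<bar>f x\<bar> \<le> C
      else integrable lborel (\<lambda>x. \<bar>f x\<bar> powr enn2real p))"
proof -
  have "f \<in> borel_measurable lebesgue" by (intro measurable_completion) simp
  then show ?thesis by (simp add: Lp_space_def AE_completion_iff integrable_completion)
qed

lemma Lp_space_translate:
  fixes f :: "'a::euclidean_space \<Rightarrow> real"
  assumes f [measurable]: "f \<in> borel_measurable borel" and "f \<in> Lp_space p"
  shows "(\<lambda>x. f (a + x)) \<in> Lp_space p"
proof -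
  have AE: "AE x in lborel. \<bar>f (a + x)\<bar> \<le> C" if "AE x in lborel. \<bar>f x\<bar> \<le> C" for C
  proof -
    have "AE x in distr lborel borel ((+) a). \<bar>f x\<bar> \<le> C" using that by (subst lborel_distr_plus)
    then show ?thesis by (subst (asm) AE_distr_iff) auto
  qed
  have "integrable lborel (\<lambda>x. \<bar>f (a + x)\<bar> powr enn2real p)" if "integrable lborel (\<lambda>x. \<bar>f x\<bar> powr enn2real p)"
    using that integral_translate(1)[of "\<lambda>x. \<bar>f x\<bar> powr enn2real p" a] by simp
  then show ?thesis
    using assms(2) AE by (auto simp: Lp_space_borel split: if_splits)
qed

text \<open>For finite exponents this is Young's inequality for \<open>\<bar>f\<bar>\<^sup>p\<close> and \<open>\<bar>g\<bar>\<^sup>q\<close> with the weights \<open>r/p\<close> and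
  \<open>r/q\<close>; if \<open>p\<close> or \<open>q\<close> is infinite, then \<open>r\<close> is the other exponent.\<close>

lemma Hoelder_Lp_space:
  fixes f g h :: "'a::euclidean_space \<Rightarrow> real"
  assumes [measurable]: "f \<in> borel_measurable borel" "g \<in> borel_measurable borel" "h \<in> borel_measurable borel"
    and f: "f \<in> Lp_space p" and g: "g \<in> Lp_space q"
    and pqr: "1 \<le> p" "1 \<le> q" "1 \<le> r" "1 / p + 1 / q = 1 / r"
    and C: "C \<ge> 0" and h: "\<And>x. \<bar>h x\<bar> \<le> C * (\<bar>f x\<bar> * \<bar>g x\<bar>)"
  shows "h \<in> Lp_space r"
proof -
  have bounded_case: "k \<in> Lp_space r" if k [measurable]: "k \<in> borel_measurable borel" and l [measurable]: "l \<in> borel_measurable borel" "l \<in> Lp_space r"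
    and D: "D \<ge> 0" "AE x in lborel. \<bar>k x\<bar> \<le> D * \<bar>l x\<bar>" for k l :: "'a \<Rightarrow> real" and D
  proof (cases "r = \<infinity>")
    case True
    then obtain E where E: "AE x in lborel. \<bar>l x\<bar> \<le> E" using l by (auto simp: Lp_space_borel)
    have "AE x in lborel. \<bar>k x\<bar> \<le> D * E"
      using D(2) E by eventually_elim (use D(1) in \<open>auto intro: order_trans mult_left_mono\<close>)
    then show ?thesis using True by (auto simp: Lp_space_borel)
  next
    case False
    have "integrable lborel (\<lambda>x. D powr enn2real r * \<bar>l x\<bar> powr enn2real r)"
      using l False by (auto simp: Lp_space_borel)
    then have "integrable lborel (\<lambda>x. \<bar>k x\<bar> powr enn2real r)"
    proof (rule Bochner_Integration.integrable_bound)
      show "AE x in lborel. norm (\<bar>k x\<bar> powr enn2real r) \<le> norm (D powr enn2real r * \<bar>l x\<bar> powr enn2real r)"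
        using D(2)
      proof eventually_elim
        case (elim x)
        have "\<bar>k x\<bar> powr enn2real r \<le> (D * \<bar>l x\<bar>) powr enn2real r"
          using elim by (intro powr_mono2) auto
        also have "\<dots> = D powr enn2real r * \<bar>l x\<bar> powr enn2real r" using D(1) by (simp add: powr_mult)
        finally show ?case by simp
      qed
    qed measurable
    then show ?thesis using False by (simp add: Lp_space_borel)
  qed
  have inj: "a = c" if "1 \<le> a" "1 \<le> c" "inverse a = inverse c" for a c :: ennreal
  proof (cases "a = top \<or> c = top")
    case True
    then show ?thesis using that(3) by (metis ennreal_inverse_eq_0_iff)
  next
    case False
    obtain a' where a: "a = ennreal a'" using False by (cases a) auto
    obtain c' where c: "c = ennreal c'" using False by (cases c) auto
    have "a' \<ge> 1" "c' \<ge> 1" using that(1,2) by (auto simp: a c)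
    then show ?thesis using that(3) by (simp add: a c inverse_ennreal)
  qed
  have inv: "1 / a = inverse a" for a :: ennreal by (simp add: divide_ennreal_def)
  consider "p = \<infinity>" | "q = \<infinity>" | "p \<noteq> \<infinity>" "q \<noteq> \<infinity>" by blast
  then show ?thesis
  proof cases
    case 1
    then have "inverse q = inverse r" using pqr(4) by (simp add: inv)
    then have "q = r" by (rule inj[OF pqr(2,3)])
    obtain E where E: "AE x in lborel. \<bar>f x\<bar> \<le> E" using f 1 by (auto simp: Lp_space_borel)
    have "AE x in lborel. \<bar>h x\<bar> \<le> (C * max E 0) * \<bar>g x\<bar>"
      using E
    proof eventually_elim
      case (elim x)
      have "C * (\<bar>f x\<bar> * \<bar>g x\<bar>) \<le> C * (max E 0 * \<bar>g x\<bar>)"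
        using elim C by (intro mult_left_mono mult_right_mono) auto
      then show ?case using h[of x] by simp
    qed
    then show ?thesis using g C unfolding \<open>q = r\<close> by (intro bounded_case[of h g "C * max E 0"]) auto
  next
    case 2
    then have "inverse p = inverse r" using pqr(4) by (simp add: inv)
    then have "p = r" by (rule inj[OF pqr(1,3)])
    obtain E where E: "AE x in lborel. \<bar>g x\<bar> \<le> E" using g 2 by (auto simp: Lp_space_borel)
    have "AE x in lborel. \<bar>h x\<bar> \<le> (C * max E 0) * \<bar>f x\<bar>"
      using E
    proof eventually_elim
      case (elim x)
      have "C * (\<bar>f x\<bar> * \<bar>g x\<bar>) \<le> C * (\<bar>f x\<bar> * max E 0)"
        using elim C by (intro mult_left_mono) auto
      then show ?case using h[of x] by (simp add: mult_ac)
    qed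
    then show ?thesis using f C unfolding \<open>p = r\<close> by (intro bounded_case[of h f "C * max E 0"]) auto
  next
    case 3
    define p' q' r' where "p' = enn2real p" and "q' = enn2real q" and "r' = enn2real r"
    have p: "p = ennreal p'" and q: "q = ennreal q'" using 3 by (auto simp: p'_def q'_def less_top)
    have p1: "p' \<ge> 1" and q1: "q' \<ge> 1" using pqr(1,2) by (auto simp: p q)
    have "r \<noteq> \<infinity>"
    proof
      assume "r = \<infinity>"
      then have "1 / p = 0" using pqr(4) by simp
      then show False using 3 by (simp add: inv)
    qed
    then have r: "r = ennreal r'" by (simp add: r'_def less_top)
    have r1: "r' \<ge> 1" using pqr(3) by (simp add: r)
    have "ennreal (1 / p' + 1 / q') = ennreal (1 / r')"
      using pqr(4) p1 q1 r1 unfolding p q r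
      by (simp add: inv inverse_ennreal ennreal_plus[symmetric] inverse_eq_divide del: ennreal_plus)
    then have eq: "1 / p' + 1 / q' = 1 / r'" using p1 q1 r1 by (subst (asm) ennreal_inj) auto
    have eq': "r' / p' + r' / q' = 1" using arg_cong[OF eq, of "\<lambda>z. r' * z"] r1 by (simp add: distrib_left)
    have Y: "A powr (r' / p') * B powr (r' / q') \<le> r' / p' * A + r' / q' * B" if "A \<ge> 0" "B \<ge> 0" for A B
    proof (cases "A = 0 \<or> B = 0")
      case True
      then have "A powr (r' / p') * B powr (r' / q') = 0" by auto
      also have "0 \<le> r' / p' * A + r' / q' * B" using that p1 q1 r1 by (intro add_nonneg_nonneg mult_nonneg_nonneg) auto
      finally show ?thesis .
    next
      case False
      then show ?thesis using that p1 q1 r1 eq' by (intro Youngs_inequality_0) auto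
    qed
    have i: "integrable lborel (\<lambda>x. C powr r' * (r' / p' * \<bar>f x\<bar> powr p' + r' / q' * \<bar>g x\<bar> powr q'))"
      using f g 3 by (intro integrable_mult_right Bochner_Integration.integrable_add)
        (auto simp: Lp_space_borel p'_def q'_def)
    have "integrable lborel (\<lambda>x. \<bar>h x\<bar> powr r')"
    proof (rule Bochner_Integration.integrable_bound[OF i])
      show "AE x in lborel. norm (\<bar>h x\<bar> powr r') \<le> norm (C powr r' * (r' / p' * \<bar>f x\<bar> powr p' + r' / q' * \<bar>g x\<bar> powr q'))"
      proof (intro AE_I2)
        fix x
        have "\<bar>h x\<bar> powr r' \<le> (C * (\<bar>f x\<bar> * \<bar>g x\<bar>)) powr r'"
          using h[of x] r1 by (intro powr_mono2) auto
        also have "\<dots> = C powr r' * (\<bar>f x\<bar> powr r' * \<bar>g x\<bar> powr r')" using C by (simp add: powr_mult)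
        also have "\<bar>f x\<bar> powr r' * \<bar>g x\<bar> powr r' = (\<bar>f x\<bar> powr p') powr (r' / p') * (\<bar>g x\<bar> powr q') powr (r' / q')"
          using p1 q1 by (simp add: powr_powr)
        also have "C powr r' * ((\<bar>f x\<bar> powr p') powr (r' / p') * (\<bar>g x\<bar> powr q') powr (r' / q')) \<le>
            C powr r' * (r' / p' * \<bar>f x\<bar> powr p' + r' / q' * \<bar>g x\<bar> powr q')"
          by (intro mult_left_mono Y) auto
        finally show "norm (\<bar>h x\<bar> powr r') \<le> norm (C powr r' * (r' / p' * \<bar>f x\<bar> powr p' + r' / q' * \<bar>g x\<bar> powr q'))"
          by simp
      qed
    qed measurable
    then show ?thesis using \<open>r \<noteq> \<infinity>\<close> by (simp add: Lp_space_borel r'_def)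
  qed
qed

text \<open>The constant is the same for all windows, in particular for all translates of given ones.\<close>

lemma distr_prod_norm_bound:
  fixes b :: "'n::finite \<Rightarrow> 'j::finite"
  assumes e: "convolution_exponents b s t \<sigma> \<delta>"
  shows "\<exists>C\<ge>0. \<forall>u v. loc_sobolev b s u \<longrightarrow> loc_sobolev b t v \<longrightarrow> (\<forall>\<theta>1\<in>test_functions. \<forall>\<theta>2\<in>test_functions.
     sobolev_norm b \<sigma> (fun_mult (\<lambda>x. \<theta>1 x * \<theta>2 x) (distr_prod b s u v)) \<le>
       C * (sobolev_norm b s (fun_mult \<theta>1 u) * sobolev_norm b t (fun_mult \<theta>2 v)))"
proof -
  obtain C where C: "C \<ge> 0" "\<And>F G. F \<in> borel_measurable borel \<Longrightarrow> G \<in> borel_measurable borel \<Longrightarrow> L2 (weighted b s F) \<Longrightarrow> L2 (weighted b t G) \<Longrightarrow>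
     sqnorm (weighted b \<sigma> (convolution F G)) \<le> C * (sqnorm (weighted b s F) * sqnorm (weighted b t G))"
    using convolution_bound[OF e] by blast
  define Q where "Q = (2 * pi) ^ CARD('n)"
  have Q: "Q > 0" by (simp add: Q_def)
  have "sobolev_norm b \<sigma> (fun_mult (\<lambda>x. \<theta>1 x * \<theta>2 x) (distr_prod b s u v)) \<le>
       sqrt (C / Q) * (sobolev_norm b s (fun_mult \<theta>1 u) * sobolev_norm b t (fun_mult \<theta>2 v))"
    if u: "loc_sobolev b s u" and v: "loc_sobolev b t v" and \<theta>: "\<theta>1 \<in> test_functions" "\<theta>2 \<in> test_functions" for u v \<theta>1 \<theta>2
  proof -
    obtain F where F: "fourier_rep b s (fun_mult \<theta>1 u) F" using loc_sobolev_fourier_rep[OF u \<theta>(1)] by blast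
    obtain G where G: "fourier_rep b t (fun_mult \<theta>2 v) G" using loc_sobolev_fourier_rep[OF v \<theta>(2)] by blast
    have n: "sqnorm (weighted b \<sigma> (\<lambda>\<xi>. convolution F G \<xi> / of_real Q)) = sqnorm (weighted b \<sigma> (convolution F G)) / Q\<^sup>2"
      using Q by (simp add: sqnorm_def weighted_def norm_mult norm_divide power_divide power_mult_distrib times_divide_eq_right)
    have "sobolev_norm b \<sigma> (fun_mult (\<lambda>x. \<theta>1 x * \<theta>2 x) (distr_prod b s u v)) = sqrt (sqnorm (weighted b \<sigma> (convolution F G)) / Q\<^sup>2 / Q)"
      unfolding fourier_rep_sobolev(2)[OF distr_prod_fourier_rep[OF e u v \<theta> F G]] Q_def[symmetric] n ..
    also have "\<dots> \<le> sqrt ((C * (sqnorm (weighted b s F) * sqnorm (weighted b t G))) / Q\<^sup>2 / Q)"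
      using C(2)[OF fourier_repD(1)[OF F] fourier_repD(1)[OF G] fourier_repD(2)[OF F] fourier_repD(2)[OF G]] Q
      by (intro real_sqrt_le_mono divide_right_mono) auto
    also have "(C * (sqnorm (weighted b s F) * sqnorm (weighted b t G))) / Q\<^sup>2 / Q = (C / Q) * ((sqnorm (weighted b s F) / Q) * (sqnorm (weighted b t G) / Q))"
      using Q by (simp add: power2_eq_square)
    also have "sqrt \<dots> = sqrt (C / Q) * (sobolev_norm b s (fun_mult \<theta>1 u) * sobolev_norm b t (fun_mult \<theta>2 v))"
      unfolding fourier_rep_sobolev(2)[OF F] fourier_rep_sobolev(2)[OF G] Q_def[symmetric] by (simp only: real_sqrt_mult)
    finally show ?thesis .
  qed
  moreover have "sqrt (C / Q) \<ge> 0" using C Q by simp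
  ultimately show ?thesis by blast
qed

theorem proposition3p7:
  fixes b :: "'n::finite \<Rightarrow> 'j::finite"
    and s t \<epsilon> \<sigma> :: "real^'j"
    and p q r :: ennreal
  assumes "surj b"
    and "\<And>l. s $ l + t $ l > real (block_dim b l) / 2"
    and "\<And>l. 0 < \<epsilon> $ l \<and> \<epsilon> $ l < s $ l + t $ l - real (block_dim b l) / 2"
    and "\<And>l. \<sigma> $ l = Min {s $ l, t $ l, s $ l + t $ l - real (block_dim b l) / 2 - \<epsilon> $ l}"
    and "1 \<le> p" "1 \<le> q" "1 \<le> r"
    and "1 / p + 1 / q = 1 / r"
  shows "\<forall>u\<in>kato_sobolev b p s. \<forall>v\<in>kato_sobolev b q t. distr_prod b s u v \<in> kato_sobolev b r \<sigma>"
proof (intro ballI)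
  fix u v assume u: "u \<in> kato_sobolev b p s" and v: "v \<in> kato_sobolev b q t"
  \<comment> \<open>The exponent \<open>\<delta>\<close> of the kernel estimate.\<close>
  have e: "convolution_exponents b s t \<sigma> (\<chi> l. block_dim b l / 2 + \<epsilon> $ l)"
    unfolding convolution_exponents_def
  proof
    fix l
    have "\<sigma> $ l \<le> s $ l" "\<sigma> $ l \<le> t $ l" "\<sigma> $ l \<le> s $ l + t $ l - real (block_dim b l) / 2 - \<epsilon> $ l"
      unfolding assms(4) by (auto intro!: Min_le)
    then show "block_dim b l / 2 < (\<chi> l. block_dim b l / 2 + \<epsilon> $ l) $ l \<and> (\<chi> l. block_dim b l / 2 + \<epsilon> $ l) $ l \<le> s $ l + t $ l \<and>
     \<sigma> $ l \<le> s $ l \<and> \<sigma> $ l \<le> t $ l \<and> \<sigma> $ l \<le> s $ l + t $ l - (\<chi> l. block_dim b l / 2 + \<epsilon> $ l) $ l"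
      using assms(3)[of l] by auto
  qed
  obtain \<theta>1 where \<theta>1: "\<theta>1 \<in> test_functions" "\<theta>1 \<noteq> (\<lambda>x. 0)" "\<And>y. fun_mult (translate y \<theta>1) u \<in> sobolev_space b s"
    "(\<lambda>y. sobolev_norm b s (fun_mult (translate y \<theta>1) u)) \<in> Lp_space p" and ul: "linear_functional_on test_functions u"
    using u by (auto simp: kato_sobolev_def distributions_def)
  obtain \<theta>2 where \<theta>2: "\<theta>2 \<in> test_functions" "\<theta>2 \<noteq> (\<lambda>x. 0)" "\<And>y. fun_mult (translate y \<theta>2) v \<in> sobolev_space b t"
    "(\<lambda>y. sobolev_norm b t (fun_mult (translate y \<theta>2) v)) \<in> Lp_space q" and vl: "linear_functional_on test_functions v"
    using v by (auto simp: kato_sobolev_def distributions_def)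
  obtain x1 where x1: "\<theta>1 x1 \<noteq> 0" using \<theta>1(2) by auto
  obtain x2 where x2: "\<theta>2 x2 \<noteq> 0" using \<theta>2(2) by auto
  have lu: "loc_sobolev b s u"
    unfolding loc_sobolev_def using local_sobolev[OF ul \<theta>1(1) x1 \<theta>1(3)] by blast
  have lv: "loc_sobolev b t v"
    unfolding loc_sobolev_def using local_sobolev[OF vl \<theta>2(1) x2 \<theta>2(3)] by blast
  let ?w = "distr_prod b s u v"
  have lw: "loc_sobolev b \<sigma> ?w" by (rule distr_prod_loc_sobolev[OF e lu lv])
  define \<theta> where "\<theta> = (\<lambda>x. translate (- x1) \<theta>1 x * translate (- x2) \<theta>2 x)"
  have \<theta>: "\<theta> \<in> test_functions" unfolding \<theta>_def
    by (intro test_mult test_smooth test_translate \<theta>1 \<theta>2)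
  have "\<theta> 0 \<noteq> 0" using x1 x2 by (simp add: \<theta>_def translate_def)
  then have \<theta>0: "\<theta> \<noteq> (\<lambda>x. 0)" by auto
  define N1 where "N1 = (\<lambda>y. sobolev_norm b s (fun_mult (translate y \<theta>1) u))"
  define N2 where "N2 = (\<lambda>y. sobolev_norm b t (fun_mult (translate y \<theta>2) v))"
  define N where "N = (\<lambda>y. sobolev_norm b \<sigma> (fun_mult (translate y \<theta>) ?w))"
  have [measurable]: "N1 \<in> borel_measurable borel" "N2 \<in> borel_measurable borel" "N \<in> borel_measurable borel"
    unfolding N1_def N2_def N_def
    by (intro sobolev_norm_translate_borel lu lv lw \<theta>1 \<theta>2 \<theta>)+
  obtain C where C: "C \<ge> 0" "\<And>\<theta>1 \<theta>2. \<theta>1\<in>test_functions \<Longrightarrow> \<theta>2\<in>test_functions \<Longrightarrow>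
     sobolev_norm b \<sigma> (fun_mult (\<lambda>x. \<theta>1 x * \<theta>2 x) ?w) \<le>
       C * (sobolev_norm b s (fun_mult \<theta>1 u) * sobolev_norm b t (fun_mult \<theta>2 v))"
    using distr_prod_norm_bound[OF e] lu lv by blast
  have N_nonneg: "N y \<ge> 0" for y
    by (simp add: N_def sobolev_norm_def L2_norm_def)
  have bound: "\<bar>N y\<bar> \<le> C * (\<bar>N1 (- x1 + y)\<bar> * \<bar>N2 (- x2 + y)\<bar>)" for y
  proof -
    have "translate y \<theta> = (\<lambda>x. translate (- x1 + y) \<theta>1 x * translate (- x2 + y) \<theta>2 x)"
      by (simp add: \<theta>_def translate_def algebra_simps)
    then have "N y \<le> C * (N1 (- x1 + y) * N2 (- x2 + y))"
      unfolding N_def N1_def N2_def using C(2)[OF test_translate[OF \<theta>1(1)] test_translate[OF \<theta>2(1)]] by simp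
    also have "\<dots> \<le> C * (\<bar>N1 (- x1 + y)\<bar> * \<bar>N2 (- x2 + y)\<bar>)"
      unfolding abs_mult[symmetric] by (intro mult_left_mono C(1) abs_ge_self)
    finally show ?thesis using N_nonneg[of y] by simp
  qed
  have "N \<in> Lp_space r"
  proof (rule Hoelder_Lp_space[OF _ _ _ _ _ assms(5-8) C(1) bound])
    show "(\<lambda>y. N1 (- x1 + y)) \<in> Lp_space p"
      by (rule Lp_space_translate) (use \<theta>1(4) in \<open>simp_all add: N1_def[symmetric]\<close>)
    show "(\<lambda>y. N2 (- x2 + y)) \<in> Lp_space q"
      by (rule Lp_space_translate) (use \<theta>2(4) in \<open>simp_all add: N2_def[symmetric]\<close>)
  qed measurable
  moreover have "fun_mult (translate y \<theta>) ?w \<in> sobolev_space b \<sigma>" for y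
    using lw test_translate[OF \<theta>] by (simp add: loc_sobolev_def)
  moreover have "?w \<in> distributions" by (rule loc_sobolev_distribution[OF lw])
  ultimately show "?w \<in> kato_sobolev b r \<sigma>"
    using \<theta> \<theta>0 unfolding kato_sobolev_def N_def by blast
qed

end
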